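(* Let $H,H'$ be complex Hadamard matrices of the same size $n$ all of whose entries are $s$-th roots of unity ($s\in\mathbb N$). If $H$ and $H'$ are $s$-quantum equivalent, then the graphs $\Gamma_H$ and $\Gamma_{H'}$ are quantum isomorphic in the commuting operator framework (the graph isomorphism game for $\Gamma_H,\Gamma_{H'}$ has a perfect quantum commuting strategy).
   Context: A (complex) Hadamard matrix of size $n$ is $H\in M_n(\mathbb C)$ with entries of modulus one and $HH^\dagger=nI$. Let $\omega=e^{2\pi i/s}$. For a unital $*$-algebra $\mathcal A$, $u=(u_{ij})\in M_n(\mathcal A)$ is an order-$s$ quantum reflection matrix if $u$ and $\bar u=(u_{ij}^* )$ are unitary, each $u_{ij}$ is a normal partial isometry, and $u_{ij}^s=u_{ij}u_{ij}^*$. $H,H'$ are $s$-quantum equivalent if there are order-$s$ quantum reflection matrices $p,q$ over a common non-zero unital $C^*$-algebra with $H'q=pH$. The Hadamard graph $\Gamma_H$ is the bipartite graph with vertex set $\{(r_i,\omega^k)\}\sqcup\{(c_j,\omega^l)\}$, $1\le i,j\le n$, $k,l\in\mathbb Z_s$, and adjacency $(r_i,\omega^k)\sim(c_j,\omega^l)\iff\omega^kH_{ij}=\omega^l$ (no edges inside the two parts). The graph isomorphism game for two graphs is the standard synchronous non-local game whose game algebra is the universal unital $*$-algebra generated by the entries of a magic unitary $U$ (entries are self-adjoint projections, rows and columns sum to $1$) satisfying $AU=UA'$, where $A,A'$ are the adjacency matrices of the two graphs. It is a known fact that non-vanishing of this algebra is equivalent to existence of a perfect quantum commuting (qc) strategy.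 *)

theory Defs
  imports "HOL-Analysis.Analysis" "HOL-Algebra.Algebraic_Closure_Type" "Graph_Theory.Pair_Digraph"
begin

no_notation fps_nth (infixl \<open>$\<close> 75)

section \<open>Unital C*-algebras\<close>

class scaleC =
  fixes scaleC :: "complex \<Rightarrow> 'a \<Rightarrow> 'a"  (infixr \<open>*\<^sub>C\<close> 75)

class star =
  fixes star :: "'a \<Rightarrow> 'a"

class complex_star_algebra_1 = ring_1 + scaleC + star +
  assumes scaleC_add_right: "c *\<^sub>C (x + y) = c *\<^sub>C x + c *\<^sub>C y"
    and scaleC_add_left: "(c + d) *\<^sub>C x = c *\<^sub>C x + d *\<^sub>C x"
    and scaleC_scaleC: "c *\<^sub>C (d *\<^sub>C x) = (c * d) *\<^sub>C x"
    and scaleC_one: "1 *\<^sub>C x = x"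
    and mult_scaleC_left: "(c *\<^sub>C x) * y = c *\<^sub>C (x * y)"
    and mult_scaleC_right: "x * (c *\<^sub>C y) = c *\<^sub>C (x * y)"
    and star_add: "star (x + y) = star x + star y"
    and star_scaleC: "star (c *\<^sub>C x) = cnj c *\<^sub>C star x"
    and star_mult: "star (x * y) = star y * star x"
    and star_star: "star (star x) = x"

text \<open>
  The axiom \<^prop>\<open>(0::'a::zero_neq_one) \<noteq> 1\<close>, inherited from \<^class>\<open>ring_1\<close>,
  makes all algebras below non-zero.
\<close>

class unital_cstar_algebra = complex_star_algebra_1 + real_normed_algebra_1 + banach +
  assumes scaleR_scaleC: "r *\<^sub>R x = complex_of_real r *\<^sub>C x"
    and norm_scaleC: "norm (c *\<^sub>C x) = cmod c * norm x"
    and cstar_identity: "norm (star x * x) = (norm x)\<^sup>2"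


section \<open>Hadamard matrices and quantum equivalence\<close>

definition complex_hadamard :: "complex^'n^'n \<Rightarrow> bool" where
  "complex_hadamard H \<longleftrightarrow>
     (\<forall>i j. cmod (H $ i $ j) = 1) \<and>
     H ** transpose (map_matrix cnj H) = mat (of_nat CARD('n))"

definition unitary_matrix :: "'a::complex_star_algebra_1^'n^'n \<Rightarrow> bool" where
  "unitary_matrix u \<longleftrightarrow>
     u ** transpose (map_matrix star u) = mat 1 \<and> transpose (map_matrix star u) ** u = mat 1"

definition normal_element :: "'a::complex_star_algebra_1 \<Rightarrow> bool" where
  "normal_element x \<longleftrightarrow> x * star x = star x * x"

definition partial_isometry :: "'a::complex_star_algebra_1 \<Rightarrow> bool" where
  "partial_isometry x \<longleftrightarrow> x * star x * x = x"

definition quantum_reflection_matrix ::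
    "nat \<Rightarrow> 'a::complex_star_algebra_1^'n^'n \<Rightarrow> bool" where
  "quantum_reflection_matrix s u \<longleftrightarrow>
     unitary_matrix u \<and> unitary_matrix (map_matrix star u) \<and>
     (\<forall>i j. normal_element (u $ i $ j) \<and> partial_isometry (u $ i $ j) \<and>
            (u $ i $ j) ^ s = u $ i $ j * star (u $ i $ j))"

text \<open>
  HOL cannot quantify existentially over types, so the C*-algebra is a type argument.
  As a hypothesis with a free type variable, this amounts to the existence of some
  non-zero unital C*-algebra with the required matrices.
\<close>

definition quantum_equivalent_over ::
    "'a::unital_cstar_algebra itself \<Rightarrow> nat \<Rightarrow> complex^'n^'n \<Rightarrow> complex^'n^'n \<Rightarrow> bool" where
  "quantum_equivalent_over TYPE('a) s H H' \<longleftrightarrow>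
     (\<exists>p q :: 'a^'n^'n.
        quantum_reflection_matrix s p \<and> quantum_reflection_matrix s q \<and>
        map_matrix (\<lambda>c. c *\<^sub>C 1) H' ** q = p ** map_matrix (\<lambda>c. c *\<^sub>C 1) H)"


section \<open>Hadamard graphs\<close>

definition root_of_unity :: "nat \<Rightarrow> complex" where
  "root_of_unity s = exp (2 * of_real pi * \<i> / of_nat s)"

datatype 'n hadamard_vertex = Row 'n complex | Col 'n complex

definition hadamard_graph ::
    "nat \<Rightarrow> complex^'n^'n \<Rightarrow> 'n hadamard_vertex pair_pre_digraph" where
  "hadamard_graph s H =
    (let \<omega> = root_of_unity s;
         E = {(Row i (\<omega> ^ k), Col j (\<omega> ^ l)) | i j k l. k < s \<and> l < s \<and> \<omega> ^ k * H $ i $ j = \<omega> ^ l}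
     in \<lparr> pverts = {Row i (\<omega> ^ k) | i k. k < s} \<union> {Col j (\<omega> ^ l) | j l. l < s},
          parcs = E \<union> E\<inverse> \<rparr>)"

lemma pair_graph_hadamard_graph: "pair_graph (hadamard_graph s (H :: complex^'n^'n))"
proof
  show fin: "finite (pverts (hadamard_graph s H))"
  proof (rule finite_subset)
    show "pverts (hadamard_graph s H) \<subseteq>
        (\<lambda>(i, k). Row i (root_of_unity s ^ k)) ` (UNIV \<times> {..<s}) \<union>
        (\<lambda>(j, l). Col j (root_of_unity s ^ l)) ` (UNIV \<times> {..<s})"
      by (auto simp: hadamard_graph_def Let_def)
  qed simp
  have "parcs (hadamard_graph s H) \<subseteq> pverts (hadamard_graph s H) \<times> pverts (hadamard_graph s H)"
    by (auto simp: hadamard_graph_def Let_def)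
  then show "finite (parcs (hadamard_graph s H))"
    using fin by (meson finite_SigmaI finite_subset)
qed (auto simp: hadamard_graph_def Let_def symmetric_def intro!: symI)


section \<open>Hilbert spaces\<close>

text \<open>
  Vectors live in an explicit carrier, because the quantum commuting strategies below quantify
  existentially over Hilbert spaces.
  The fields \<open>mult\<close> and \<open>one\<close>, which \<^typ>\<open>('a, 'b) module\<close> inherits from rings, play no role.
  The inner product is linear in its second argument.
\<close>

record 'h inner_module = "(complex, 'h) module" +
  inner_prod :: "'h \<Rightarrow> 'h \<Rightarrow> complex"

definition vec_norm :: "('h, 'm) inner_module_scheme \<Rightarrow> 'h \<Rightarrow> real" where
  "vec_norm K v = sqrt (Re (inner_prod K v v))"

locale complex_hilbert_space = module ring_of_type_algebra K
  for K :: "('h, 'm) inner_module_scheme" (structure) +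
  assumes inner_prod_add: "\<lbrakk>u \<in> carrier K; v \<in> carrier K; w \<in> carrier K\<rbrakk>
      \<Longrightarrow> inner_prod K u (v \<oplus> w) = inner_prod K u v + inner_prod K u w"
    and inner_prod_smult: "\<lbrakk>u \<in> carrier K; v \<in> carrier K\<rbrakk>
      \<Longrightarrow> inner_prod K u (c \<odot> v) = c * inner_prod K u v"
    and inner_prod_commute: "\<lbrakk>u \<in> carrier K; v \<in> carrier K\<rbrakk>
      \<Longrightarrow> inner_prod K v u = cnj (inner_prod K u v)"
    and inner_prod_pos: "\<lbrakk>v \<in> carrier K; v \<noteq> \<zero>\<rbrakk> \<Longrightarrow> Re (inner_prod K v v) > 0"
    and complete: "\<lbrakk>\<And>n. f n \<in> carrier K;
        \<And>e. e > 0 \<Longrightarrow> \<exists>N. \<forall>m\<ge>N. \<forall>n\<ge>N. vec_norm K (f m \<ominus> f n) < e\<rbrakk>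
      \<Longrightarrow> \<exists>x\<in>carrier K. (\<lambda>n. vec_norm K (f n \<ominus> x)) \<longlonglongrightarrow> 0"

definition bounded_operator :: "('h, 'm) inner_module_scheme \<Rightarrow> ('h \<Rightarrow> 'h) \<Rightarrow> bool" where
  "bounded_operator K T \<longleftrightarrow>
     T \<in> carrier K \<rightarrow> carrier K \<and>
     (\<forall>v\<in>carrier K. \<forall>w\<in>carrier K. T (v \<oplus>\<^bsub>K\<^esub> w) = T v \<oplus>\<^bsub>K\<^esub> T w) \<and>
     (\<forall>c. \<forall>v\<in>carrier K. T (c \<odot>\<^bsub>K\<^esub> v) = c \<odot>\<^bsub>K\<^esub> T v) \<and>
     (\<exists>B. \<forall>v\<in>carrier K. vec_norm K (T v) \<le> B * vec_norm K v)"

definition projection :: "('h, 'm) inner_module_scheme \<Rightarrow> ('h \<Rightarrow> 'h) \<Rightarrow> bool" where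
  "projection K P \<longleftrightarrow>
     bounded_operator K P \<and>
     (\<forall>v\<in>carrier K. P (P v) = P v) \<and>
     (\<forall>v\<in>carrier K. \<forall>w\<in>carrier K. inner_prod K (P v) w = inner_prod K v (P w))"

text \<open>Mutual orthogonality of the projections follows from their summing to the identity.\<close>

definition pvm :: "('h, 'm) inner_module_scheme \<Rightarrow> 'o set \<Rightarrow> ('o \<Rightarrow> 'h \<Rightarrow> 'h) \<Rightarrow> bool" where
  "pvm K A E \<longleftrightarrow>
     finite A \<and> (\<forall>a\<in>A. projection K (E a)) \<and>
     (\<forall>v\<in>carrier K. (\<Oplus>\<^bsub>K\<^esub>a\<in>A. E a v) = v)"


section \<open>Non-local games and quantum commuting strategies\<close>

text \<open>Both players share the question set and the answer set, as in a synchronous game.\<close>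

record ('x, 'a) nonlocal_game =
  questions :: "'x set"
  answers :: "'a set"
  wins :: "'x \<Rightarrow> 'x \<Rightarrow> 'a \<Rightarrow> 'a \<Rightarrow> bool"  \<comment> \<open>questions \<open>x\<close>, \<open>y\<close>, then answers \<open>a\<close>, \<open>b\<close>\<close>

definition perfect_qc_strategy ::
    "('x, 'a) nonlocal_game \<Rightarrow> ('h, 'm) inner_module_scheme \<Rightarrow> 'h \<Rightarrow>
     ('x \<Rightarrow> 'a \<Rightarrow> 'h \<Rightarrow> 'h) \<Rightarrow> ('x \<Rightarrow> 'a \<Rightarrow> 'h \<Rightarrow> 'h) \<Rightarrow> bool" where
  "perfect_qc_strategy G K \<psi> E F \<longleftrightarrow>
     complex_hilbert_space K \<and> \<psi> \<in> carrier K \<and> vec_norm K \<psi> = 1 \<and>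
     (\<forall>x\<in>questions G. pvm K (answers G) (E x)) \<and>
     (\<forall>y\<in>questions G. pvm K (answers G) (F y)) \<and>
     (\<forall>x\<in>questions G. \<forall>y\<in>questions G. \<forall>a\<in>answers G. \<forall>b\<in>answers G.
        (\<forall>v\<in>carrier K. E x a (F y b v) = F y b (E x a v)) \<and>
        (\<not> wins G x y a b \<longrightarrow> inner_prod K \<psi> (E x a (F y b \<psi>)) = 0))"

text \<open>
  The type of \<open>K\<close> restricts the cardinality of the Hilbert space to that of the continuum.
  For finite question and answer sets this loses no generality: a strategy restricts to the closed
  subspace generated by \<open>\<psi>\<close> under all \<open>E x a\<close> and \<open>F y b\<close>, which is separable, and a
  separable Hilbert space has a copy whose carrier is a subset of \<^typ>\<open>nat \<Rightarrow> complex\<close>.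
\<close>

definition has_perfect_qc_strategy :: "('x, 'a) nonlocal_game \<Rightarrow> bool" where
  "has_perfect_qc_strategy G \<longleftrightarrow>
     (\<exists>(K :: (nat \<Rightarrow> complex) inner_module) \<psi> E F. perfect_qc_strategy G K \<psi> E F)"

text \<open>
  Questions and answers are the vertices of both graphs, tagged \<^const>\<open>Inl\<close> and \<^const>\<open>Inr\<close>.
  To win, each player must answer with a vertex of the graph other than the one their question
  comes from, and the two \<open>G\<close>-vertices thus in play must be related (equal, adjacent,
  or distinct and non-adjacent) exactly as the two \<open>H\<close>-vertices are.
\<close>

definition graph_isomorphism_game ::
    "'v pair_pre_digraph \<Rightarrow> 'w pair_pre_digraph \<Rightarrow> ('v + 'w, 'v + 'w) nonlocal_game" where
  "graph_isomorphism_game G H =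
    \<lparr> questions = Inl ` pverts G \<union> Inr ` pverts H,
      answers = Inl ` pverts G \<union> Inr ` pverts H,
      wins = (\<lambda>x y a b. \<exists>g h g' h'.
        {x, a} = {Inl g, Inr h} \<and> {y, b} = {Inl g', Inr h'} \<and>
        (g = g' \<longleftrightarrow> h = h') \<and> ((g, g') \<in> parcs G \<longleftrightarrow> (h, h') \<in> parcs H)) \<rparr>"

definition qc_isomorphic :: "'v pair_pre_digraph \<Rightarrow> 'w pair_pre_digraph \<Rightarrow> bool" where
  "qc_isomorphic G H \<longleftrightarrow> has_perfect_qc_strategy (graph_isomorphism_game G H)"

end

theory Submission
  imports Defs
begin

text \<open>
  The spectral projections of the entries of \<open>p\<close> and \<open>q\<close> form a magic unitary \<open>U\<close> indexed by
  the vertices of the two graphs, and \<open>H' q = p H\<close> says that \<open>U\<close> intertwines the adjacency matrices.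
  A perfect commuting strategy needs a trace on the algebra generated by the entries of \<open>U\<close>. The given
  C*-algebra need not carry one, but the universal algebra does, namely its invariant (Haar)
  functional, which depends only on fixed vectors: on words of length \<open>k\<close> it is the matrix that sends
  every vector \<open>v\<close> with \<open>U\<^sup>\<otimes>\<^sup>k v = w\<cdot>1\<close> to \<open>w\<close> and annihilates the orthogonal complement of these
  vectors. Fixed vectors are stable under rotating the tensor factors, which makes the functional
  tracial. For positivity, the functional on words of length \<open>2 k\<close>, read as a matrix on pairs of words
  of length \<open>k\<close>, satisfies \<open>\<Pi>\<^sup>2 = \<Pi> R\<close> for a positive definite \<open>R\<close>. In the GNS space of the trace, left
  and right multiplication by the letters are commuting projections, and they form the strategy.
\<close>

section \<open>Star algebras\<close>

text \<open>The C*-norm serves only to make the projections in a row or column orthogonal. From the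
  locale \<open>magic_unitary\<close> on, a non-zero star algebra is enough: non-vanishing enters
  through the fact that multiples \<open>c 1\<close> and \<open>d 1\<close> of the unit agree only
  if \<open>c = d\<close>, so that a fixed vector \<open>v\<close> determines its partner
  \<open>w\<close>. The trace is needed because both players act on one space. For the inner product
  \<open>tau (a * star b)\<close>, right multiplication by a projection is symmetric at once, left
  multiplication only because \<open>tau\<close> is tracial. With \<open>\<psi>\<close> the class of
  1, a pair of answers has amplitude \<open>tau (U g h * U g' h')\<close>, so the product relations
  alone exclude the losing pairs. Rotation works because the entries of \<open>U\<close> are
  self-adjoint: \<open>U\<close> and its entrywise adjoint are both unitary, and a tensor factor can
  be moved from the front to the back. No state on the given algebra is used for positivity. Fixed
  vectors on pairs of words are pairs of matrices with \<open>U v = w U\<close>; these are closed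
  under products and adjoints and contain the identity, which yields both the relation between
  \<open>\<Pi>\<close> and \<open>R\<close> and the definiteness of \<open>R\<close>.\<close>

lemma scaleC_zero_left [simp]: "0 *\<^sub>C (x::'a::complex_star_algebra_1) = 0"
  using scaleC_add_left[of 0 0 x] by simp

lemma scaleC_zero_right [simp]: "c *\<^sub>C (0::'a::complex_star_algebra_1) = 0"
  using scaleC_add_right[of c 0 0] by simp

lemma scaleC_one' [simp]: "1 *\<^sub>C (x::'a::complex_star_algebra_1) = x"
  by (rule scaleC_one)

lemma scaleC_minus_left: "(- c) *\<^sub>C (x::'a::complex_star_algebra_1) = - (c *\<^sub>C x)"
  using scaleC_add_left[of c "-c" x] by (simp add: eq_neg_iff_add_eq_0 add.commute)

lemma scaleC_diff_left: "(c - d) *\<^sub>C (x::'a::complex_star_algebra_1) = c *\<^sub>C x - d *\<^sub>C x"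
  using scaleC_add_left[of c "-d" x] by (simp add: scaleC_minus_left)

lemma scaleC_minus_right: "c *\<^sub>C (- x::'a::complex_star_algebra_1) = - (c *\<^sub>C x)"
  using scaleC_add_right[of c x "-x"] by (simp add: eq_neg_iff_add_eq_0 add.commute)

lemma scaleC_diff_right: "c *\<^sub>C (x - y::'a::complex_star_algebra_1) = c *\<^sub>C x - c *\<^sub>C y"
  using scaleC_add_right[of c x "-y"] by (simp add: scaleC_minus_right)

lemma scaleC_sum_right: "c *\<^sub>C (\<Sum>i\<in>A. f i :: 'a::complex_star_algebra_1) = (\<Sum>i\<in>A. c *\<^sub>C f i)"
  by (induction A rule: infinite_finite_induct) (auto simp: scaleC_add_right)

lemma scaleC_sum_left: "(\<Sum>i\<in>A. f i) *\<^sub>C (x :: 'a::complex_star_algebra_1) = (\<Sum>i\<in>A. f i *\<^sub>C x)"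
  by (induction A rule: infinite_finite_induct) (auto simp: scaleC_add_left)

lemma scaleC_eq_0_iff [simp]: "c *\<^sub>C (x::'a::complex_star_algebra_1) = 0 \<longleftrightarrow> c = 0 \<or> x = 0"
proof -
  have "x = inverse c *\<^sub>C (c *\<^sub>C x)" if "c \<noteq> 0"
    using that by (simp add: scaleC_scaleC)
  then show ?thesis by (metis scaleC_zero_left scaleC_zero_right)
qed

lemma scaleC_one_inject [simp]:
  "c *\<^sub>C (1::'a::complex_star_algebra_1) = d *\<^sub>C 1 \<longleftrightarrow> c = d"
  using scaleC_eq_0_iff[of "c - d" "1::'a"] by (simp add: scaleC_diff_left)

lemma star_zero [simp]: "star (0::'a::complex_star_algebra_1) = 0"
  using star_add[of 0 "0::'a"] by simp

lemma star_one [simp]: "star (1::'a::complex_star_algebra_1) = 1"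
  by (metis star_mult star_star mult.left_neutral mult.right_neutral)

lemma star_eq_0_iff [simp]: "star (x::'a::complex_star_algebra_1) = 0 \<longleftrightarrow> x = 0"
  by (metis star_star star_zero)

lemma star_minus: "star (- x::'a::complex_star_algebra_1) = - star x"
  using star_add[of x "-x"] by (simp add: eq_neg_iff_add_eq_0 add.commute)

lemma star_diff: "star (x - y::'a::complex_star_algebra_1) = star x - star y"
  using star_add[of x "-y"] by (simp add: star_minus)

lemma star_sum: "star (\<Sum>i\<in>A. f i :: 'a::complex_star_algebra_1) = (\<Sum>i\<in>A. star (f i))"
  by (induction A rule: infinite_finite_induct) (auto simp: star_add)

lemma star_power: "star ((x::'a::complex_star_algebra_1) ^ m) = star x ^ m"
  by (induction m) (auto simp: star_mult power_commutes)

lemma selfadjoint_of_star_mult_self: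
  fixes e :: "'a::complex_star_algebra_1"
  assumes "star e * e = e"
  shows "star e = e"
  by (metis assms star_mult star_star)


section \<open>Projections summing to one in a C*-algebra\<close>

lemma norm_star [simp]: "norm (star x) = norm (x::'a::unital_cstar_algebra)"
proof -
  have le: "norm y \<le> norm (star y)" for y :: 'a
  proof (cases "y = 0")
    case False
    have "norm y * norm y \<le> norm (star y) * norm y"
      by (metis cstar_identity norm_mult_ineq power2_eq_square)
    then show ?thesis using False by simp
  qed auto
  show ?thesis using le[of x] le[of "star x"] by (simp add: star_star)
qed

lemma star_mult_self_eq_0_iff [simp]: "star x * x = 0 \<longleftrightarrow> x = (0::'a::unital_cstar_algebra)"
  using cstar_identity[of x] by auto

lemma norm_projection_le_1:
  fixes e :: "'a::unital_cstar_algebra"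
  assumes "star e = e" "e * e = e"
  shows "norm e \<le> 1"
  using cstar_identity[of e] assms by (cases "norm e = 0") (auto simp: power2_eq_square)

text \<open>The reflection is self-adjoint with square 1. Its compressions will record the
  positivity of compressed projections in terms of norms.\<close>

lemma norm_one_minus_twice_projection:
  fixes e :: "'a::unital_cstar_algebra"
  assumes "star e = e" "e * e = e"
  shows "norm (1 - (e + e)) = 1"
proof -
  have "star (1 - (e + e)) = 1 - (e + e)"
    using assms by (simp add: star_diff star_add)
  moreover have "(1 - (e + e)) * (1 - (e + e)) = 1"
    by (simp add: algebra_simps assms)
  ultimately have "(norm (1 - (e + e)))\<^sup>2 = 1"
    by (metis cstar_identity norm_one)
  then show ?thesis
    by (metis abs_norm_cancel real_sqrt_abs real_sqrt_one)
qed

text \<open>In the sum of the squares of \<open>e + h\<close> and \<open>e + \<i> h\<close> the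
  terms \<open>h * h\<close> cancel, and twice the new element remains.\<close>

lemma rotated_contraction:
  fixes e h :: "'a::unital_cstar_algebra"
  assumes "e * e = e" "e * h = h" "h * e = h"
    and "norm (e + h) \<le> 1" "norm (e + \<i> *\<^sub>C h) \<le> 1"
  shows "norm (e + (1 + \<i>) *\<^sub>C h) \<le> 1"
proof -
  have le: "norm (x * x) \<le> 1" if "norm x \<le> 1" for x :: 'a
    by (rule order_trans[OF norm_mult_ineq]) (use that in \<open>simp add: mult_le_one\<close>)
  have "2 *\<^sub>C (e + (1 + \<i>) *\<^sub>C h) = (e + h) * (e + h) + (e + \<i> *\<^sub>C h) * (e + \<i> *\<^sub>C h)"
  proof -
    have two: "2 *\<^sub>C x = x + x" for x :: 'a
      using scaleC_add_left[of 1 1 x] by simp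
    have two_i: "(\<i> * 2) *\<^sub>C x = \<i> *\<^sub>C x + \<i> *\<^sub>C x" for x :: 'a
      by (metis mult_2_right scaleC_add_left)
    show ?thesis
      by (simp add: algebra_simps assms mult_scaleC_left mult_scaleC_right scaleC_scaleC
          scaleC_add_left scaleC_add_right two two_i scaleC_minus_left)
  qed
  then have "2 * norm (e + (1 + \<i>) *\<^sub>C h)
      \<le> norm ((e + h) * (e + h)) + norm ((e + \<i> *\<^sub>C h) * (e + \<i> *\<^sub>C h))"
    by (metis norm_numeral norm_scaleC norm_triangle_ineq)
  also have "\<dots> \<le> 2"
    using le[OF assms(4)] le[OF assms(5)] by linarith
  finally show ?thesis by simp
qed

text \<open>
  A projection \<open>e\<close> is an extreme point of the unit ball of its corner: the set of \<open>w\<close> such that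
  \<open>e + \<i>\<^sup>k w h\<close> is a contraction for all \<open>k\<close> contains \<open>1\<close> and is closed under multiplication
  by \<open>1 + \<i>\<close>, hence unbounded.
\<close>

lemma projection_extreme:
  fixes e h :: "'a::unital_cstar_algebra"
  assumes e: "star e = e" "e * e = e" and h: "star h = h" "e * h = h" "h * e = h"
    and le: "norm (e + h) \<le> 1" "norm (e - h) \<le> 1"
  shows "h = 0"
proof (rule ccontr)
  assume "h \<noteq> 0"
  have sq: "norm (x * x) \<le> 1" if "norm x \<le> 1" for x :: 'a
    by (rule order_trans[OF norm_mult_ineq]) (use that in \<open>simp add: mult_le_one\<close>)
  \<comment> \<open>The mean of the squares of \<open>e + h\<close> and \<open>e - h\<close> is
    \<open>e + h * h\<close>.\<close>
  have "2 * norm (e + h * h) = norm ((e + h) * (e + h) + (e - h) * (e - h))"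
  proof -
    have "(e + h) * (e + h) + (e - h) * (e - h) = 2 *\<^sub>R (e + h * h)"
      by (simp add: algebra_simps e h scaleR_2)
    then show ?thesis by simp
  qed
  also have "\<dots> \<le> 2"
    using norm_triangle_ineq[of "(e + h) * (e + h)" "(e - h) * (e - h)"] sq[OF le(1)] sq[OF le(2)]
    by linarith
  finally have ehh: "norm (e + h * h) \<le> 1" by simp
  \<comment> \<open>Here \<open>c + cnj c = 0\<close> removes the cross terms, and the C*-identity
    turns the bound on \<open>e + h * h\<close> into one on \<open>e + c h\<close>.\<close>
  have imag: "norm (e + c *\<^sub>C h) \<le> 1" if "c = \<i> \<or> c = -\<i>" for c
  proof -
    have "star (e + c *\<^sub>C h) * (e + c *\<^sub>C h) = e + h * h"
      using that by (auto simp: algebra_simps e h star_add star_scaleC mult_scaleC_left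
          mult_scaleC_right scaleC_scaleC scaleC_minus_left scaleC_add_right scaleC_diff_right)
    then have "(norm (e + c *\<^sub>C h))\<^sup>2 \<le> 1"
      using ehh by (metis cstar_identity)
    then show ?thesis by (simp add: power2_le_iff_abs_le abs_square_le_1)
  qed
  define P where "P w \<longleftrightarrow> (\<forall>k. norm (e + (\<i> ^ k * w) *\<^sub>C h) \<le> 1)" for w :: complex
  have "P 1"
  proof (unfold P_def, intro allI)
    fix k :: nat
    have "\<i> ^ k \<in> {1, -1, \<i>, -\<i>}"
      by (induction k) auto
    then show "norm (e + (\<i> ^ k * 1) *\<^sub>C h) \<le> 1"
      using imag le by (auto simp: scaleC_minus_left)
  qed
  have step: "P ((1 + \<i>) * w)" if "P w" for w
  proof (unfold P_def, intro allI)
    fix k :: nat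
    have "norm (e + (1 + \<i>) *\<^sub>C ((\<i> ^ k * w) *\<^sub>C h)) \<le> 1"
    proof (rule rotated_contraction)
      show "norm (e + \<i> *\<^sub>C ((\<i> ^ k * w) *\<^sub>C h)) \<le> 1"
        using that[unfolded P_def, rule_format, of "Suc k"] by (simp add: scaleC_scaleC mult.assoc)
    qed (use that in \<open>auto simp: e h mult_scaleC_left mult_scaleC_right P_def\<close>)
    then show "norm (e + (\<i> ^ k * ((1 + \<i>) * w)) *\<^sub>C h) \<le> 1"
      by (simp add: scaleC_scaleC mult_ac)
  qed
  have "P ((1 + \<i>) ^ n)" for n
    by (induction n) (use \<open>P 1\<close> step in auto)
  then have bound: "norm (e + (1 + \<i>) ^ n *\<^sub>C h) \<le> 1" for n
    unfolding P_def by (metis mult_1 power_0)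
  have cmod_1_i: "cmod (1 + \<i>) = sqrt 2"
    by (simp add: cmod_def)
  have "sqrt 2 ^ n * norm h \<le> 2" for n
  proof -
    have "sqrt 2 ^ n * norm h = norm ((1 + \<i>) ^ n *\<^sub>C h)"
      using cmod_1_i by (simp add: norm_scaleC norm_power)
    also have "\<dots> \<le> norm (e + (1 + \<i>) ^ n *\<^sub>C h) + norm e"
      by (metis add.commute norm_diff_ineq norm_minus_commute add_diff_cancel_left' norm_triangle_sub
          diff_add_cancel norm_triangle_ineq4)
    also have "\<dots> \<le> 2"
      using bound[of n] norm_projection_le_1[OF e] by simp
    finally show ?thesis .
  qed
  moreover obtain n where "2 / norm h < sqrt 2 ^ n"
    using real_arch_pow[of "sqrt 2" "2 / norm h"] by auto
  ultimately show False
    using \<open>h \<noteq> 0\<close> by (metis linorder_not_le zero_less_norm_iff pos_divide_less_eq)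
qed

text \<open>The compressions \<open>h i = e a * e i * e a\<close> with \<open>i \<noteq> a\<close>
  sum to 0, and each is positive in the sense that \<open>e a - 2 h i\<close> is a contraction. As
  \<open>h b\<close> is minus the sum of the others, adding or subtracting a small multiple of
  \<open>h b\<close> keeps \<open>e a\<close> a contraction, so extremality of \<open>e a\<close>
  forces \<open>h b = 0\<close>.\<close>

lemma projections_sum_one_orthogonal:
  fixes e :: "'i \<Rightarrow> 'a::unital_cstar_algebra"
  assumes "finite A"
    and proj: "\<And>i. i \<in> A \<Longrightarrow> star (e i) = e i" "\<And>i. i \<in> A \<Longrightarrow> e i * e i = e i"
    and sum: "(\<Sum>i\<in>A. e i) = 1"
    and ab: "a \<in> A" "b \<in> A" "a \<noteq> b"
  shows "e a * e b = 0"
proof -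
  define h where "h i = e a * e i * e a" for i
  have ea: "star (e a) = e a" "e a * e a = e a"
    using proj ab by auto
  have eah: "e a * h i = h i" "h i * e a = h i" for i
    unfolding h_def by (simp_all add: mult.assoc ea) (simp_all flip: mult.assoc add: ea)
  have sum_h: "(\<Sum>i\<in>A - {a}. h i) = 0"
  proof -
    have "(\<Sum>i\<in>A. h i) = e a"
      unfolding h_def by (simp add: sum ea flip: sum_distrib_left sum_distrib_right)
    then show ?thesis
      using \<open>finite A\<close> ab by (simp add: sum_diff1 h_def ea)
  qed
  have small: "norm (e a - (h i + h i)) \<le> 1" if "i \<in> A" for i
  proof -
    have "e a - (h i + h i) = e a * (1 - (e i + e i)) * e a"
      by (simp add: h_def algebra_simps ea)
    also have "norm \<dots> \<le> norm (e a) * norm (1 - (e i + e i)) * norm (e a)"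
      by (meson norm_mult_ineq order_trans mult_right_mono norm_ge_zero)
    also have "\<dots> \<le> 1"
      using norm_one_minus_twice_projection[OF proj[OF that]] norm_projection_le_1[OF ea]
      by (simp add: mult_le_one)
    finally show ?thesis .
  qed
  define B where "B = A - {a, b}"
  \<comment> \<open>\<open>N e a + 2 h b\<close> splits into \<open>e a\<close> and the
    \<open>card B\<close> contractions \<open>e a - 2 h i\<close>; this is the number of
    summands.\<close>
  define N where "N = card B + 1"
  have "N \<ge> 1" by (simp add: N_def)
  have hb: "h b = - (\<Sum>i\<in>B. h i)"
  proof -
    have "A - {a} = insert b B" "b \<notin> B" "finite B"
      using ab \<open>finite A\<close> by (auto simp: B_def)
    then show ?thesis using sum_h by (simp add: eq_neg_iff_add_eq_0)
  qed
  have "real N *\<^sub>R e a + (h b + h b) = e a + (\<Sum>i\<in>B. e a - (h i + h i))"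
    by (simp add: hb N_def sum_subtractf sum.distrib algebra_simps sum_constant_scaleR
        del: sum_constant)
  also have "norm \<dots> \<le> norm (e a) + (\<Sum>i\<in>B. norm (e a - (h i + h i)))"
    by (rule order_trans[OF norm_triangle_ineq add_left_mono[OF norm_sum]])
  also have "\<dots> \<le> 1 + (\<Sum>i\<in>B. 1)"
    by (intro add_mono sum_mono norm_projection_le_1 ea small) (auto simp: B_def)
  finally have plus: "norm (real N *\<^sub>R e a + (h b + h b)) \<le> real N"
    by (simp add: N_def)
  have "real N *\<^sub>R e a - (h b + h b) = real (N - 1) *\<^sub>R e a + (e a - (h b + h b))"
    using \<open>N \<ge> 1\<close> by (simp add: algebra_simps of_nat_diff)
  also have "norm \<dots> \<le> real (N - 1) * norm (e a) + norm (e a - (h b + h b))"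
    by (metis norm_triangle_ineq norm_scaleR abs_of_nat)
  also have "\<dots> \<le> real (N - 1) * 1 + 1"
    by (intro add_mono mult_left_mono small norm_projection_le_1 ea ab) auto
  finally have minus: "norm (real N *\<^sub>R e a - (h b + h b)) \<le> real N"
    using \<open>N \<ge> 1\<close> by (simp add: of_nat_diff)
  have star_h: "star (h b) = h b"
    using proj ab by (simp add: h_def star_mult mult.assoc)
  define k where "k = inverse (real N) *\<^sub>R (h b + h b)"
  have "k = 0"
  proof (rule projection_extreme[OF ea])
    show "star k = k"
      by (simp add: k_def scaleR_scaleC star_scaleC star_add star_h)
    show "e a * k = k" "k * e a = k"
      by (simp_all add: k_def algebra_simps eah)
    have eq: "e a + k = inverse (real N) *\<^sub>R (real N *\<^sub>R e a + (h b + h b))"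
      "e a - k = inverse (real N) *\<^sub>R (real N *\<^sub>R e a - (h b + h b))"
      using \<open>N \<ge> 1\<close> by (simp_all add: k_def scaleR_right_distrib scaleR_right_diff_distrib)
    have "norm (inverse (real N) *\<^sub>R y) \<le> 1" if "norm y \<le> real N" for y :: 'a
      using that \<open>N \<ge> 1\<close> by (simp add: field_simps)
    then show "norm (e a + k) \<le> 1" "norm (e a - k) \<le> 1"
      unfolding eq using plus minus by blast+
  qed
  then have "h b + h b = 0"
    using \<open>N \<ge> 1\<close> by (simp add: k_def)
  then have "h b = 0"
    by (simp flip: scaleR_2)
  \<comment> \<open>Written as \<open>star x * x\<close> with \<open>x = e b * e a\<close>, the
    compression can vanish only if \<open>x\<close> does.\<close>
  moreover have "h b = star (e b * e a) * (e b * e a)"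
    unfolding h_def star_mult proj(1)[OF ab(1)] proj(1)[OF ab(2)]
    by (metis ab(2) mult.assoc proj(2))
  ultimately have "e b * e a = 0"
    by simp
  then have "star (e b * e a) = 0" by simp
  then show ?thesis using proj ab by (simp add: star_mult)
qed


section \<open>Spectral projections of quantum reflections\<close>

text \<open>Since \<open>z ^ m = 1\<close> has only \<open>m < s\<close> solutions, some root
  \<open>w\<close> has \<open>w ^ m \<noteq> 1\<close>; translating by \<open>w\<close> multiplies
  the sum by \<open>w ^ m\<close>.\<close>

lemma sum_roots_unity_power:
  assumes "0 < m" "m < s"
  shows "(\<Sum>z | z ^ s = 1. (z::complex) ^ m) = 0"
proof -
  let ?Z = "{z::complex. z ^ s = 1}"
  have "\<not> ?Z \<subseteq> {z. z ^ m = 1}"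
    using assms card_mono[OF finite_nth_roots[OF assms(1), of 1], of ?Z]
    by (auto simp: card_roots_unity_eq)
  then obtain w :: complex where w: "w ^ s = 1" "w ^ m \<noteq> 1" by blast
  then have "w \<noteq> 0" using assms by (auto simp: power_0_left)
  have "(\<Sum>z\<in>?Z. z ^ m) = (\<Sum>z\<in>?Z. (w * z) ^ m)"
    by (rule sum.reindex_bij_witness[of _ "\<lambda>z. w * z" "\<lambda>z. z / w"])
       (use w \<open>w \<noteq> 0\<close> in \<open>auto simp: power_mult_distrib power_divide\<close>)
  also have "\<dots> = w ^ m * (\<Sum>z\<in>?Z. z ^ m)"
    by (simp add: power_mult_distrib sum_distrib_left)
  finally show ?thesis using w by auto
qed

lemma sum_powers_root_of_unity:
  fixes z :: complex
  assumes "z ^ s = 1"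
  shows "(\<Sum>m=1..s. z ^ m) = (if z = 1 then of_nat s else 0)"
proof (cases "z = 1")
  case False
  have "(z - 1) * (\<Sum>m=1..s. z ^ m) = (\<Sum>m=1..s. z ^ Suc m - z ^ m)"
    by (simp add: sum_distrib_left algebra_simps)
  also have "\<dots> = z ^ Suc s - z"
    by (subst sum_Suc_diff) auto
  finally show ?thesis using False assms by simp
qed auto

lemma cnj_root_of_unity:
  fixes z :: complex
  assumes "z ^ s = 1" "s \<ge> 1"
  shows "cnj z = inverse z"
proof -
  have "cmod z ^ s = 1" by (metis assms(1) norm_one norm_power)
  then have "cmod z = 1" using assms(2) power_eq_imp_eq_base[of "cmod z" s 1] by auto
  then show ?thesis
    by (metis complex_norm_square inverse_unique of_real_1 one_power2)
qed

definition quantum_reflection :: "nat \<Rightarrow> 'a::complex_star_algebra_1 \<Rightarrow> bool" where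
  "quantum_reflection s x \<longleftrightarrow> normal_element x \<and> partial_isometry x \<and> x ^ s = x * star x"

text \<open>The finite Fourier transform of the powers of \<open>x\<close>. The sum runs from 1 to
  \<open>s\<close>, not from 0, because the unit of the algebra generated by \<open>x\<close> is the
  support \<open>x ^ s = x * star x\<close>; the power 0 would contribute 1 instead.\<close>

definition spectral_projection :: "nat \<Rightarrow> complex \<Rightarrow> 'a::complex_star_algebra_1 \<Rightarrow> 'a" where
  "spectral_projection s z x = (1 / of_nat s) *\<^sub>C (\<Sum>m=1..s. inverse z ^ m *\<^sub>C x ^ m)"

context
  fixes s :: nat and x :: "'a::complex_star_algebra_1"
  assumes s: "s \<ge> 1" and x: "quantum_reflection s x"
begin

lemma reflection_power: "x ^ s = x * star x"
  using x by (simp add: quantum_reflection_def)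

lemma reflection_normal: "star x * x = x * star x"
  using x by (simp add: quantum_reflection_def normal_element_def)

lemma reflection_support: "x * star x * x = x"
  using x by (simp add: quantum_reflection_def partial_isometry_def)

lemma star_mult_reflection_power: "m \<ge> 1 \<Longrightarrow> star x * x * x ^ m = x ^ m"
  by (cases m) (auto simp: reflection_normal reflection_support simp flip: mult.assoc)

text \<open>Multiplication by \<open>x\<close> shifts the terms of the Fourier sum by one, and the
  sum closes up because \<open>x ^ Suc s = x\<close>.\<close>

lemma reflection_mult_spectral_projection:
  assumes z: "z ^ s = 1"
  shows "x * spectral_projection s z x = z *\<^sub>C spectral_projection s z x"
proof -
  define g where "g m = inverse z ^ m *\<^sub>C x ^ m" for m
  have "z \<noteq> 0" using z s by (auto simp: power_0_left)
  have x_Suc: "x ^ Suc s = x"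
    by (simp only: power_Suc2 reflection_power reflection_support)
  have "g (Suc s) = g 1"
    using z x_Suc by (simp add: g_def power_inverse)
  have xg: "x * g m = z *\<^sub>C g (Suc m)" for m
    using \<open>z \<noteq> 0\<close> by (simp add: g_def mult_scaleC_right scaleC_scaleC field_simps)
  have "(\<Sum>m=1..s. g (Suc m)) - (\<Sum>m=1..s. g m) = g (Suc s) - g 1"
    by (subst sum_subtractf[symmetric], subst sum_Suc_diff) auto
  then have "(\<Sum>m=1..s. g (Suc m)) = (\<Sum>m=1..s. g m)"
    using \<open>g (Suc s) = g 1\<close> by simp
  then have "x * (\<Sum>m=1..s. g m) = z *\<^sub>C (\<Sum>m=1..s. g m)"
    by (simp add: sum_distrib_left xg flip: scaleC_sum_right)
  then show ?thesis
    by (simp add: spectral_projection_def g_def mult_scaleC_right scaleC_scaleC mult.commute)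
qed

lemma reflection_power_mult_spectral_projection:
  "z ^ s = 1 \<Longrightarrow> x ^ m * spectral_projection s z x = z ^ m *\<^sub>C spectral_projection s z x"
  by (induction m)
     (auto simp: mult.assoc reflection_mult_spectral_projection mult_scaleC_right scaleC_scaleC mult.commute)

lemma spectral_projection_mult:
  assumes "z ^ s = 1" "w ^ s = 1"
  shows "spectral_projection s w x * spectral_projection s z x =
    (if w = z then spectral_projection s z x else 0)"
proof -
  have "w \<noteq> 0" using assms s by (auto simp: power_0_left)
  have "spectral_projection s w x * spectral_projection s z x =
     (1 / of_nat s) *\<^sub>C (\<Sum>m=1..s. (inverse w * z) ^ m *\<^sub>C spectral_projection s z x)"
    unfolding spectral_projection_def[of s w]
    by (simp add: mult_scaleC_left sum_distrib_right reflection_power_mult_spectral_projection assms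
        scaleC_scaleC power_mult_distrib)
  also have "\<dots> = ((\<Sum>m=1..s. (inverse w * z) ^ m) / of_nat s) *\<^sub>C spectral_projection s z x"
    by (simp add: scaleC_scaleC flip: scaleC_sum_left)
  also have "(\<Sum>m=1..s. (inverse w * z) ^ m) = (if inverse w * z = 1 then of_nat s else 0)"
    using assms by (intro sum_powers_root_of_unity) (simp add: power_mult_distrib power_inverse)
  finally show ?thesis
    using s \<open>w \<noteq> 0\<close> by (auto simp: field_simps split: if_splits)
qed

text \<open>Below the support, \<open>star x\<close> inverts \<open>x\<close>, hence acts on the
  projection \<open>e\<close> as \<open>inverse z\<close>. This gives \<open>star e * e = e\<close>,
  which already implies self-adjointness.\<close>

lemma star_spectral_projection:
  assumes z: "z ^ s = 1"
  shows "star (spectral_projection s z x) = spectral_projection s z x"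
proof (rule selfadjoint_of_star_mult_self)
  let ?e = "spectral_projection s z x"
  have "z \<noteq> 0" using z s by (auto simp: power_0_left)
  have "star x * x * ?e = ?e"
    unfolding spectral_projection_def
    by (simp add: mult_scaleC_right sum_distrib_left star_mult_reflection_power)
  then have "z *\<^sub>C (star x * ?e) = ?e"
    using reflection_mult_spectral_projection[OF z] by (metis mult.assoc mult_scaleC_right)
  then have "star x * ?e = inverse z *\<^sub>C ?e"
    using \<open>z \<noteq> 0\<close> by (metis scaleC_scaleC left_inverse scaleC_one)
  then have pow: "star x ^ m * ?e = inverse z ^ m *\<^sub>C ?e" for m
    by (induction m) (auto simp: mult.assoc mult_scaleC_right scaleC_scaleC mult.commute)
  have "cnj z = inverse z" using cnj_root_of_unity[OF z s] .
  then have "star ?e = (1 / of_nat s) *\<^sub>C (\<Sum>m=1..s. z ^ m *\<^sub>C star x ^ m)"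
    by (simp add: spectral_projection_def star_scaleC star_sum star_power)
  then have "star ?e * ?e = (1 / of_nat s) *\<^sub>C (\<Sum>m=1..s. ?e)"
    using \<open>z \<noteq> 0\<close>
    by (simp add: mult_scaleC_left sum_distrib_right pow scaleC_scaleC flip: power_mult_distrib)
  also have "(\<Sum>m=1..s. ?e) = of_nat s *\<^sub>C ?e"
    using scaleC_sum_left[of "\<lambda>_. 1" "{1..s}" ?e] by simp
  finally show "star ?e * ?e = ?e"
    using s by (simp add: scaleC_scaleC)
qed

text \<open>Orthogonality of characters kills every power except \<open>m = s\<close>.\<close>

lemma sum_spectral_projections: "(\<Sum>z | z ^ s = 1. spectral_projection s z x) = x * star x"
proof -
  have inv: "(\<Sum>z | z ^ s = 1. inverse z ^ m) = (if m = s then of_nat s else (0::complex))"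
    if "m \<in> {1..s}" for m
  proof -
    have "(\<Sum>z | z ^ s = 1. inverse z ^ m) = (\<Sum>z | z ^ s = 1. (z::complex) ^ m)"
      by (rule sum.reindex_bij_witness[of _ inverse inverse]) (auto simp: power_inverse)
    also have "\<dots> = (if m = s then of_nat s else 0)"
      using that s sum_roots_unity_power[of m s] by (auto simp: card_roots_unity_eq)
    finally show ?thesis .
  qed
  have "(\<Sum>z | z ^ s = 1. spectral_projection s z x) =
      (1 / of_nat s) *\<^sub>C (\<Sum>m=1..s. (\<Sum>z | z ^ s = 1. inverse z ^ m) *\<^sub>C x ^ m)"
    unfolding spectral_projection_def scaleC_sum_left
    by (subst sum.swap) (simp add: scaleC_sum_right)
  also have "(\<Sum>m=1..s. (\<Sum>z | z ^ s = 1. inverse z ^ m) *\<^sub>C x ^ m) =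
      (\<Sum>m=1..s. (if m = s then of_nat s else 0) *\<^sub>C x ^ m)"
    by (rule sum.cong) (simp_all add: inv)
  also have "\<dots> = (\<Sum>m=1..s. if m = s then of_nat s *\<^sub>C x ^ m else 0)"
    by (rule sum.cong) auto
  also have "\<dots> = of_nat s *\<^sub>C x ^ s"
    using s by (simp add: sum.delta)
  finally show ?thesis
    using s by (simp add: scaleC_scaleC reflection_power)
qed

lemma spectral_projection_mult_eq_0:
  "x * y = 0 \<Longrightarrow> spectral_projection s z x * y = 0"
  "y * x = 0 \<Longrightarrow> y * spectral_projection s z x = 0"
proof -
  have "x ^ m * y = 0" if "x * y = 0" "m \<in> {1..s}" for m
    using that by (cases m) (auto simp: power_Suc2 mult.assoc simp del: power_Suc)
  then show "x * y = 0 \<Longrightarrow> spectral_projection s z x * y = 0"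
    by (simp add: spectral_projection_def mult_scaleC_left sum_distrib_right)
  have "y * x ^ m = 0" if "y * x = 0" "m \<in> {1..s}" for m
    using that by (cases m) (auto simp flip: mult.assoc)
  then show "y * x = 0 \<Longrightarrow> y * spectral_projection s z x = 0"
    by (simp add: spectral_projection_def mult_scaleC_right sum_distrib_left)
qed

lemma spectral_projection_mult_reflection:
  assumes "z ^ s = 1"
  shows "spectral_projection s z x * x = z *\<^sub>C spectral_projection s z x"
proof -
  have "spectral_projection s z x * x = x * spectral_projection s z x"
    by (simp add: spectral_projection_def mult_scaleC_left mult_scaleC_right sum_distrib_left
        sum_distrib_right power_commutes)
  then show ?thesis using reflection_mult_spectral_projection assms by simp
qed

end


section \<open>From quantum equivalence to a magic unitary\<close>

lemma quantum_reflection_matrix_entry: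
  "quantum_reflection_matrix s u \<Longrightarrow> quantum_reflection s (u $ i $ j)"
  by (simp add: quantum_reflection_matrix_def quantum_reflection_def)

lemma quantum_reflection_matrix_row_sum:
  assumes "quantum_reflection_matrix s u"
  shows "(\<Sum>j\<in>UNIV. u $ i $ j * star (u $ i $ j)) = 1"
proof -
  have "(u ** transpose (map_matrix star u)) $ i $ i = mat 1 $ i $ i"
    using assms by (simp add: quantum_reflection_matrix_def unitary_matrix_def)
  then show ?thesis
    by (simp add: matrix_matrix_mult_def transpose_def map_matrix_def mat_def)
qed

lemma quantum_reflection_matrix_column_sum:
  assumes "quantum_reflection_matrix s u"
  shows "(\<Sum>i\<in>UNIV. u $ i $ j * star (u $ i $ j)) = 1"
proof -
  have "(transpose (map_matrix star u) ** u) $ j $ j = mat 1 $ j $ j"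
    using assms by (simp add: quantum_reflection_matrix_def unitary_matrix_def)
  then show ?thesis
    using assms by (simp add: matrix_matrix_mult_def transpose_def map_matrix_def mat_def
      quantum_reflection_matrix_def normal_element_def)
qed

text \<open>By normality \<open>x = x * (x * star x)\<close>, and
  \<open>y = (y * star y) * y\<close>, so the product of the two supports stands in the middle of
  \<open>x * y\<close>.\<close>

lemma quantum_reflection_mult_eq_0:
  assumes "quantum_reflection s x" "quantum_reflection s y"
    and "(x * star x) * (y * star y) = 0"
  shows "x * y = 0"
proof -
  have y: "y = y * star y * y"
    using assms(2) by (simp add: quantum_reflection_def partial_isometry_def)
  have "x * (x * star x) = x * (star x * x)"
    using assms(1) by (simp add: quantum_reflection_def normal_element_def)
  also have "\<dots> = x"
    using assms(1) by (simp add: quantum_reflection_def partial_isometry_def mult.assoc)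
  finally have "x * y = (x * (x * star x)) * (y * star y * y)"
    using y by simp
  also have "\<dots> = x * ((x * star x) * (y * star y)) * y"
    by (simp only: mult.assoc)
  finally show ?thesis by (simp add: assms(3))
qed

lemma quantum_reflection_support_projection:
  assumes "quantum_reflection s x"
  shows "star (x * star x) = x * star x" "(x * star x) * (x * star x) = x * star x"
  using assms
  by (simp_all add: star_mult star_star quantum_reflection_def partial_isometry_def)
     (simp flip: mult.assoc)

text \<open>The supports along a row are projections with sum one, so they are orthogonal in a
  C*-algebra; orthogonality of supports passes to the entries.\<close>

lemma quantum_reflection_matrix_row_orthogonal:
  fixes u :: "'a::unital_cstar_algebra^'n^'n"
  assumes "quantum_reflection_matrix s u" "j \<noteq> k"
  shows "u $ i $ j * u $ i $ k = 0"
  by (rule quantum_reflection_mult_eq_0,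
      (rule quantum_reflection_matrix_entry[OF assms(1)])+,
      rule projections_sum_one_orthogonal[where A = UNIV and e = "\<lambda>j. u $ i $ j * star (u $ i $ j)"])
     (use assms in \<open>auto intro: quantum_reflection_support_projection
       quantum_reflection_matrix_entry quantum_reflection_matrix_row_sum\<close>)

lemma quantum_reflection_matrix_column_orthogonal:
  fixes u :: "'a::unital_cstar_algebra^'n^'n"
  assumes "quantum_reflection_matrix s u" "i \<noteq> k"
  shows "u $ i $ j * u $ k $ j = 0"
  by (rule quantum_reflection_mult_eq_0,
      (rule quantum_reflection_matrix_entry[OF assms(1)])+,
      rule projections_sum_one_orthogonal[where A = UNIV and e = "\<lambda>i. u $ i $ j * star (u $ i $ j)"])
     (use assms in \<open>auto intro: quantum_reflection_support_projection
       quantum_reflection_matrix_entry quantum_reflection_matrix_column_sum\<close>)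

section \<open>Hadamard graphs in terms of roots of unity\<close>

lemma powers_of_root_of_unity:
  assumes "s \<ge> 1"
  shows "{root_of_unity s ^ k | k. k < s} = {z. z ^ s = 1}"
proof -
  have "root_of_unity s ^ k = cis (2 * pi * real k / real s)" for k
    by (simp add: root_of_unity_def cis_conv_exp mult_ac flip: exp_of_nat_mult)
  then have "{root_of_unity s ^ k | k. k < s} = (\<lambda>k. cis (2 * pi * real k / real s)) ` {..<s}"
    by auto
  also have "\<dots> = {z. z ^ s = 1}"
    using Complex.bij_betw_roots_unity[of s] assms by (simp add: bij_betw_def)
  finally show ?thesis .
qed

lemma pverts_hadamard_graph:
  assumes "s \<ge> 1"
  shows "pverts (hadamard_graph s (H :: complex^'n^'n)) =
    {Row i a | i a. a ^ s = 1} \<union> {Col j c | j c. c ^ s = 1}"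
proof -
  have *: "z ^ s = 1 \<longleftrightarrow> (\<exists>k<s. z = root_of_unity s ^ k)" for z
    using powers_of_root_of_unity[OF assms] by blast
  show ?thesis
    by (auto simp: hadamard_graph_def Let_def *)
qed

lemma finite_pverts_hadamard_graph: "finite (pverts (hadamard_graph s (H :: complex^'n^'n)))"
proof -
  interpret pair_graph "hadamard_graph s H"
    by (rule pair_graph_hadamard_graph)
  show ?thesis by (rule pair_finite_verts)
qed

lemma parcs_hadamard_graph:
  assumes "s \<ge> 1"
  shows "(Row i a, Row i' b) \<notin> parcs (hadamard_graph s H)"
    "(Col j c, Col j' d) \<notin> parcs (hadamard_graph s H)"
    "(Row i a, Col j c) \<in> parcs (hadamard_graph s H) \<longleftrightarrow> a ^ s = 1 \<and> c ^ s = 1 \<and> a * H $ i $ j = c"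
    "(Col j c, Row i a) \<in> parcs (hadamard_graph s H) \<longleftrightarrow> a ^ s = 1 \<and> c ^ s = 1 \<and> a * H $ i $ j = c"
proof -
  have *: "z ^ s = 1 \<longleftrightarrow> (\<exists>k<s. z = root_of_unity s ^ k)" for z
    using powers_of_root_of_unity[OF assms] by blast
  show "(Row i a, Row i' b) \<notin> parcs (hadamard_graph s H)"
    "(Col j c, Col j' d) \<notin> parcs (hadamard_graph s H)"
    "(Row i a, Col j c) \<in> parcs (hadamard_graph s H) \<longleftrightarrow> a ^ s = 1 \<and> c ^ s = 1 \<and> a * H $ i $ j = c"
    "(Col j c, Row i a) \<in> parcs (hadamard_graph s H) \<longleftrightarrow> a ^ s = 1 \<and> c ^ s = 1 \<and> a * H $ i $ j = c"
    unfolding * by (auto simp: hadamard_graph_def Let_def)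
qed

lemma sum_pverts_hadamard_graph:
  assumes "s \<ge> 1"
  shows "(\<Sum>v\<in>pverts (hadamard_graph s (H :: complex^'n^'n)). f v) =
    (\<Sum>i\<in>UNIV. \<Sum>z | z ^ s = 1. f (Row i z)) + (\<Sum>j\<in>UNIV. \<Sum>z | z ^ s = 1. f (Col j z))"
proof -
  let ?Z = "{z::complex. z ^ s = 1}"
  have fin: "finite ?Z" using assms by (intro finite_nth_roots) auto
  have "pverts (hadamard_graph s H) =
      (\<lambda>(i, z). Row i z) ` (UNIV \<times> ?Z) \<union> (\<lambda>(j, z). Col j z) ` (UNIV \<times> ?Z)"
    by (auto simp: pverts_hadamard_graph[OF assms])
  also have "sum f \<dots> = sum f ((\<lambda>(i, z). Row i z) ` (UNIV \<times> ?Z))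
      + sum f ((\<lambda>(j, z). Col j z) ` (UNIV \<times> ?Z))"
    using fin by (intro sum.union_disjoint) auto
  also have "sum f ((\<lambda>(i, z). Row i z) ` (UNIV \<times> ?Z)) = (\<Sum>i\<in>UNIV. \<Sum>z\<in>?Z. f (Row i z))"
    by (subst sum.reindex) (auto simp: inj_on_def sum.cartesian_product split_beta)
  also have "sum f ((\<lambda>(j, z). Col j z) ` (UNIV \<times> ?Z)) = (\<Sum>j\<in>UNIV. \<Sum>z\<in>?Z. f (Col j z))"
    by (subst sum.reindex) (auto simp: inj_on_def sum.cartesian_product split_beta)
  finally show ?thesis .
qed

locale magic_unitary =
  fixes V :: "'x set" and W :: "'y set" and U :: "'x \<Rightarrow> 'y \<Rightarrow> 'a::complex_star_algebra_1"
  assumes finite_V: "finite V" and finite_W: "finite W"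
    and star_U: "\<lbrakk>x \<in> V; y \<in> W\<rbrakk> \<Longrightarrow> star (U x y) = U x y"
    and U_idem: "\<lbrakk>x \<in> V; y \<in> W\<rbrakk> \<Longrightarrow> U x y * U x y = U x y"
    and U_row_orthogonal: "\<lbrakk>x \<in> V; y \<in> W; y' \<in> W; y \<noteq> y'\<rbrakk> \<Longrightarrow> U x y * U x y' = 0"
    and U_column_orthogonal: "\<lbrakk>x \<in> V; x' \<in> V; y \<in> W; x \<noteq> x'\<rbrakk> \<Longrightarrow> U x y * U x' y = 0"
    and U_row_sum: "x \<in> V \<Longrightarrow> (\<Sum>y\<in>W. U x y) = 1"
    and U_column_sum: "y \<in> W \<Longrightarrow> (\<Sum>x\<in>V. U x y) = 1"

text \<open>For a magic unitary this is the relation \<open>A U = U A'\<close> in the form that the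
  losing answers of the game require.\<close>

definition intertwines_graphs ::
    "'v pair_pre_digraph \<Rightarrow> 'w pair_pre_digraph \<Rightarrow> ('v \<Rightarrow> 'w \<Rightarrow> 'a::complex_star_algebra_1) \<Rightarrow> bool" where
  "intertwines_graphs G H U \<longleftrightarrow>
     (\<forall>g\<in>pverts G. \<forall>g'\<in>pverts G. \<forall>h\<in>pverts H. \<forall>h'\<in>pverts H.
        ((g, g') \<in> parcs G \<longleftrightarrow> (h, h') \<notin> parcs H) \<longrightarrow> U g h * U g' h' = 0)"

text \<open>In the scalar case a nonzero entry \<open>z\<close> of \<open>p\<close> in position
  \<open>(i', i)\<close> sends the vertex \<open>Row i a\<close> to \<open>Row i' (a / z)\<close>;
  the projection for \<open>a / b\<close> is the quantum version of this event, and likewise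
  \<open>q\<close> moves the column vertices. The indices of \<open>p\<close> and \<open>q\<close>
  are exchanged because \<open>H' q = p H\<close> lets their columns belong to \<open>H\<close>, the
  source graph.\<close>

fun hadamard_magic ::
    "nat \<Rightarrow> 'a^'n^'n \<Rightarrow> 'a^'n^'n \<Rightarrow> 'n hadamard_vertex \<Rightarrow> 'n hadamard_vertex \<Rightarrow> 'a::complex_star_algebra_1"
  where
  "hadamard_magic s p q (Row i a) (Row i' b) = spectral_projection s (a / b) (p $ i' $ i)"
| "hadamard_magic s p q (Col l c) (Col j d) = spectral_projection s (c / d) (q $ j $ l)"
| "hadamard_magic s p q (Row _ _) (Col _ _) = 0"
| "hadamard_magic s p q (Col _ _) (Row _ _) = 0"

section \<open>The magic unitary of a quantum equivalence\<close>

lemma sum_spectral_projections_quotient: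
  assumes "s \<ge> 1" "quantum_reflection s x" "a ^ s = 1"
  shows "(\<Sum>b | b ^ s = 1. spectral_projection s (a / b) x) = x * star x"
    and "(\<Sum>b | b ^ s = 1. spectral_projection s (b / a) x) = x * star x"
proof -
  have "a \<noteq> 0" using assms by (auto simp: power_0_left)
  have nz: "b \<noteq> 0" if "b ^ s = 1" for b :: complex using that assms(1) by (auto simp: power_0_left)
  have "(\<Sum>b | b ^ s = 1. spectral_projection s (a / b) x) = (\<Sum>z | z ^ s = 1. spectral_projection s z x)"
    by (rule sum.reindex_bij_witness[of _ "\<lambda>z. a / z" "\<lambda>b. a / b"])
       (use assms \<open>a \<noteq> 0\<close> nz in \<open>auto simp: power_divide\<close>)
  then show "(\<Sum>b | b ^ s = 1. spectral_projection s (a / b) x) = x * star x"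
    using sum_spectral_projections assms by simp
  have "(\<Sum>b | b ^ s = 1. spectral_projection s (b / a) x) = (\<Sum>z | z ^ s = 1. spectral_projection s z x)"
    by (rule sum.reindex_bij_witness[of _ "\<lambda>z. z * a" "\<lambda>b. b / a"])
       (use assms \<open>a \<noteq> 0\<close> nz in \<open>auto simp: power_divide power_mult_distrib\<close>)
  then show "(\<Sum>b | b ^ s = 1. spectral_projection s (b / a) x) = x * star x"
    using sum_spectral_projections assms by simp
qed

lemma spectral_projections_mult_eq_0:
  assumes "s \<ge> 1" "quantum_reflection s x" "quantum_reflection s y" "x * y = 0"
  shows "spectral_projection s z x * spectral_projection s w y = 0"
  using assms spectral_projection_mult_eq_0 by metis

text \<open>Distinct entries of a column are orthogonal, and distinct roots give orthogonal spectral
  projections of one entry. Because of the exchanged indices, columns of \<open>p\<close> and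
  \<open>q\<close> yield the rows of \<open>hadamard_magic\<close>.\<close>

lemma spectral_projections_column_orthogonal:
  fixes u :: "'a::unital_cstar_algebra^'n^'n"
  assumes "s \<ge> 1" "quantum_reflection_matrix s u"
    and "a ^ s = 1" "b ^ s = 1" "b' ^ s = 1" "(i, b) \<noteq> (i', b')"
  shows "spectral_projection s (a / b) (u $ i $ j) * spectral_projection s (a / b') (u $ i' $ j) = 0"
proof (cases "i = i'")
  case True
  have "b \<noteq> 0" "b' \<noteq> 0" "a \<noteq> 0" using assms by (auto simp: power_0_left)
  then have "a / b \<noteq> a / b'" using assms True by auto
  then show ?thesis
    using True spectral_projection_mult[OF assms(1) quantum_reflection_matrix_entry[OF assms(2)]] assms
    by (simp add: power_divide)
next
  case False
  then show ?thesis
    by (intro spectral_projections_mult_eq_0 quantum_reflection_matrix_column_orthogonal[OF assms(2)]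
        quantum_reflection_matrix_entry[OF assms(2)] assms(1))
qed

lemma spectral_projections_row_orthogonal:
  fixes u :: "'a::unital_cstar_algebra^'n^'n"
  assumes "s \<ge> 1" "quantum_reflection_matrix s u"
    and "a ^ s = 1" "a' ^ s = 1" "b ^ s = 1" "(j, a) \<noteq> (j', a')"
  shows "spectral_projection s (a / b) (u $ i $ j) * spectral_projection s (a' / b) (u $ i $ j') = 0"
proof (cases "j = j'")
  case True
  have "b \<noteq> 0" using assms by (auto simp: power_0_left)
  then have "a / b \<noteq> a' / b" using assms True by auto
  then show ?thesis
    using True spectral_projection_mult[OF assms(1) quantum_reflection_matrix_entry[OF assms(2)]] assms
    by (simp add: power_divide)
next
  case False
  then show ?thesis
    by (intro spectral_projections_mult_eq_0 quantum_reflection_matrix_row_orthogonal[OF assms(2)]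
        quantum_reflection_matrix_entry[OF assms(2)] assms(1))
qed

context
  fixes s :: nat and H H' :: "complex^'n^'n" and p q :: "'a::unital_cstar_algebra^'n^'n"
  assumes s: "s \<ge> 1"
    and p: "quantum_reflection_matrix s p" and q: "quantum_reflection_matrix s q"
    and eq: "map_matrix (\<lambda>c. c *\<^sub>C 1) H' ** q = p ** map_matrix (\<lambda>c. c *\<^sub>C 1) H"
begin

lemma magic_unitary_hadamard_magic:
  "magic_unitary (pverts (hadamard_graph s H)) (pverts (hadamard_graph s H')) (hadamard_magic s p q)"
proof -
  note pr = quantum_reflection_matrix_entry[OF p] and qr = quantum_reflection_matrix_entry[OF q]
  note verts = pverts_hadamard_graph[OF s]
  have nz: "b \<noteq> 0" if "b ^ s = 1" for b :: complex using that s by (auto simp: power_0_left)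
  show ?thesis
  proof
    show "finite (pverts (hadamard_graph s H))" "finite (pverts (hadamard_graph s H'))"
      by (rule finite_pverts_hadamard_graph)+
  next
    fix x y
    assume x: "x \<in> pverts (hadamard_graph s H)" and y: "y \<in> pverts (hadamard_graph s H')"
    show "star (hadamard_magic s p q x y) = hadamard_magic s p q x y"
      using x y by (auto simp: verts power_divide star_spectral_projection[OF s pr] star_spectral_projection[OF s qr])
    show "hadamard_magic s p q x y * hadamard_magic s p q x y = hadamard_magic s p q x y"
      using x y by (auto simp: verts power_divide spectral_projection_mult[OF s pr] spectral_projection_mult[OF s qr])
  next
    fix x y y'
    assume "x \<in> pverts (hadamard_graph s H)" "y \<in> pverts (hadamard_graph s H')"
      "y' \<in> pverts (hadamard_graph s H')" "y \<noteq> y'"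
    then show "hadamard_magic s p q x y * hadamard_magic s p q x y' = 0"
      by (auto simp: verts intro!: spectral_projections_column_orthogonal[OF s p]
        spectral_projections_column_orthogonal[OF s q])
  next
    fix x x' y
    assume "x \<in> pverts (hadamard_graph s H)" "x' \<in> pverts (hadamard_graph s H)"
      "y \<in> pverts (hadamard_graph s H')" "x \<noteq> x'"
    then show "hadamard_magic s p q x y * hadamard_magic s p q x' y = 0"
      by (auto simp: verts intro!: spectral_projections_row_orthogonal[OF s p]
        spectral_projections_row_orthogonal[OF s q])
  next
    fix x assume "x \<in> pverts (hadamard_graph s H)"
    then have "(\<exists>i a. x = Row i a \<and> a ^ s = 1) \<or> (\<exists>j c. x = Col j c \<and> c ^ s = 1)"
      by (auto simp: verts)
    then show "(\<Sum>y\<in>pverts (hadamard_graph s H'). hadamard_magic s p q x y) = 1"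
      by (auto simp: sum_pverts_hadamard_graph[OF s] sum_spectral_projections_quotient[OF s pr]
        sum_spectral_projections_quotient[OF s qr]
        quantum_reflection_matrix_column_sum[OF p] quantum_reflection_matrix_column_sum[OF q]
        quantum_reflection_matrix_row_sum[OF p] quantum_reflection_matrix_row_sum[OF q])
  next
    fix y assume "y \<in> pverts (hadamard_graph s H')"
    then have "(\<exists>i a. y = Row i a \<and> a ^ s = 1) \<or> (\<exists>j c. y = Col j c \<and> c ^ s = 1)"
      by (auto simp: verts)
    then show "(\<Sum>x\<in>pverts (hadamard_graph s H). hadamard_magic s p q x y) = 1"
      by (auto simp: sum_pverts_hadamard_graph[OF s] sum_spectral_projections_quotient[OF s pr]
        sum_spectral_projections_quotient[OF s qr]
        quantum_reflection_matrix_column_sum[OF p] quantum_reflection_matrix_column_sum[OF q]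
        quantum_reflection_matrix_row_sum[OF p] quantum_reflection_matrix_row_sum[OF q])
  qed
qed

text \<open>The entry \<open>(i', l)\<close> of \<open>H' q = p H\<close> is compressed between the
  two projections. By orthogonality only \<open>q $ j $ l\<close> survives next to the right one,
  where it acts as \<open>w\<close>, and only \<open>p $ i' $ i\<close> next to the left one, where
  it acts as \<open>z\<close>. The product of the projections is thus killed by the difference of
  the two scalars.\<close>

lemma spectral_projections_intertwine:
  assumes z: "z ^ s = 1" and w: "w ^ s = 1" and ne: "H' $ i' $ j * w \<noteq> z * H $ i $ l"
  shows "spectral_projection s z (p $ i' $ i) * spectral_projection s w (q $ j $ l) = 0"
proof -
  note pr = quantum_reflection_matrix_entry[OF p] and qr = quantum_reflection_matrix_entry[OF q]
  let ?e = "spectral_projection s z (p $ i' $ i)" and ?f = "spectral_projection s w (q $ j $ l)"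
  have "(map_matrix (\<lambda>c. c *\<^sub>C 1) H' ** q) $ i' $ l = (p ** map_matrix (\<lambda>c. c *\<^sub>C 1) H) $ i' $ l"
    by (simp add: eq)
  then have "(\<Sum>k\<in>UNIV. H' $ i' $ k *\<^sub>C q $ k $ l) = (\<Sum>k\<in>UNIV. H $ k $ l *\<^sub>C p $ i' $ k)"
    by (simp add: matrix_matrix_mult_def map_matrix_def mult_scaleC_left mult_scaleC_right)
  then have "?e * (\<Sum>k\<in>UNIV. H' $ i' $ k *\<^sub>C q $ k $ l) * ?f = ?e * (\<Sum>k\<in>UNIV. H $ k $ l *\<^sub>C p $ i' $ k) * ?f"
    by simp
  moreover have "?e * (\<Sum>k\<in>UNIV. H' $ i' $ k *\<^sub>C q $ k $ l) * ?f = (H' $ i' $ j * w) *\<^sub>C (?e * ?f)"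
  proof -
    have "q $ k $ l * ?f = (if k = j then w *\<^sub>C ?f else 0)" for k
      using spectral_projection_mult_eq_0(2)[OF s qr] quantum_reflection_matrix_column_orthogonal[OF q]
        reflection_mult_spectral_projection[OF s qr w] by auto
    then have "(\<Sum>k\<in>UNIV. H' $ i' $ k *\<^sub>C (q $ k $ l * ?f))
        = (\<Sum>k\<in>UNIV. if k = j then (H' $ i' $ j * w) *\<^sub>C ?f else 0)"
      by (intro sum.cong) (auto simp: scaleC_scaleC)
    then show ?thesis
      by (simp add: mult.assoc sum_distrib_right mult_scaleC_left mult_scaleC_right)
  qed
  moreover have "?e * (\<Sum>k\<in>UNIV. H $ k $ l *\<^sub>C p $ i' $ k) * ?f = (z * H $ i $ l) *\<^sub>C (?e * ?f)"
  proof -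
    have "?e * p $ i' $ k = (if k = i then z *\<^sub>C ?e else 0)" for k
      using spectral_projection_mult_eq_0(1)[OF s pr] quantum_reflection_matrix_row_orthogonal[OF p]
        spectral_projection_mult_reflection[OF s pr z] by auto
    then have "(\<Sum>k\<in>UNIV. H $ k $ l *\<^sub>C (?e * p $ i' $ k))
        = (\<Sum>k\<in>UNIV. if k = i then (z * H $ i $ l) *\<^sub>C ?e else 0)"
      by (intro sum.cong) (auto simp: scaleC_scaleC mult.commute)
    then show ?thesis
      by (simp add: sum_distrib_left mult_scaleC_left mult_scaleC_right)
  qed
  ultimately have "(H' $ i' $ j * w - z * H $ i $ l) *\<^sub>C (?e * ?f) = 0"
    by (simp add: scaleC_diff_left)
  then show ?thesis using ne by simp
qed

text \<open>Neither graph has edges inside its parts, and \<open>hadamard_magic\<close> vanishes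
  between a row and a column vertex, so only a row pair next to a column pair matters. The opposite
  order follows by taking adjoints.\<close>

lemma intertwines_hadamard_magic:
  "intertwines_graphs (hadamard_graph s H) (hadamard_graph s H') (hadamard_magic s p q)"
  unfolding intertwines_graphs_def
proof (intro ballI impI)
  fix g g' h h'
  assume v: "g \<in> pverts (hadamard_graph s H)" "g' \<in> pverts (hadamard_graph s H)"
    "h \<in> pverts (hadamard_graph s H')" "h' \<in> pverts (hadamard_graph s H')"
    and ne: "(g, g') \<in> parcs (hadamard_graph s H) \<longleftrightarrow> (h, h') \<notin> parcs (hadamard_graph s H')"
  interpret magic_unitary "pverts (hadamard_graph s H)" "pverts (hadamard_graph s H')" "hadamard_magic s p q"
    by (rule magic_unitary_hadamard_magic)
  have nz: "b \<noteq> 0" if "b ^ s = 1" for b :: complex using that s by (auto simp: power_0_left)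
  have row_col: "hadamard_magic s p q (Row i a) (Row i' b) * hadamard_magic s p q (Col l c) (Col j d) = 0"
    if "a ^ s = 1" "b ^ s = 1" "c ^ s = 1" "d ^ s = 1" "a * H $ i $ l = c \<longleftrightarrow> b * H' $ i' $ j \<noteq> d"
    for a b c d i i' l j
  proof -
    have "H' $ i' $ j * (c / d) \<noteq> (a / b) * H $ i $ l"
    proof
      assume "H' $ i' $ j * (c / d) = (a / b) * H $ i $ l"
      then have "(b * H' $ i' $ j) * c = d * (a * H $ i $ l)"
        using that nz by (simp add: field_simps)
      then show False using that nz by (metis mult.commute mult_cancel_left)
    qed
    then show ?thesis
      using that by (simp add: spectral_projections_intertwine power_divide)
  qed
  have col_row: "hadamard_magic s p q (Col l c) (Col j d) * hadamard_magic s p q (Row i a) (Row i' b) = 0"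
    if "a ^ s = 1" "b ^ s = 1" "c ^ s = 1" "d ^ s = 1" "a * H $ i $ l = c \<longleftrightarrow> b * H' $ i' $ j \<noteq> d"
    for a b c d i i' l j
  proof -
    have "star (hadamard_magic s p q (Row i a) (Row i' b) * hadamard_magic s p q (Col l c) (Col j d)) = 0"
      using row_col[OF that] by simp
    moreover have "star (hadamard_magic s p q (Row i a) (Row i' b)) = hadamard_magic s p q (Row i a) (Row i' b)"
      "star (hadamard_magic s p q (Col l c) (Col j d)) = hadamard_magic s p q (Col l c) (Col j d)"
      by (rule star_U; use that in \<open>simp add: pverts_hadamard_graph[OF s]\<close>)+
    ultimately show ?thesis by (simp add: star_mult)
  qed
  show "hadamard_magic s p q g h * hadamard_magic s p q g' h' = 0"
    using v ne row_col col_row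
    by (cases g; cases g'; cases h; cases h')
       (auto simp: pverts_hadamard_graph[OF s] parcs_hadamard_graph[OF s] simp del: hadamard_magic.simps(1,2))
qed

end


section \<open>Finite-dimensional inner products\<close>

definition ip :: "'k set \<Rightarrow> ('k \<Rightarrow> complex) \<Rightarrow> ('k \<Rightarrow> complex) \<Rightarrow> complex" where
  "ip K f g = (\<Sum>k\<in>K. cnj (f k) * g k)"

text \<open>Vectors are functions on the whole type, while \<open>ip K\<close> reads only their
  values on \<open>K\<close>; expansions are therefore stated on \<open>K\<close> alone.\<close>

definition linear_space :: "('k \<Rightarrow> complex) set \<Rightarrow> bool" where
  "linear_space F \<longleftrightarrow> (\<lambda>_. 0) \<in> F \<and> (\<forall>f\<in>F. \<forall>g\<in>F. \<forall>c. (\<lambda>k. f k + c * g k) \<in> F)"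

lemma linear_space_sum:
  assumes "linear_space F" "\<And>a. a \<in> A \<Longrightarrow> e a \<in> F"
  shows "(\<lambda>k. \<Sum>a\<in>A. c a * e a k) \<in> F"
  using assms(2)
proof (induction A rule: infinite_finite_induct)
  case (insert a A)
  then have "(\<lambda>k. \<Sum>a\<in>A. c a * e a k) \<in> F" "e a \<in> F" by auto
  then have "(\<lambda>k. (\<Sum>a\<in>A. c a * e a k) + c a * e a k) \<in> F"
    using assms(1) by (auto simp: linear_space_def)
  then show ?case using insert by (simp add: add.commute)
qed (use assms(1) in \<open>auto simp: linear_space_def\<close>)

lemma linear_space_scale:
  assumes "linear_space F" "f \<in> F"
  shows "(\<lambda>k. c * f k) \<in> F"
  using linear_space_sum[of F "{()}" "\<lambda>_. f" "\<lambda>_. c"] assms by simp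

lemma linear_space_diff:
  assumes "linear_space F" "f \<in> F" "g \<in> F"
  shows "(\<lambda>k. f k - g k) \<in> F"
proof -
  have "(\<lambda>k. f k + (-1) * g k) \<in> F"
    using assms unfolding linear_space_def by blast
  then show ?thesis by simp
qed

lemma ip_sum_right: "ip K f (\<lambda>k. \<Sum>a\<in>A. c a * e a k) = (\<Sum>a\<in>A. c a * ip K f (e a))"
  unfolding ip_def sum_distrib_left by (subst sum.swap) (simp add: mult_ac)

lemma ip_diff_right: "ip K f (\<lambda>k. g k - h k) = ip K f g - ip K f h"
  by (simp add: ip_def algebra_simps sum_subtractf)

lemma ip_diff_left: "ip K (\<lambda>k. g k - h k) f = ip K g f - ip K h f"
  by (simp add: ip_def algebra_simps sum_subtractf)

lemma cnj_ip: "cnj (ip K f g) = ip K g f"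
  by (simp add: ip_def mult.commute)

lemma ip_self: "ip K f f = complex_of_real (\<Sum>k\<in>K. (cmod (f k))\<^sup>2)"
  by (simp add: ip_def mult.commute flip: complex_norm_square)

lemma ip_self_nonneg: "ip K f f \<in> \<real>\<^sub>\<ge>\<^sub>0"
  unfolding ip_self nonneg_Reals_of_real_iff by (simp add: sum_nonneg)

lemma ip_self_eq_0_iff: "finite K \<Longrightarrow> ip K f f = 0 \<longleftrightarrow> (\<forall>k\<in>K. f k = 0)"
  by (simp add: ip_self sum_nonneg_eq_0_iff del: of_real_sum)

lemma ip_cong: "(\<And>k. k \<in> K \<Longrightarrow> f k = f' k) \<Longrightarrow> (\<And>k. k \<in> K \<Longrightarrow> g k = g' k) \<Longrightarrow> ip K f g = ip K f' g'"
  by (simp add: ip_def)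

definition orthonormal :: "'k set \<Rightarrow> nat \<Rightarrow> (nat \<Rightarrow> 'k \<Rightarrow> complex) \<Rightarrow> bool" where
  "orthonormal K m e \<longleftrightarrow> (\<forall>a<m. \<forall>b<m. ip K (e a) (e b) = (if a = b then 1 else 0))"

definition residual :: "'k set \<Rightarrow> nat \<Rightarrow> (nat \<Rightarrow> 'k \<Rightarrow> complex) \<Rightarrow> ('k \<Rightarrow> complex) \<Rightarrow> 'k \<Rightarrow> complex" where
  "residual K m e f = (\<lambda>k. f k - (\<Sum>a<m. ip K (e a) f * e a k))"

lemma ip_residual:
  assumes "orthonormal K m e" "b < m"
  shows "ip K (e b) (residual K m e f) = 0"
proof -
  have "(\<Sum>a<m. ip K (e a) f * ip K (e b) (e a)) = (\<Sum>a<m. if a = b then ip K (e a) f else 0)"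
    using assms by (intro sum.cong) (auto simp: orthonormal_def)
  then show ?thesis
    using assms(2) unfolding residual_def ip_diff_right ip_sum_right by simp
qed

lemma ip_residual_self:
  assumes "orthonormal K m e"
  shows "ip K f (residual K m e f) = ip K (residual K m e f) (residual K m e f)"
proof -
  have "ip K (\<lambda>k. \<Sum>a<m. ip K (e a) f * e a k) (residual K m e f)
      = cnj (\<Sum>a<m. ip K (e a) f * ip K (residual K m e f) (e a))"
    by (simp add: cnj_ip flip: ip_sum_right)
  also have "\<dots> = 0"
    using ip_residual[OF assms] by (simp add: cnj_ip)
  finally show ?thesis
    unfolding residual_def[of K m e f] by (simp add: ip_diff_left residual_def)
qed

text \<open>Bessel's inequality for the point mass at each \<open>k\<close>, summed over
  \<open>K\<close>.\<close>

lemma orthonormal_card_le: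
  assumes "finite K" "orthonormal K m e"
  shows "m \<le> card K"
proof -
  have le: "(\<Sum>a<m. (cmod (e a k))\<^sup>2) \<le> 1" if k: "k \<in> K" for k
  proof -
    let ?d = "\<lambda>l. if l = k then 1 else 0"
    have "ip K g ?d = (\<Sum>l\<in>K. if l = k then cnj (g k) else 0)"
      "ip K ?d g = (\<Sum>l\<in>K. if l = k then g k else 0)" for g
      unfolding ip_def by (auto intro!: sum.cong)
    then have ipd: "ip K g ?d = cnj (g k)" "ip K ?d g = g k" for g
      using k assms(1) by simp_all
    have "ip K ?d (residual K m e ?d) \<in> \<real>\<^sub>\<ge>\<^sub>0"
      unfolding ip_residual_self[OF assms(2)] by (rule ip_self_nonneg)
    then have "1 - (\<Sum>a<m. cnj (e a k) * e a k) \<in> \<real>\<^sub>\<ge>\<^sub>0"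
      by (simp add: ipd residual_def)
    also have "1 - (\<Sum>a<m. cnj (e a k) * e a k) = complex_of_real (1 - (\<Sum>a<m. (cmod (e a k))\<^sup>2))"
      by (simp add: mult.commute flip: complex_norm_square)
    finally show ?thesis by (simp only: nonneg_Reals_of_real_iff)
  qed
  have "real m = (\<Sum>a<m. \<Sum>k\<in>K. (cmod (e a k))\<^sup>2)"
  proof -
    have "(\<Sum>k\<in>K. (cmod (e a k))\<^sup>2) = 1" if "a < m" for a
    proof -
      have "complex_of_real (\<Sum>k\<in>K. (cmod (e a k))\<^sup>2) = 1"
        using assms(2) that by (simp add: orthonormal_def del: of_real_sum flip: ip_self)
      then show ?thesis by (simp only: of_real_eq_1_iff)
    qed
    then show ?thesis by simp
  qed
  also have "\<dots> = (\<Sum>k\<in>K. \<Sum>a<m. (cmod (e a k))\<^sup>2)"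
    by (rule sum.swap)
  also have "\<dots> \<le> (\<Sum>k\<in>K. 1)"
    by (intro sum_mono le)
  finally show ?thesis by simp
qed

text \<open>An orthonormal family of maximal length works: a nonzero residual could be normalised
  and appended.\<close>

lemma orthonormal_basis_exists:
  assumes "finite K" "linear_space F"
  shows "\<exists>m e. (\<forall>a<m. e a \<in> F) \<and> orthonormal K m e \<and>
    (\<forall>f\<in>F. \<forall>k\<in>K. f k = (\<Sum>a<m. ip K (e a) f * e a k))"
proof -
  define P where "P m \<longleftrightarrow> (\<exists>e. (\<forall>a<m. e a \<in> F) \<and> orthonormal K m e)" for m
  have "P 0" by (simp add: P_def orthonormal_def)
  moreover have bound: "\<forall>m. P m \<longrightarrow> m \<le> card K"
    using orthonormal_card_le[OF assms(1)] by (auto simp: P_def)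
  ultimately obtain m where m: "P m" "\<And>n. P n \<Longrightarrow> n \<le> m"
    by (metis GreatestI_nat Greatest_le_nat)
  then obtain e where e: "\<And>a. a < m \<Longrightarrow> e a \<in> F" "orthonormal K m e"
    by (auto simp: P_def)
  have "residual K m e f k = 0" if f: "f \<in> F" and k: "k \<in> K" for f k
  proof (rule ccontr)
    assume nz: "residual K m e f k \<noteq> 0"
    let ?r = "residual K m e f"
    define N where "N = sqrt (\<Sum>k\<in>K. (cmod (?r k))\<^sup>2)"
    have "(\<Sum>k\<in>K. (cmod (?r k))\<^sup>2) > 0"
      using nz k assms(1) by (intro sum_pos2[of K k]) auto
    then have N: "N > 0" "ip K ?r ?r = of_real (N\<^sup>2)"
      by (simp_all add: N_def ip_self sum_nonneg)
    have r: "?r \<in> F"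
      unfolding residual_def
      by (intro linear_space_diff[OF assms(2) f] linear_space_sum[OF assms(2)]) (use e in auto)
    define u where "u = (\<lambda>k. ?r k / of_real N)"
    have "u \<in> F"
      using linear_space_scale[OF assms(2) r, of "1 / of_real N"] by (simp add: u_def)
    have ipu: "ip K g u = ip K g ?r / of_real N" "ip K u g = ip K ?r g / of_real N" for g
      by (simp_all add: ip_def u_def sum_divide_distrib)
    have uu: "ip K u u = 1"
      using N by (simp add: ipu power2_eq_square)
    have ue: "ip K (e a) u = 0" "ip K u (e a) = 0" if "a < m" for a
      using ip_residual[OF e(2) that, of f] cnj_ip[of K "e a" u] by (simp_all add: ipu)
    have "P (Suc m)"
      unfolding P_def
    proof (intro exI conjI allI impI)
      show "(e(m := u)) a \<in> F" if "a < Suc m" for a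
        using that e(1) \<open>u \<in> F\<close> by (auto simp: less_Suc_eq)
      show "orthonormal K (Suc m) (e(m := u))"
        using e(2) uu ue by (auto simp: orthonormal_def less_Suc_eq)
    qed
    then show False using m(2) by fastforce
  qed
  then show ?thesis
    using e by (intro exI[of _ m] exI[of _ e]) (auto simp: residual_def)
qed

section \<open>Hermitian and positive definite matrices\<close>

definition mat_app :: "'k set \<Rightarrow> ('k \<Rightarrow> 'k \<Rightarrow> complex) \<Rightarrow> ('k \<Rightarrow> complex) \<Rightarrow> 'k \<Rightarrow> complex" where
  "mat_app K M c = (\<lambda>k. \<Sum>l\<in>K. M k l * c l)"

lemma ip_mat_app:
  assumes "\<And>k l. k \<in> K \<Longrightarrow> l \<in> K \<Longrightarrow> M l k = cnj (M k l)"
  shows "ip K (mat_app K M c) d = ip K c (mat_app K M d)"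
proof -
  have "ip K (mat_app K M c) d = (\<Sum>k\<in>K. \<Sum>l\<in>K. cnj (M k l) * cnj (c l) * d k)"
    by (simp add: ip_def mat_app_def sum_distrib_right)
  also have "\<dots> = (\<Sum>l\<in>K. \<Sum>k\<in>K. cnj (c l) * (M l k * d k))"
  proof (subst sum.swap, intro sum.cong refl)
    fix k l assume "k \<in> K" "l \<in> K"
    then show "cnj (M k l) * cnj (c l) * d k = cnj (c l) * (M l k * d k)"
      using assms[of k l] by simp
  qed
  also have "\<dots> = ip K c (mat_app K M d)"
    by (simp add: ip_def mat_app_def sum_distrib_left)
  finally show ?thesis .
qed

lemma mat_app_mat_app:
  "mat_app K M (mat_app K N c) k = (\<Sum>l\<in>K. (\<Sum>j\<in>K. M k j * N j l) * c l)"
  unfolding mat_app_def sum_distrib_left sum_distrib_right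
  by (subst sum.swap) (simp add: mult_ac)

lemma mat_app_cong: "(\<And>l. l \<in> K \<Longrightarrow> c l = d l) \<Longrightarrow> mat_app K M c = mat_app K M d"
  by (simp add: mat_app_def)

text \<open>The residual \<open>r\<close> of \<open>c\<close> with respect to the range of
  \<open>R\<close> is orthogonal to \<open>R r\<close>, so definiteness gives
  \<open>r = 0\<close>.\<close>

lemma positive_definite_surjective:
  assumes "finite K" and herm: "\<And>k l. k \<in> K \<Longrightarrow> l \<in> K \<Longrightarrow> R l k = cnj (R k l)"
    and def: "\<And>c k. ip K c (mat_app K R c) = 0 \<Longrightarrow> k \<in> K \<Longrightarrow> c k = 0"
  shows "\<exists>d. \<forall>k\<in>K. c k = mat_app K R d k"
proof -
  define F where "F = {f. \<exists>d. \<forall>k\<in>K. f k = mat_app K R d k}"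
  have "linear_space F"
    unfolding linear_space_def
  proof (intro conjI ballI allI)
    show "(\<lambda>_. 0) \<in> F"
      by (auto simp: F_def mat_app_def intro!: exI[of _ "\<lambda>_. 0"])
    fix f g c assume "f \<in> F" "g \<in> F"
    then obtain d d' where "\<forall>k\<in>K. f k = mat_app K R d k" "\<forall>k\<in>K. g k = mat_app K R d' k"
      by (auto simp: F_def)
    then have "\<forall>k\<in>K. f k + c * g k = mat_app K R (\<lambda>k. d k + c * d' k) k"
      by (simp add: mat_app_def algebra_simps sum.distrib sum_distrib_left)
    then show "(\<lambda>k. f k + c * g k) \<in> F"
      unfolding F_def by blast
  qed
  from orthonormal_basis_exists[OF assms(1) this] obtain m e where
    e: "\<And>a. a < m \<Longrightarrow> e a \<in> F" "orthonormal K m e"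
      "\<And>f k. f \<in> F \<Longrightarrow> k \<in> K \<Longrightarrow> f k = (\<Sum>a<m. ip K (e a) f * e a k)"
    by blast
  define p where "p = (\<lambda>k. \<Sum>a<m. ip K (e a) c * e a k)"
  define r where "r = residual K m e c"
  have "p \<in> F"
    unfolding p_def by (rule linear_space_sum[OF \<open>linear_space F\<close>]) (use e(1) in auto)
  have orth: "ip K r f = 0" if "f \<in> F" for f
  proof -
    have "ip K r f = ip K r (\<lambda>k. \<Sum>a<m. ip K (e a) f * e a k)"
      using e(3)[OF that] by (intro ip_cong) auto
    also have "\<dots> = (\<Sum>a<m. ip K (e a) f * cnj (ip K (e a) r))"
      by (simp add: ip_sum_right cnj_ip)
    also have "\<dots> = 0"
      unfolding r_def using ip_residual[OF e(2)] by simp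
    finally show ?thesis .
  qed
  have "ip K r (mat_app K R r) = 0"
    by (rule orth) (auto simp: F_def)
  then have "\<forall>k\<in>K. c k = p k"
    using def[of r] by (simp add: r_def residual_def p_def)
  then show ?thesis using \<open>p \<in> F\<close> by (simp add: F_def)
qed

text \<open>
  Since \<open>\<Pi>\<close> commutes with \<open>R\<close>, writing \<open>c = R d\<close> gives
  \<open>\<langle>c, \<Pi> c\<rangle> = \<langle>d, \<Pi> R \<Pi> d\<rangle> = \<langle>\<Pi> d, R \<Pi> d\<rangle>\<close>.
\<close>

lemma psd_of_square_eq:
  assumes "finite K"
    and M: "\<And>k l. k \<in> K \<Longrightarrow> l \<in> K \<Longrightarrow> M l k = cnj (M k l)"
    and R: "\<And>k l. k \<in> K \<Longrightarrow> l \<in> K \<Longrightarrow> R l k = cnj (R k l)"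
    and MM: "\<And>k l. k \<in> K \<Longrightarrow> l \<in> K \<Longrightarrow> (\<Sum>j\<in>K. M k j * M j l) = (\<Sum>j\<in>K. M k j * R j l)"
    and pos: "\<And>c. ip K c (mat_app K R c) \<in> \<real>\<^sub>\<ge>\<^sub>0"
    and def: "\<And>c k. ip K c (mat_app K R c) = 0 \<Longrightarrow> k \<in> K \<Longrightarrow> c k = 0"
  shows "ip K c (mat_app K M c) \<in> \<real>\<^sub>\<ge>\<^sub>0"
proof -
  let ?M = "mat_app K M" and ?R = "mat_app K R"
  \<comment> \<open>The adjoint of \<open>M M = M R\<close> is \<open>M M = R M\<close>, since both
    matrices are Hermitian; hence they commute.\<close>
  have MR: "(\<Sum>j\<in>K. M k j * R j l) = (\<Sum>j\<in>K. R k j * M j l)" if "k \<in> K" "l \<in> K" for k l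
  proof -
    have "(\<Sum>j\<in>K. R k j * M j l) = cnj (\<Sum>j\<in>K. M l j * R j k)"
      unfolding cnj_sum
    proof (intro sum.cong refl)
      fix j assume "j \<in> K"
      then show "R k j * M j l = cnj (M l j * R j k)"
        using that M[of l j] R[of j k] by simp
    qed
    also have "\<dots> = cnj (\<Sum>j\<in>K. M l j * M j k)"
      using that by (simp only: MM)
    also have "\<dots> = (\<Sum>j\<in>K. M k j * M j l)"
      unfolding cnj_sum
    proof (intro sum.cong refl)
      fix j assume "j \<in> K"
      then show "cnj (M l j * M j k) = M k j * M j l"
        using that M[of l j] M[of j k] by simp
    qed
    finally show ?thesis using that by (simp only: MM)
  qed
  have MMv: "?M (?M d) k = ?M (?R d) k" if "k \<in> K" for d k
    unfolding mat_app_mat_app using that by (intro sum.cong refl) (simp only: MM)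
  have MRv: "?M (?R d) k = ?R (?M d) k" if "k \<in> K" for d k
    unfolding mat_app_mat_app using that by (intro sum.cong refl) (simp only: MR)
  have "\<exists>d. \<forall>k\<in>K. c k = ?R d k"
  proof (rule positive_definite_surjective[OF assms(1)])
    show "R l k = cnj (R k l)" if "k \<in> K" "l \<in> K" for k l
      using that by (rule R)
    show "f k = 0" if "ip K f (?R f) = 0" "k \<in> K" for f k
      using that by (rule def)
  qed
  then obtain d where d: "\<And>k. k \<in> K \<Longrightarrow> c k = ?R d k" by blast
  have "ip K c (?M c) = ip K (?R d) (?M (?R d))"
    using d mat_app_cong[of K c "?R d" M] by (intro ip_cong) auto
  also have "\<dots> = ip K d (?R (?M (?R d)))"
    by (rule ip_mat_app) (rule R)
  also have "\<dots> = ip K d (?M (?R (?R d)))"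
    by (intro ip_cong) (simp_all add: MRv)
  also have "\<dots> = ip K d (?M (?M (?R d)))"
    by (intro ip_cong) (simp_all add: MMv)
  also have "\<dots> = ip K (?M d) (?M (?R d))"
    by (rule ip_mat_app[symmetric]) (rule M)
  also have "\<dots> = ip K (?M d) (?R (?M d))"
    by (intro ip_cong) (simp_all add: MRv)
  finally show ?thesis using pos by simp
qed


section \<open>The invariant functional of a unitary\<close>

locale algebra_unitary =
  fixes I :: "'i set" and J :: "'j set" and U :: "'i \<Rightarrow> 'j \<Rightarrow> 'a::complex_star_algebra_1"
  assumes finite_I: "finite I" and finite_J: "finite J"
    and isometry: "\<lbrakk>j \<in> J; j' \<in> J\<rbrakk> \<Longrightarrow> (\<Sum>i\<in>I. star (U i j) * U i j') = (if j = j' then 1 else 0)"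
    and coisometry: "\<lbrakk>i \<in> I; i' \<in> I\<rbrakk> \<Longrightarrow> (\<Sum>j\<in>J. U i j * star (U i' j)) = (if i = i' then 1 else 0)"

text \<open>Both components are kept since \<open>U\<close> is rectangular: \<open>U v = w 1\<close>
  relates a vector on \<open>J\<close> to a vector on \<open>I\<close>. The values of
  \<open>w\<close> on \<open>I\<close> are determined by \<open>v\<close>.\<close>

definition fixed_pairs ::
    "'i set \<Rightarrow> 'j set \<Rightarrow> ('i \<Rightarrow> 'j \<Rightarrow> 'a::complex_star_algebra_1) \<Rightarrow> (('i \<Rightarrow> complex) \<times> ('j \<Rightarrow> complex)) set"
  where "fixed_pairs I J U = {(w, v). \<forall>i\<in>I. (\<Sum>j\<in>J. v j *\<^sub>C U i j) = w i *\<^sub>C 1}"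

text \<open>
  If \<open>h\<close> is the invariant state of the linking algebra generated by the entries of \<open>U\<close>, then the matrix
  \<open>h (U i j)\<close> maps each fixed vector \<open>v\<close> to its partner \<open>w\<close> and annihilates the orthogonal
  complement of the fixed vectors.
\<close>

definition is_invariant_functional ::
    "'i set \<Rightarrow> 'j set \<Rightarrow> ('i \<Rightarrow> 'j \<Rightarrow> 'a::complex_star_algebra_1) \<Rightarrow> ('i \<Rightarrow> 'j \<Rightarrow> complex) \<Rightarrow> bool" where
  "is_invariant_functional I J U \<theta> \<longleftrightarrow>
     (\<forall>(w, v)\<in>fixed_pairs I J U. \<forall>i\<in>I. (\<Sum>j\<in>J. \<theta> i j * v j) = w i) \<and>
     (\<forall>i\<in>I. \<exists>w. (w, \<lambda>j. cnj (\<theta> i j)) \<in> fixed_pairs I J U)"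

lemma fixed_pairs_sum:
  assumes "\<And>a. a \<in> A \<Longrightarrow> (w a, v a) \<in> fixed_pairs I J U"
  shows "(\<lambda>i. \<Sum>a\<in>A. c a * w a i, \<lambda>j. \<Sum>a\<in>A. c a * v a j) \<in> fixed_pairs I J U"
proof -
  have "(\<Sum>j\<in>J. (\<Sum>a\<in>A. c a * v a j) *\<^sub>C U i j) = (\<Sum>a\<in>A. c a * w a i) *\<^sub>C 1" if "i \<in> I" for i
  proof -
    have "(\<Sum>j\<in>J. (\<Sum>a\<in>A. c a * v a j) *\<^sub>C U i j) = (\<Sum>a\<in>A. c a *\<^sub>C (\<Sum>j\<in>J. v a j *\<^sub>C U i j))"
      unfolding scaleC_sum_left scaleC_sum_right scaleC_scaleC by (rule sum.swap)
    also have "\<dots> = (\<Sum>a\<in>A. c a *\<^sub>C (w a i *\<^sub>C 1))"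
      using assms that by (intro sum.cong) (auto simp: fixed_pairs_def)
    finally show ?thesis by (simp add: scaleC_sum_left scaleC_scaleC)
  qed
  then show ?thesis by (simp add: fixed_pairs_def)
qed

lemma fixed_pairs_cong:
  assumes "(w, v) \<in> fixed_pairs I J U" "\<And>i. i \<in> I \<Longrightarrow> w' i = w i" "\<And>j. j \<in> J \<Longrightarrow> v' j = v j"
  shows "(w', v') \<in> fixed_pairs I J U"
  using assms by (simp add: fixed_pairs_def)

lemma linear_space_fixed_vectors: "linear_space (snd ` fixed_pairs I J U)"
  unfolding linear_space_def
proof (intro conjI ballI allI)
  show "(\<lambda>_. 0) \<in> snd ` fixed_pairs I J U"
    by (rule image_eqI[of _ _ "(\<lambda>_. 0, \<lambda>_. 0)"]) (auto simp: fixed_pairs_def)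
  fix f g c assume "f \<in> snd ` fixed_pairs I J U" "g \<in> snd ` fixed_pairs I J U"
  then obtain w w' where "(w, f) \<in> fixed_pairs I J U" "(w', g) \<in> fixed_pairs I J U"
    by auto
  then have "(\<lambda>i. w i + c * w' i, \<lambda>k. f k + c * g k) \<in> fixed_pairs I J U"
    by (auto simp: fixed_pairs_def scaleC_add_left sum.distrib simp flip: scaleC_scaleC scaleC_sum_right)
  then show "(\<lambda>k. f k + c * g k) \<in> snd ` fixed_pairs I J U"
    by force
qed

context algebra_unitary
begin

abbreviation "FP \<equiv> fixed_pairs I J U"

text \<open>The functional expands a vector in an orthonormal basis \<open>Q\<close> of the fixed
  vectors and replaces each \<open>Q a\<close> by its partner \<open>P a\<close>.\<close>

lemma invariant_functional_basis:
  obtains m :: nat and P Q where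
    "\<And>a. a < m \<Longrightarrow> (P a, Q a) \<in> FP" "orthonormal J m Q"
    "\<And>w v j. (w, v) \<in> FP \<Longrightarrow> j \<in> J \<Longrightarrow> v j = (\<Sum>a<m. ip J (Q a) v * Q a j)"
    "is_invariant_functional I J U (\<lambda>i j. \<Sum>a<m. P a i * cnj (Q a j))"
proof -
  obtain m Q where Q: "\<And>a. a < m \<Longrightarrow> Q a \<in> snd ` FP" "orthonormal J m Q"
    "\<And>v j. v \<in> snd ` FP \<Longrightarrow> j \<in> J \<Longrightarrow> v j = (\<Sum>a<m. ip J (Q a) v * Q a j)"
    using orthonormal_basis_exists[OF finite_J linear_space_fixed_vectors[of I J U]] by blast
  define P where "P a = (SOME w. (w, Q a) \<in> FP)" for a
  have P: "(P a, Q a) \<in> FP" if "a < m" for a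
  proof -
    have "\<exists>w. (w, Q a) \<in> FP" using Q(1)[OF that] by auto
    then show ?thesis unfolding P_def by (rule someI_ex)
  qed
  have exp: "v j = (\<Sum>a<m. ip J (Q a) v * Q a j)" if "(w, v) \<in> FP" "j \<in> J" for w v j
    using Q(3)[of v j] that by force
  let ?\<theta> = "\<lambda>i j. \<Sum>a<m. P a i * cnj (Q a j)"
  have "is_invariant_functional I J U ?\<theta>"
    unfolding is_invariant_functional_def
  proof (intro conjI ballI, clarify)
    fix w v i assume wv: "(w, v) \<in> FP" and i: "i \<in> I"
    have "(\<lambda>i. \<Sum>a<m. ip J (Q a) v * P a i, \<lambda>j. \<Sum>a<m. ip J (Q a) v * Q a j) \<in> FP"
      by (rule fixed_pairs_sum) (use P in auto)
    then have "(\<lambda>i. \<Sum>a<m. ip J (Q a) v * P a i, v) \<in> FP"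
      by (rule fixed_pairs_cong) (use exp[OF wv] in auto)
    then have "w i *\<^sub>C (1::'a) = (\<Sum>a<m. ip J (Q a) v * P a i) *\<^sub>C 1"
      using wv i by (simp add: fixed_pairs_def)
    then have "w i = (\<Sum>a<m. ip J (Q a) v * P a i)"
      by simp
    also have "\<dots> = (\<Sum>j\<in>J. ?\<theta> i j * v j)"
      unfolding ip_def sum_distrib_right by (subst sum.swap) (simp add: mult_ac)
    finally show "(\<Sum>j\<in>J. ?\<theta> i j * v j) = w i" ..
  next
    fix i assume "i \<in> I"
    have "(\<lambda>i'. \<Sum>a<m. cnj (P a i) * P a i', \<lambda>j. \<Sum>a<m. cnj (P a i) * Q a j) \<in> FP"
      by (rule fixed_pairs_sum) (use P in auto)
    then show "\<exists>w. (w, \<lambda>j. cnj (?\<theta> i j)) \<in> FP"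
      by auto
  qed
  show ?thesis
    by (rule that[OF P Q(2) exp \<open>is_invariant_functional I J U ?\<theta>\<close>])
qed

text \<open>The conjugate of the difference is itself a fixed vector, and testing on it shows that
  it is orthogonal to itself. Every identity for \<open>haar\<close> below is obtained by comparing
  two functionals in this way.\<close>

lemma row_functional_unique:
  assumes L: "(w1, \<lambda>j. cnj (L j)) \<in> FP" and R: "(w2, \<lambda>j. cnj (R j)) \<in> FP"
    and eq: "\<And>w v. (w, v) \<in> FP \<Longrightarrow> (\<Sum>j\<in>J. L j * v j) = (\<Sum>j\<in>J. R j * v j)"
    and j: "j \<in> J"
  shows "L j = R j"
proof -
  let ?d = "\<lambda>j. cnj (L j) - cnj (R j)"
  have "?d \<in> snd ` FP"
    by (rule linear_space_diff[OF linear_space_fixed_vectors]) (use L R in \<open>force+\<close>)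
  then obtain w where "(w, ?d) \<in> FP" by auto
  from eq[OF this] have "ip J ?d ?d = 0"
    by (simp add: ip_def algebra_simps sum_subtractf sum.distrib)
  then have "cnj (L j) = cnj (R j)"
    using j by (simp add: ip_self_eq_0_iff finite_J)
  then show ?thesis by simp
qed

definition haar :: "'i \<Rightarrow> 'j \<Rightarrow> complex" where
  "haar = (SOME \<theta>. is_invariant_functional I J U \<theta>)"

lemma is_invariant_functional_haar: "is_invariant_functional I J U haar"
proof (rule invariant_functional_basis)
  fix m P Q
  assume "is_invariant_functional I J U (\<lambda>i j. \<Sum>a<m::nat. P a i * cnj (Q a j))"
  then have "\<exists>\<theta>. is_invariant_functional I J U \<theta>"
    by (intro exI)
  then show ?thesis unfolding haar_def by (rule someI_ex)
qed

lemma haar_apply: "(w, v) \<in> FP \<Longrightarrow> i \<in> I \<Longrightarrow> (\<Sum>j\<in>J. haar i j * v j) = w i"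
  using is_invariant_functional_haar by (auto simp: is_invariant_functional_def)

lemma haar_row:
  assumes "i \<in> I"
  obtains w where "(w, \<lambda>j. cnj (haar i j)) \<in> FP"
  using is_invariant_functional_haar assms by (auto simp: is_invariant_functional_def)

lemma haar_unique:
  assumes "is_invariant_functional I J U \<theta>" "i \<in> I" "j \<in> J"
  shows "\<theta> i j = haar i j"
proof -
  obtain w1 where "(w1, \<lambda>j. cnj (\<theta> i j)) \<in> FP"
    using assms by (auto simp: is_invariant_functional_def)
  moreover obtain w2 where "(w2, \<lambda>j. cnj (haar i j)) \<in> FP"
    using haar_row assms by blast
  ultimately show ?thesis
    by (rule row_functional_unique)
       (use assms haar_apply in \<open>auto simp: is_invariant_functional_def\<close>)
qed

text \<open>\<open>U\<close> is block diagonal for the colourings \<open>r\<close> and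
  \<open>r'\<close>, so cutting a fixed pair down to one colour leaves it fixed. A row of
  \<open>haar\<close> and its truncation to the colour of \<open>i\<close> therefore agree on all
  fixed vectors.\<close>

lemma haar_eq_0:
  assumes zero: "\<And>i j. i \<in> I \<Longrightarrow> j \<in> J \<Longrightarrow> r i \<noteq> r' j \<Longrightarrow> U i j = 0"
    and i: "i \<in> I" and j: "j \<in> J" and ne: "r i \<noteq> r' j"
  shows "haar i j = 0"
proof -
  have res: "(\<lambda>i. of_bool (r i = c) * w i, \<lambda>j. of_bool (r' j = c) * v j) \<in> FP" if "(w, v) \<in> FP" for w v c
  proof -
    have "(\<Sum>j\<in>J. (of_bool (r' j = c) * v j) *\<^sub>C U i j) = (of_bool (r i = c) * w i) *\<^sub>C 1" if i: "i \<in> I" for i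
    proof -
      have "(\<Sum>j\<in>J. (of_bool (r' j = c) * v j) *\<^sub>C U i j) = (\<Sum>j\<in>J. of_bool (r i = c) *\<^sub>C (v j *\<^sub>C U i j))"
        using zero[OF i] by (intro sum.cong) (auto simp: scaleC_scaleC)
      also have "\<dots> = (of_bool (r i = c) * w i) *\<^sub>C 1"
        using \<open>(w, v) \<in> FP\<close> i by (simp add: fixed_pairs_def scaleC_scaleC flip: scaleC_sum_right)
      finally show ?thesis .
    qed
    then show ?thesis by (simp add: fixed_pairs_def)
  qed
  obtain w where w: "(w, \<lambda>j. cnj (haar i j)) \<in> FP"
    using haar_row i by blast
  have "haar i j = haar i j * of_bool (r' j = r i)"
  proof (rule row_functional_unique[OF w _ _ j])
    show "(\<lambda>i'. of_bool (r i' = r i) * w i', \<lambda>j. cnj (haar i j * of_bool (r' j = r i))) \<in> FP"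
      by (rule fixed_pairs_cong[OF res[OF w, of "r i"]]) auto
    fix w' v' assume wv: "(w', v') \<in> FP"
    show "(\<Sum>j\<in>J. haar i j * v' j) = (\<Sum>j\<in>J. haar i j * of_bool (r' j = r i) * v' j)"
      using haar_apply[OF wv i] haar_apply[OF res[OF wv, of "r i"] i] by (simp add: mult.assoc)
  qed
  then show ?thesis using ne by auto
qed

end

definition extension :: "'i set \<Rightarrow> ('i \<Rightarrow> 'k) \<Rightarrow> ('i \<Rightarrow> complex) \<Rightarrow> 'k \<Rightarrow> complex" where
  "extension I \<sigma> w = (\<lambda>k. if k \<in> \<sigma> ` I then w (inv_into I \<sigma> k) else 0)"

lemma extension_apply: "inj_on \<sigma> I \<Longrightarrow> i \<in> I \<Longrightarrow> extension I \<sigma> w (\<sigma> i) = w i"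
  by (simp add: extension_def)

lemma sum_extension:
  assumes "inj_on \<sigma> I" "\<sigma> ` I \<subseteq> K" "finite K" "\<And>k. g k 0 = 0"
  shows "(\<Sum>k\<in>K. g k (extension I \<sigma> w k)) = (\<Sum>i\<in>I. g (\<sigma> i) (w i))"
proof -
  have "(\<Sum>k\<in>K. g k (extension I \<sigma> w k)) = (\<Sum>k\<in>\<sigma> ` I. g k (extension I \<sigma> w k))"
    using assms by (intro sum.mono_neutral_right) (auto simp: extension_def)
  also have "\<dots> = (\<Sum>i\<in>I. g (\<sigma> i) (w i))"
    using assms(1) by (subst sum.reindex) (auto intro!: sum.cong simp: extension_apply)
  finally show ?thesis .
qed

text \<open>Restriction transports the fixed rows of the larger functional and extension by zero
  transports the test vectors, so the restricted functional is invariant and uniqueness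
  applies.\<close>

lemma haar_embed_fixed_pairs:
  assumes A: "algebra_unitary I J U" and B: "algebra_unitary K L V"
    and \<sigma>: "inj_on \<sigma> I" "\<sigma> ` I \<subseteq> K" and \<rho>: "inj_on \<rho> J" "\<rho> ` J \<subseteq> L"
    and res: "\<And>w v. (w, v) \<in> fixed_pairs K L V \<Longrightarrow> (w \<circ> \<sigma>, v \<circ> \<rho>) \<in> fixed_pairs I J U"
    and ext: "\<And>w v. (w, v) \<in> fixed_pairs I J U \<Longrightarrow> (extension I \<sigma> w, extension J \<rho> v) \<in> fixed_pairs K L V"
    and ij: "i \<in> I" "j \<in> J"
  shows "algebra_unitary.haar K L V (\<sigma> i) (\<rho> j) = algebra_unitary.haar I J U i j"
proof -
  interpret A: algebra_unitary I J U by (rule A)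
  interpret B: algebra_unitary K L V by (rule B)
  have "is_invariant_functional I J U (\<lambda>i j. B.haar (\<sigma> i) (\<rho> j))"
    unfolding is_invariant_functional_def
  proof (intro conjI ballI, clarify)
    fix w v i assume wv: "(w, v) \<in> fixed_pairs I J U" and i: "i \<in> I"
    have "(\<Sum>j\<in>J. B.haar (\<sigma> i) (\<rho> j) * v j) = (\<Sum>l\<in>L. B.haar (\<sigma> i) l * extension J \<rho> v l)"
      using sum_extension[OF \<rho> B.finite_J, of "\<lambda>l x. B.haar (\<sigma> i) l * x"] by simp
    also have "\<dots> = w i"
      using B.haar_apply[OF ext[OF wv]] \<sigma> i by (auto simp: extension_apply)
    finally show "(\<Sum>j\<in>J. B.haar (\<sigma> i) (\<rho> j) * v j) = w i" .
  next
    fix i assume "i \<in> I"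
    then obtain w where "(w, \<lambda>l. cnj (B.haar (\<sigma> i) l)) \<in> fixed_pairs K L V"
      using B.haar_row \<sigma> by blast
    from res[OF this] show "\<exists>w. (w, \<lambda>j. cnj (B.haar (\<sigma> i) (\<rho> j))) \<in> fixed_pairs I J U"
      by (auto simp: o_def)
  qed
  then show ?thesis using A.haar_unique ij by blast
qed

text \<open>Here \<open>U\<close> is a diagonal block of \<open>V\<close>; the vanishing of the
  entries that leave the block makes restriction and extension by zero preserve fixed pairs.\<close>

lemma haar_embed:
  assumes A: "algebra_unitary I J U" and B: "algebra_unitary K L V"
    and \<sigma>: "inj_on \<sigma> I" "\<sigma> ` I \<subseteq> K" and \<rho>: "inj_on \<rho> J" "\<rho> ` J \<subseteq> L"
    and eq: "\<And>i j. i \<in> I \<Longrightarrow> j \<in> J \<Longrightarrow> V (\<sigma> i) (\<rho> j) = U i j"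
    and row: "\<And>i l. i \<in> I \<Longrightarrow> l \<in> L \<Longrightarrow> l \<notin> \<rho> ` J \<Longrightarrow> V (\<sigma> i) l = 0"
    and col: "\<And>k j. k \<in> K \<Longrightarrow> j \<in> J \<Longrightarrow> k \<notin> \<sigma> ` I \<Longrightarrow> V k (\<rho> j) = 0"
    and ij: "i \<in> I" "j \<in> J"
  shows "algebra_unitary.haar K L V (\<sigma> i) (\<rho> j) = algebra_unitary.haar I J U i j"
proof (rule haar_embed_fixed_pairs[OF A B \<sigma> \<rho> _ _ ij])
  interpret B: algebra_unitary K L V by (rule B)
  fix w v assume wv: "(w, v) \<in> fixed_pairs K L V"
  have "(\<Sum>j\<in>J. v (\<rho> j) *\<^sub>C U i j) = w (\<sigma> i) *\<^sub>C 1" if "i \<in> I" for i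
  proof -
    have "(\<Sum>j\<in>J. v (\<rho> j) *\<^sub>C U i j) = (\<Sum>l\<in>\<rho> ` J. v l *\<^sub>C V (\<sigma> i) l)"
      using \<rho> that by (subst sum.reindex) (auto simp: eq)
    also have "\<dots> = (\<Sum>l\<in>L. v l *\<^sub>C V (\<sigma> i) l)"
      using \<rho> that B.finite_J row by (intro sum.mono_neutral_left) auto
    finally show ?thesis using wv \<sigma> that by (auto simp: fixed_pairs_def)
  qed
  then show "(w \<circ> \<sigma>, v \<circ> \<rho>) \<in> fixed_pairs I J U"
    by (simp add: fixed_pairs_def)
next
  interpret B: algebra_unitary K L V by (rule B)
  fix w v assume wv: "(w, v) \<in> fixed_pairs I J U"
  have "(\<Sum>l\<in>L. extension J \<rho> v l *\<^sub>C V k l) = extension I \<sigma> w k *\<^sub>C 1" if k: "k \<in> K" for k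
  proof -
    have *: "(\<Sum>l\<in>L. extension J \<rho> v l *\<^sub>C V k l) = (\<Sum>j\<in>J. v j *\<^sub>C V k (\<rho> j))"
      using sum_extension[OF \<rho> B.finite_J, of "\<lambda>l x. x *\<^sub>C V k l"] by simp
    show ?thesis
    proof (cases "k \<in> \<sigma> ` I")
      case True
      then obtain i where "i \<in> I" "k = \<sigma> i" by auto
      then show ?thesis using * wv \<sigma> by (simp add: eq extension_apply fixed_pairs_def)
    next
      case False
      then show ?thesis using * col[OF k] by (simp add: extension_def)
    qed
  qed
  then show "(extension I \<sigma> w, extension J \<rho> v) \<in> fixed_pairs K L V"
    by (simp add: fixed_pairs_def)
qed


section \<open>Positivity of the invariant functional\<close>

lemma sum_swap_pairs:
  "(\<Sum>k\<in>K. \<Sum>j\<in>J. \<Sum>b\<in>B. \<Sum>l\<in>L. f k j b l) = (\<Sum>b\<in>B. \<Sum>l\<in>L. \<Sum>k\<in>K. \<Sum>j\<in>J. f k j b l)"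
proof -
  have "(\<Sum>p\<in>K \<times> J. \<Sum>q\<in>B \<times> L. f (fst p) (snd p) (fst q) (snd q))
      = (\<Sum>q\<in>B \<times> L. \<Sum>p\<in>K \<times> J. f (fst p) (snd p) (fst q) (snd q))"
    by (rule sum.swap)
  then show ?thesis by (simp add: sum.cartesian_product')
qed

text \<open>Unitarity of the pair matrix is assumed separately: expanding it also requires the
  entrywise adjoint of \<open>U\<close> to be unitary, which does not follow from unitarity of
  \<open>U\<close> over a noncommutative algebra.\<close>

locale pair_unitary = algebra_unitary I J U + pair: algebra_unitary "I \<times> I" "J \<times> J"
    "\<lambda>(i, i') (j, j'). U i j * star (U i' j')"
  for I :: "'i set" and J :: "'j set" and U :: "'i \<Rightarrow> 'j \<Rightarrow> 'a::complex_star_algebra_1"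
begin

lemma pair_fixed_iff:
  "(w, v) \<in> pair.FP \<longleftrightarrow>
     (\<forall>i\<in>I. \<forall>i'\<in>I. (\<Sum>j\<in>J. \<Sum>j'\<in>J. v (j, j') *\<^sub>C (U i j * star (U i' j'))) = w (i, i') *\<^sub>C 1)"
  by (auto simp: fixed_pairs_def sum.cartesian_product split_beta)

text \<open>Vectors on pairs are matrices, and being fixed means that \<open>U\<close>,
  \<open>v\<close> and the adjoint of \<open>U\<close> multiply to \<open>w\<close>. Multiplying by
  \<open>U\<close> on the right, or back by its adjoint, gives the equivalent relation
  \<open>U v = w U\<close>.\<close>

lemma pair_fixed_iff_intertwining:
  "(w, v) \<in> pair.FP \<longleftrightarrow>
     (\<forall>i\<in>I. \<forall>j\<in>J. (\<Sum>j'\<in>J. v (j', j) *\<^sub>C U i j') = (\<Sum>i'\<in>I. w (i, i') *\<^sub>C U i' j))"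
  (is "?L \<longleftrightarrow> ?R")
proof
  assume L: ?L
  show ?R
  proof (intro ballI)
    fix i j assume i: "i \<in> I" and j: "j \<in> J"
    have "(\<Sum>i'\<in>I. w (i, i') *\<^sub>C U i' j) = (\<Sum>i'\<in>I. (w (i, i') *\<^sub>C 1) * U i' j)"
      by (simp add: mult_scaleC_left)
    also have "\<dots> = (\<Sum>i'\<in>I. (\<Sum>j'\<in>J. \<Sum>k\<in>J. v (j', k) *\<^sub>C (U i j' * star (U i' k))) * U i' j)"
      using L i by (intro sum.cong refl) (simp add: pair_fixed_iff)
    also have "\<dots> = (\<Sum>i'\<in>I. \<Sum>j'\<in>J. \<Sum>k\<in>J. v (j', k) *\<^sub>C (U i j' * (star (U i' k) * U i' j)))"
      by (simp add: sum_distrib_right mult_scaleC_left mult.assoc)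
    also have "\<dots> = (\<Sum>j'\<in>J. \<Sum>k\<in>J. \<Sum>i'\<in>I. v (j', k) *\<^sub>C (U i j' * (star (U i' k) * U i' j)))"
      by (subst sum.swap) (rule sum.cong[OF refl], rule sum.swap)
    also have "\<dots> = (\<Sum>j'\<in>J. \<Sum>k\<in>J. v (j', k) *\<^sub>C (U i j' * (\<Sum>i'\<in>I. star (U i' k) * U i' j)))"
      by (simp add: sum_distrib_left scaleC_sum_right)
    also have "\<dots> = (\<Sum>j'\<in>J. \<Sum>k\<in>J. if k = j then v (j', j) *\<^sub>C U i j' else 0)"
      using j by (intro sum.cong refl) (simp add: isometry)
    also have "\<dots> = (\<Sum>j'\<in>J. v (j', j) *\<^sub>C U i j')"
      using j by (simp add: finite_J)
    finally show "(\<Sum>j'\<in>J. v (j', j) *\<^sub>C U i j') = (\<Sum>i'\<in>I. w (i, i') *\<^sub>C U i' j)" ..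
  qed
next
  assume R: ?R
  show ?L
    unfolding pair_fixed_iff
  proof (intro ballI)
    fix i i' assume i: "i \<in> I" and i': "i' \<in> I"
    have "(\<Sum>j\<in>J. \<Sum>k\<in>J. v (j, k) *\<^sub>C (U i j * star (U i' k)))
        = (\<Sum>k\<in>J. (\<Sum>j\<in>J. v (j, k) *\<^sub>C U i j) * star (U i' k))"
      by (subst sum.swap) (simp add: sum_distrib_right mult_scaleC_left)
    also have "\<dots> = (\<Sum>k\<in>J. (\<Sum>l\<in>I. w (i, l) *\<^sub>C U l k) * star (U i' k))"
      using R i by simp
    also have "\<dots> = (\<Sum>l\<in>I. w (i, l) *\<^sub>C (\<Sum>k\<in>J. U l k * star (U i' k)))"
      unfolding sum_distrib_right scaleC_sum_right mult_scaleC_left by (rule sum.swap)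
    also have "\<dots> = (\<Sum>l\<in>I. if l = i' then w (i, i') *\<^sub>C 1 else 0)"
      using i' by (intro sum.cong refl) (simp add: coisometry)
    also have "\<dots> = w (i, i') *\<^sub>C 1"
      using i' by (simp add: finite_I)
    finally show "(\<Sum>j\<in>J. \<Sum>k\<in>J. v (j, k) *\<^sub>C (U i j * star (U i' k))) = w (i, i') *\<^sub>C 1" .
  qed
qed

text \<open>\<open>U v v' = w U v' = w w' U\<close>.\<close>

lemma pair_fixed_mult:
  assumes "(w, v) \<in> pair.FP" "(w', v') \<in> pair.FP"
  shows "(\<lambda>(i, i'). \<Sum>k\<in>I. w (i, k) * w' (k, i'), \<lambda>(j, j'). \<Sum>k\<in>J. v (j, k) * v' (k, j')) \<in> pair.FP"
  unfolding pair_fixed_iff_intertwining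
proof (intro ballI)
  note wv = assms[unfolded pair_fixed_iff_intertwining, rule_format]
  fix i j assume i: "i \<in> I" and j: "j \<in> J"
  have "(\<Sum>j'\<in>J. (\<Sum>k\<in>J. v (j', k) * v' (k, j)) *\<^sub>C U i j')
      = (\<Sum>k\<in>J. v' (k, j) *\<^sub>C (\<Sum>j'\<in>J. v (j', k) *\<^sub>C U i j'))"
    unfolding scaleC_sum_left scaleC_sum_right scaleC_scaleC
    by (subst sum.swap) (simp add: mult.commute)
  also have "\<dots> = (\<Sum>k\<in>J. v' (k, j) *\<^sub>C (\<Sum>l\<in>I. w (i, l) *\<^sub>C U l k))"
    using wv(1)[OF i] by simp
  also have "\<dots> = (\<Sum>l\<in>I. w (i, l) *\<^sub>C (\<Sum>k\<in>J. v' (k, j) *\<^sub>C U l k))"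
    unfolding scaleC_sum_left scaleC_sum_right scaleC_scaleC
    by (subst sum.swap) (simp add: mult.commute)
  also have "\<dots> = (\<Sum>l\<in>I. w (i, l) *\<^sub>C (\<Sum>k\<in>I. w' (l, k) *\<^sub>C U k j))"
    using wv(2)[OF _ j] by simp
  also have "\<dots> = (\<Sum>k\<in>I. (\<Sum>l\<in>I. w (i, l) * w' (l, k)) *\<^sub>C U k j)"
    unfolding scaleC_sum_left scaleC_sum_right scaleC_scaleC by (rule sum.swap)
  finally show "(\<Sum>j'\<in>J. (case (j', j) of (j, j') \<Rightarrow> \<Sum>k\<in>J. v (j, k) * v' (k, j')) *\<^sub>C U i j') =
      (\<Sum>i'\<in>I. (case (i, i') of (i, i') \<Rightarrow> \<Sum>k\<in>I. w (i, k) * w' (k, i')) *\<^sub>C U i' j)"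
    by simp
qed

lemma pair_fixed_adjoint:
  assumes "(w, v) \<in> pair.FP"
  shows "(\<lambda>(i, i'). cnj (w (i', i)), \<lambda>(j, j'). cnj (v (j', j))) \<in> pair.FP"
  unfolding pair_fixed_iff
proof (intro ballI)
  fix i i' assume "i \<in> I" "i' \<in> I"
  then have "star (\<Sum>j\<in>J. \<Sum>j'\<in>J. v (j, j') *\<^sub>C (U i' j * star (U i j'))) = star (w (i', i) *\<^sub>C 1)"
    using assms by (simp add: pair_fixed_iff)
  then have "(\<Sum>j\<in>J. \<Sum>j'\<in>J. cnj (v (j, j')) *\<^sub>C (U i j' * star (U i' j))) = cnj (w (i', i)) *\<^sub>C 1"
    by (simp add: star_sum star_scaleC star_mult star_star)
  then show "(\<Sum>j\<in>J. \<Sum>j'\<in>J. (case (j, j') of (j, j') \<Rightarrow> cnj (v (j', j))) *\<^sub>C (U i j * star (U i' j')))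
      = (case (i, i') of (i, i') \<Rightarrow> cnj (w (i', i))) *\<^sub>C 1"
    by (subst sum.swap) simp
qed

lemma pair_fixed_identity: "(\<lambda>(i, i'). of_bool (i = i'), \<lambda>(j, j'). of_bool (j = j')) \<in> pair.FP"
  unfolding pair_fixed_iff_intertwining
proof (intro ballI)
  fix i j assume "i \<in> I" "j \<in> J"
  have "(\<Sum>j'\<in>J. of_bool (j' = j) *\<^sub>C U i j') = (\<Sum>j'\<in>J. if j' = j then U i j else 0)"
    by (intro sum.cong) auto
  moreover have "(\<Sum>i'\<in>I. of_bool (i = i') *\<^sub>C U i' j) = (\<Sum>i'\<in>I. if i = i' then U i j else 0)"
    by (intro sum.cong) auto
  ultimately show "(\<Sum>j'\<in>J. (case (j', j) of (j, j') \<Rightarrow> of_bool (j = j')) *\<^sub>C U i j') =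
      (\<Sum>i'\<in>I. (case (i, i') of (i, i') \<Rightarrow> of_bool (i = i')) *\<^sub>C U i' j)"
    using \<open>i \<in> I\<close> \<open>j \<in> J\<close> by (simp add: finite_I finite_J)
qed

text \<open>Fixed pairs are closed under adjoints, so conjugating the functional and flipping both
  pairs gives an invariant functional again.\<close>

lemma pair_haar_hermitian:
  assumes "i \<in> I" "i' \<in> I" "j \<in> J" "j' \<in> J"
  shows "pair.haar (i', i) (j', j) = cnj (pair.haar (i, i') (j, j'))"
proof -
  have swap: "(\<Sum>q\<in>J \<times> J. f q) = (\<Sum>q\<in>J \<times> J. f (snd q, fst q))" for f :: "'j \<times> 'j \<Rightarrow> complex"
    by (rule sum.reindex_bij_witness[of _ "\<lambda>q. (snd q, fst q)" "\<lambda>q. (snd q, fst q)"]) auto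
  have "is_invariant_functional (I \<times> I) (J \<times> J) (\<lambda>(i, i') (j, j'). U i j * star (U i' j'))
      (\<lambda>p q. cnj (pair.haar (snd p, fst p) (snd q, fst q)))"
    unfolding is_invariant_functional_def
  proof (intro conjI ballI, clarify)
    fix w v i i' assume wv: "(w, v) \<in> pair.FP" and i: "i \<in> I" "i' \<in> I"
    have "(\<Sum>q\<in>J \<times> J. cnj (pair.haar (snd (i, i'), fst (i, i')) (snd q, fst q)) * v q)
        = cnj (\<Sum>q\<in>J \<times> J. pair.haar (i', i) q * (case q of (j, j') \<Rightarrow> cnj (v (j', j))))"
      by (subst swap) (simp add: split_beta)
    also have "\<dots> = w (i, i')"
      using pair.haar_apply[OF pair_fixed_adjoint[OF wv], of "(i', i)"] i by simp
    finally show "(\<Sum>q\<in>J \<times> J. cnj (pair.haar (snd (i, i'), fst (i, i')) (snd q, fst q)) * v q) = w (i, i')" .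
  next
    fix p assume "p \<in> I \<times> I"
    then have "(snd p, fst p) \<in> I \<times> I" by auto
    then obtain w where "(w, \<lambda>q. cnj (pair.haar (snd p, fst p) q)) \<in> pair.FP"
      using pair.haar_row by blast
    from pair_fixed_adjoint[OF this]
    show "\<exists>w. (w, \<lambda>q. cnj (cnj (pair.haar (snd p, fst p) (snd q, fst q)))) \<in> pair.FP"
      unfolding case_prod_beta' complex_cnj_cnj prod.collapse by blast
  qed
  from pair.haar_unique[OF this, of "(i', i)" "(j', j)"] assms show ?thesis
    by simp
qed

text \<open>As a map from matrices on \<open>J\<close> to matrices on \<open>I\<close>, the
  functional sends \<open>v Q\<close> to its value at \<open>v\<close> times \<open>P\<close>. Both
  sides are rows whose conjugates are fixed, on the right because a fixed row is multiplied by the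
  adjoint of \<open>Q\<close>, and they agree on fixed pairs.\<close>

lemma pair_haar_mult_right:
  assumes PQ: "(P, Q) \<in> pair.FP" and "i \<in> I" "k \<in> I" "j \<in> J" "j' \<in> J"
  shows "(\<Sum>i'\<in>I. pair.haar (i, i') (j, j') * P (i', k)) = (\<Sum>l\<in>J. pair.haar (i, k) (j, l) * Q (j', l))"
proof -
  define L where "L q = (\<Sum>i'\<in>I. pair.haar (i, i') q * P (i', k))" for q
  define R where "R q = (\<Sum>l\<in>J. pair.haar (i, k) (fst q, l) * Q (snd q, l))" for q
  have "\<exists>w. (w, \<lambda>q. cnj (L q)) \<in> pair.FP"
  proof -
    define W where "W i' = (SOME w. (w, \<lambda>q. cnj (pair.haar (i, i') q)) \<in> pair.FP)" for i'
    have W: "(W i', \<lambda>q. cnj (pair.haar (i, i') q)) \<in> pair.FP" if "i' \<in> I" for i'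
    proof -
      have "\<exists>w. (w, \<lambda>q. cnj (pair.haar (i, i') q)) \<in> pair.FP"
        using pair.haar_row[of "(i, i')"] that assms by blast
      then show ?thesis unfolding W_def by (rule someI_ex)
    qed
    have "(\<lambda>p. \<Sum>i'\<in>I. cnj (P (i', k)) * W i' p, \<lambda>q. \<Sum>i'\<in>I. cnj (P (i', k)) * cnj (pair.haar (i, i') q)) \<in> pair.FP"
      by (rule fixed_pairs_sum) (rule W)
    then show ?thesis by (auto simp: L_def mult.commute)
  qed
  moreover have "\<exists>w. (w, \<lambda>q. cnj (R q)) \<in> pair.FP"
  proof -
    obtain w where w: "(w, \<lambda>q. cnj (pair.haar (i, k) q)) \<in> pair.FP"
      using pair.haar_row[of "(i, k)"] assms by blast
    from pair_fixed_mult[OF w pair_fixed_adjoint[OF PQ]] show ?thesis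
      unfolding R_def case_prod_beta' cnj_sum complex_cnj_mult fst_conv snd_conv by blast
  qed
  moreover have "(\<Sum>q\<in>J \<times> J. L q * v q) = (\<Sum>q\<in>J \<times> J. R q * v q)" if wv: "(w, v) \<in> pair.FP" for w v
  proof -
    have "(\<Sum>q\<in>J \<times> J. L q * v q) = (\<Sum>i'\<in>I. P (i', k) * (\<Sum>q\<in>J \<times> J. pair.haar (i, i') q * v q))"
      unfolding L_def sum_distrib_left sum_distrib_right by (subst sum.swap) (simp add: mult_ac)
    also have "\<dots> = (\<Sum>i'\<in>I. w (i, i') * P (i', k))"
      using pair.haar_apply[OF wv] assms by (simp add: mult.commute)
    also have "\<dots> = (\<Sum>q\<in>J \<times> J. pair.haar (i, k) q * (case q of (j, l) \<Rightarrow> \<Sum>j'\<in>J. v (j, j') * Q (j', l)))"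
      using pair.haar_apply[OF pair_fixed_mult[OF wv PQ], of "(i, k)"] assms by simp
    also have "\<dots> = (\<Sum>j\<in>J. \<Sum>l\<in>J. \<Sum>j'\<in>J. pair.haar (i, k) (j, l) * (v (j, j') * Q (j', l)))"
      by (simp add: sum_distrib_left sum.cartesian_product')
    also have "\<dots> = (\<Sum>j\<in>J. \<Sum>j'\<in>J. \<Sum>l\<in>J. pair.haar (i, k) (j, l) * (v (j, j') * Q (j', l)))"
      by (rule sum.cong[OF refl], rule sum.swap)
    also have "\<dots> = (\<Sum>q\<in>J \<times> J. R q * v q)"
      by (simp add: R_def sum_distrib_left sum_distrib_right sum.cartesian_product' mult_ac)
    finally show ?thesis .
  qed
  ultimately have "L (j, j') = R (j, j')"
    using pair.row_functional_unique assms by blast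
  then show ?thesis by (simp add: L_def R_def)
qed

text \<open>
  As a matrix on \<open>I \<times> J\<close>, the functional satisfies \<open>\<Pi>\<^sup>2 = \<Pi> R\<close> for the positive definite matrix
  \<open>R = 1 \<otimes> \<Sum>\<^sub>b Q\<^sub>b\<^sup>* Q\<^sub>b\<close>, where \<open>Q\<^sub>b\<close> runs through an orthonormal basis of the intertwined matrices
  on \<open>J\<close>.
\<close>

theorem pair_haar_psd:
  "(\<Sum>(i, j)\<in>I \<times> J. \<Sum>(i', j')\<in>I \<times> J. cnj (c (i, j)) * c (i', j') * pair.haar (i, i') (j, j')) \<in> \<real>\<^sub>\<ge>\<^sub>0"
proof -
  obtain m :: nat and P Q where basis: "\<And>a. a < m \<Longrightarrow> (P a, Q a) \<in> pair.FP" "orthonormal (J \<times> J) m Q"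
    "\<And>w v q. (w, v) \<in> pair.FP \<Longrightarrow> q \<in> J \<times> J \<Longrightarrow> v q = (\<Sum>a<m. ip (J \<times> J) (Q a) v * Q a q)"
    "is_invariant_functional (I \<times> I) (J \<times> J) (\<lambda>(i, i') (j, j'). U i j * star (U i' j'))
      (\<lambda>p q. \<Sum>a<m. P a p * cnj (Q a q))"
    using pair.invariant_functional_basis by blast
  have haar: "pair.haar p q = (\<Sum>a<m. P a p * cnj (Q a q))" if "p \<in> I \<times> I" "q \<in> J \<times> J" for p q
    using pair.haar_unique[OF basis(4) that] by simp
  \<comment> \<open>The transpose of the sum of \<open>Q\<^sub>b\<^sup>* Q\<^sub>b\<close>, as it
    acts on the second index of a vector on \<open>I \<times> J\<close>.\<close>
  define Z where "Z k j = (\<Sum>b<m. \<Sum>l\<in>J. Q b (l, k) * cnj (Q b (l, j)))" for k j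
  define M where "M = (\<lambda>(i, j) (i', j'). pair.haar (i, i') (j, j'))"
  define R :: "'i \<times> 'j \<Rightarrow> 'i \<times> 'j \<Rightarrow> complex"
    where "R = (\<lambda>(i, j) (i', j'). of_bool (i = i') * Z j j')"
  have cnj_mult_self: "cnj z * z = complex_of_real ((cmod z)\<^sup>2)" for z
    using complex_norm_square[of z] by (simp add: mult.commute)
  let ?K = "I \<times> J"
  have Rapp: "mat_app ?K R d (i, k) = (\<Sum>j\<in>J. Z k j * d (i, j))" if "i \<in> I" for d i k
  proof -
    have "mat_app ?K R d (i, k) = (\<Sum>i'\<in>I. \<Sum>j\<in>J. of_bool (i = i') * Z k j * d (i', j))"
      by (simp add: mat_app_def R_def sum.cartesian_product split_beta)
    also have "\<dots> = (\<Sum>i'\<in>I. if i = i' then \<Sum>j\<in>J. Z k j * d (i, j) else 0)"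
      by (intro sum.cong) auto
    finally show ?thesis using that by (simp add: finite_I)
  qed
  have ipR: "ip ?K d (mat_app ?K R d)
      = complex_of_real (\<Sum>i\<in>I. \<Sum>b<m. \<Sum>l\<in>J. (cmod (\<Sum>j\<in>J. cnj (Q b (l, j)) * d (i, j)))\<^sup>2)" for d
  proof -
    have "ip ?K d (mat_app ?K R d) = (\<Sum>i\<in>I. \<Sum>k\<in>J. cnj (d (i, k)) * (\<Sum>j\<in>J. Z k j * d (i, j)))"
      by (simp add: ip_def Rapp sum.cartesian_product')
    also have "\<dots> = (\<Sum>i\<in>I. \<Sum>b<m. \<Sum>l\<in>J. \<Sum>k\<in>J. \<Sum>j\<in>J.
        cnj (cnj (Q b (l, k)) * d (i, k)) * (cnj (Q b (l, j)) * d (i, j)))"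
    proof (rule sum.cong[OF refl])
      fix i assume "i \<in> I"
      have "(\<Sum>k\<in>J. cnj (d (i, k)) * (\<Sum>j\<in>J. Z k j * d (i, j))) = (\<Sum>k\<in>J. \<Sum>j\<in>J. \<Sum>b<m. \<Sum>l\<in>J.
          cnj (cnj (Q b (l, k)) * d (i, k)) * (cnj (Q b (l, j)) * d (i, j)))"
        by (simp add: Z_def sum_distrib_left sum_distrib_right mult_ac)
      also have "\<dots> = (\<Sum>b<m. \<Sum>l\<in>J. \<Sum>k\<in>J. \<Sum>j\<in>J.
          cnj (cnj (Q b (l, k)) * d (i, k)) * (cnj (Q b (l, j)) * d (i, j)))"
        by (rule sum_swap_pairs)
      finally show "(\<Sum>k\<in>J. cnj (d (i, k)) * (\<Sum>j\<in>J. Z k j * d (i, j))) = \<dots>" .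
    qed
    also have "\<dots> = (\<Sum>i\<in>I. \<Sum>b<m. \<Sum>l\<in>J.
        cnj (\<Sum>j\<in>J. cnj (Q b (l, j)) * d (i, j)) * (\<Sum>j\<in>J. cnj (Q b (l, j)) * d (i, j)))"
      by (simp add: sum_product cnj_sum)
    also have "\<dots> = complex_of_real (\<Sum>i\<in>I. \<Sum>b<m. \<Sum>l\<in>J. (cmod (\<Sum>j\<in>J. cnj (Q b (l, j)) * d (i, j)))\<^sup>2)"
      unfolding of_real_sum by (intro sum.cong refl cnj_mult_self)
    finally show ?thesis .
  qed
  have "ip ?K c (mat_app ?K M c) \<in> \<real>\<^sub>\<ge>\<^sub>0"
  proof (rule psd_of_square_eq)
    show "finite ?K" by (simp add: finite_I finite_J)
    show "M l k = cnj (M k l)" if "k \<in> ?K" "l \<in> ?K" for k l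
      using that pair_haar_hermitian[of "fst k" "fst l" "snd k" "snd l"]
      by (auto simp: M_def split_beta)
    show "R l k = cnj (R k l)" for k l
      by (auto simp: R_def Z_def split_beta cnj_sum mult.commute)
    show "ip ?K d (mat_app ?K R d) \<in> \<real>\<^sub>\<ge>\<^sub>0" for d
      unfolding ipR nonneg_Reals_of_real_iff by (intro sum_nonneg) auto
    show "d k = 0" if eq0: "ip ?K d (mat_app ?K R d) = 0" and k: "k \<in> ?K" for d k
    proof -
      have "(\<Sum>i\<in>I. \<Sum>b<m. \<Sum>l\<in>J. (cmod (\<Sum>j\<in>J. cnj (Q b (l, j)) * d (i, j)))\<^sup>2) = 0"
        using eq0 unfolding ipR of_real_eq_0_iff .
      then have zero: "(\<Sum>j\<in>J. cnj (Q b (l, j)) * d (i, j)) = 0" if "i \<in> I" "b < m" "l \<in> J" for i b l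
        using that by (simp add: sum_nonneg_eq_0_iff sum_nonneg finite_I finite_J)
      obtain i l where il: "k = (i, l)" "i \<in> I" "l \<in> J" using k by auto
      \<comment> \<open>Definiteness comes from the identity matrix being intertwined, hence a
        combination of the \<open>Q b\<close>: a vector annihilated by all conjugates of the
        \<open>Q b\<close> is annihilated by the identity.\<close>
      define coef where "coef b = ip (J \<times> J) (Q b) (\<lambda>(j, j'). of_bool (j = j'))" for b
      have one: "of_bool (l = j) = (\<Sum>b<m. cnj (coef b) * cnj (Q b (l, j)))" if "j \<in> J" for j
      proof -
        have "of_bool (l = j) = (\<Sum>b<m. coef b * Q b (l, j))"
          using basis(3)[OF pair_fixed_identity, of "(l, j)"] that il by (simp add: coef_def)
        then have "cnj (of_bool (l = j)) = (\<Sum>b<m. cnj (coef b) * cnj (Q b (l, j)))"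
          by (simp only: cnj_sum complex_cnj_mult)
        then show ?thesis by auto
      qed
      have "d (i, l) = (\<Sum>j\<in>J. of_bool (l = j) * d (i, j))"
      proof -
        have "(\<Sum>j\<in>J. of_bool (l = j) * d (i, j)) = (\<Sum>j\<in>J. if l = j then d (i, l) else 0)"
          by (intro sum.cong) auto
        then show ?thesis using il by (simp add: finite_J)
      qed
      also have "\<dots> = (\<Sum>j\<in>J. \<Sum>b<m. cnj (coef b) * (cnj (Q b (l, j)) * d (i, j)))"
        by (intro sum.cong refl) (simp add: one sum_distrib_right mult.assoc)
      also have "\<dots> = (\<Sum>b<m. cnj (coef b) * (\<Sum>j\<in>J. cnj (Q b (l, j)) * d (i, j)))"
        by (subst sum.swap) (simp add: sum_distrib_left)
      also have "\<dots> = 0"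
        using zero il by simp
      finally show ?thesis using il by simp
    qed
    \<comment> \<open>The second factor is expanded as \<open>P b\<close> times the conjugate of
      \<open>Q b\<close>; \<open>pair_haar_mult_right\<close> trades \<open>P b\<close> for a
      further \<open>Q b\<close>, and the two copies of \<open>Q b\<close> combine to
      \<open>Z\<close>.\<close>
    show "(\<Sum>h\<in>?K. M k h * M h l) = (\<Sum>h\<in>?K. M k h * R h l)" if "k \<in> ?K" "l \<in> ?K" for k l
    proof -
      obtain i j i'' j'' where kl: "k = (i, j)" "l = (i'', j'')" "i \<in> I" "j \<in> J" "i'' \<in> I" "j'' \<in> J"
        using \<open>k \<in> ?K\<close> \<open>l \<in> ?K\<close> by auto
      have "(\<Sum>h\<in>?K. M k h * M h l) = (\<Sum>i'\<in>I. \<Sum>j'\<in>J. pair.haar (i, i') (j, j') * pair.haar (i', i'') (j', j''))"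
        by (simp add: M_def kl sum.cartesian_product')
      also have "\<dots> = (\<Sum>i'\<in>I. \<Sum>j'\<in>J. \<Sum>b<m. cnj (Q b (j', j'')) * (pair.haar (i, i') (j, j') * P b (i', i'')))"
        using kl by (intro sum.cong refl) (simp add: haar[of "(_, i'')" "(_, j'')"] sum_distrib_left sum_distrib_right mult_ac)
      also have "\<dots> = (\<Sum>j'\<in>J. \<Sum>b<m. cnj (Q b (j', j'')) * (\<Sum>i'\<in>I. pair.haar (i, i') (j, j') * P b (i', i'')))"
        by (subst sum.swap) (rule sum.cong[OF refl], subst sum.swap, simp add: sum_distrib_left)
      also have "\<dots> = (\<Sum>j'\<in>J. \<Sum>b<m. cnj (Q b (j', j'')) * (\<Sum>k\<in>J. pair.haar (i, i'') (j, k) * Q b (j', k)))"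
        using kl basis(1) by (intro sum.cong refl) (simp add: pair_haar_mult_right)
      also have "\<dots> = (\<Sum>j'\<in>J. \<Sum>b<m. \<Sum>k\<in>J. pair.haar (i, i'') (j, k) * (Q b (j', k) * cnj (Q b (j', j''))))"
        by (simp add: sum_distrib_left mult_ac)
      also have "\<dots> = (\<Sum>k\<in>J. \<Sum>j'\<in>J. \<Sum>b<m. pair.haar (i, i'') (j, k) * (Q b (j', k) * cnj (Q b (j', j''))))"
        by (subst (2) sum.swap, rule sum.cong[OF refl], rule sum.swap)
      also have "\<dots> = (\<Sum>k\<in>J. pair.haar (i, i'') (j, k) * Z k j'')"
        unfolding Z_def sum_distrib_left by (rule sum.cong[OF refl], rule sum.swap)
      also have "\<dots> = (\<Sum>i'\<in>I. \<Sum>k\<in>J. pair.haar (i, i') (j, k) * (of_bool (i' = i'') * Z k j''))"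
      proof -
        have "(\<Sum>i'\<in>I. \<Sum>k\<in>J. pair.haar (i, i') (j, k) * (of_bool (i' = i'') * Z k j''))
            = (\<Sum>i'\<in>I. if i' = i'' then \<Sum>k\<in>J. pair.haar (i, i'') (j, k) * Z k j'' else 0)"
          by (intro sum.cong) auto
        then show ?thesis using kl by (simp add: finite_I)
      qed
      also have "\<dots> = (\<Sum>h\<in>?K. M k h * R h l)"
        by (simp add: M_def R_def kl sum.cartesian_product')
      finally show ?thesis .
    qed
  qed
  also have "ip ?K c (mat_app ?K M c)
      = (\<Sum>(i, j)\<in>I \<times> J. \<Sum>(i', j')\<in>I \<times> J. cnj (c (i, j)) * c (i', j') * pair.haar (i, i') (j, j'))"
    by (simp add: ip_def mat_app_def M_def split_beta sum_distrib_left mult_ac)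
  finally show ?thesis .
qed

end


section \<open>The trace of a magic unitary\<close>

definition words :: "nat \<Rightarrow> 'x set \<Rightarrow> 'x list set" where
  "words n S = {xs. length xs = n \<and> set xs \<subseteq> S}"

lemma words_0 [simp]: "words 0 S = {[]}"
  by (auto simp: words_def)

lemma words_Suc: "words (Suc n) S = (\<lambda>(x, xs). x # xs) ` (S \<times> words n S)"
  by (auto simp: words_def length_Suc_conv image_iff)

lemma words_Suc_snoc: "words (Suc n) S = (\<lambda>(x, xs). xs @ [x]) ` (S \<times> words n S)"
proof -
  have "xs \<in> (\<lambda>(x, xs). xs @ [x]) ` (S \<times> words n S)" if "xs \<in> words (Suc n) S" for xs
  proof -
    have "xs \<noteq> []" using that by (auto simp: words_def)
    then obtain ys y where "xs = ys @ [y]" by (metis rev_exhaust)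
    then show ?thesis using that by (auto simp: words_def image_iff)
  qed
  then show ?thesis by (auto simp: words_def)
qed

lemma ball_words_Suc: "(\<forall>xs\<in>words (Suc n) S. P xs) \<longleftrightarrow> (\<forall>x\<in>S. \<forall>xs\<in>words n S. P (x # xs))"
  by (auto simp: words_Suc)

lemma finite_words [simp]: "finite S \<Longrightarrow> finite (words n S)"
  by (induction n) (auto simp: words_Suc)

lemma Cons_in_words [simp]: "x # xs \<in> words (Suc n) S \<longleftrightarrow> x \<in> S \<and> xs \<in> words n S"
  by (auto simp: words_def)

lemma snoc_in_words [simp]: "xs @ [x] \<in> words (Suc n) S \<longleftrightarrow> x \<in> S \<and> xs \<in> words n S"
  by (auto simp: words_def)

lemma sum_words_Suc: "(\<Sum>xs\<in>words (Suc n) S. f xs) = (\<Sum>x\<in>S. \<Sum>xs\<in>words n S. f (x # xs))"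
  unfolding words_Suc by (subst sum.reindex) (auto simp: inj_on_def sum.cartesian_product split_beta)

lemma sum_words_Suc_snoc: "(\<Sum>xs\<in>words (Suc n) S. f xs) = (\<Sum>x\<in>S. \<Sum>xs\<in>words n S. f (xs @ [x]))"
  unfolding words_Suc_snoc
  by (subst sum.reindex) (auto simp: inj_on_def sum.cartesian_product split_beta)

text \<open>On words of equal length these are the entries of a tensor power of \<open>U\<close>.
  The last clause is the empty product; it also gives a value to words of unequal length.\<close>

fun word_prod :: "('x \<Rightarrow> 'y \<Rightarrow> 'a::complex_star_algebra_1) \<Rightarrow> 'x list \<Rightarrow> 'y list \<Rightarrow> 'a" where
  "word_prod U (x # xs) (y # ys) = U x y * word_prod U xs ys"
| "word_prod U _ _ = 1"

lemma word_prod_append: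
  "length xs = length ys \<Longrightarrow>
   word_prod U (xs @ xs') (ys @ ys') = word_prod U xs ys * word_prod U xs' ys'"
  by (induction xs ys rule: list_induct2) (auto simp: mult.assoc)

lemma algebra_unitary_reindex:
  assumes B: "algebra_unitary K L V" and \<sigma>: "bij_betw \<sigma> I K" and \<rho>: "bij_betw \<rho> J L"
    and eq: "\<And>i j. i \<in> I \<Longrightarrow> j \<in> J \<Longrightarrow> V (\<sigma> i) (\<rho> j) = U i j"
  shows "algebra_unitary I J U"
proof -
  interpret B: algebra_unitary K L V by (rule B)
  note mem = bij_betwE[OF \<sigma>] bij_betwE[OF \<rho>]
  have inj: "\<sigma> i = \<sigma> i' \<longleftrightarrow> i = i'" if "i \<in> I" "i' \<in> I" for i i'
    using that \<sigma> by (meson bij_betw_def inj_on_eq_iff)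
  have inj': "\<rho> j = \<rho> j' \<longleftrightarrow> j = j'" if "j \<in> J" "j' \<in> J" for j j'
    using that \<rho> by (meson bij_betw_def inj_on_eq_iff)
  show ?thesis
  proof
    show "finite I" "finite J"
      using B.finite_I B.finite_J \<sigma> \<rho> by (simp_all add: bij_betw_finite)
    show "(\<Sum>i\<in>I. star (U i j) * U i j') = (if j = j' then 1 else 0)" if j: "j \<in> J" "j' \<in> J" for j j'
    proof -
      have "(\<Sum>i\<in>I. star (U i j) * U i j') = (\<Sum>i\<in>I. star (V (\<sigma> i) (\<rho> j)) * V (\<sigma> i) (\<rho> j'))"
        using eq j by simp
      also have "\<dots> = (\<Sum>k\<in>K. star (V k (\<rho> j)) * V k (\<rho> j'))"
        by (rule sum.reindex_bij_betw[OF \<sigma>])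
      finally show ?thesis using B.isometry[of "\<rho> j" "\<rho> j'"] mem(2) j inj' by simp
    qed
    show "(\<Sum>j\<in>J. U i j * star (U i' j)) = (if i = i' then 1 else 0)" if i: "i \<in> I" "i' \<in> I" for i i'
    proof -
      have "(\<Sum>j\<in>J. U i j * star (U i' j)) = (\<Sum>j\<in>J. V (\<sigma> i) (\<rho> j) * star (V (\<sigma> i') (\<rho> j)))"
        using eq i by simp
      also have "\<dots> = (\<Sum>l\<in>L. V (\<sigma> i) l * star (V (\<sigma> i') l))"
        by (rule sum.reindex_bij_betw[OF \<rho>])
      finally show ?thesis using B.coisometry[of "\<sigma> i" "\<sigma> i'"] mem(1) i inj by simp
    qed
  qed
qed

lemma bij_betw_append_rev_words:
  "bij_betw (\<lambda>(xs, xs'). xs @ rev xs') (words n S \<times> words n S) (words (2 * n) S)"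
proof (rule bij_betwI[where g = "\<lambda>xs. (take n xs, rev (drop n xs))"])
  show "(\<lambda>xs. (take n xs, rev (drop n xs))) \<in> words (2 * n) S \<rightarrow> words n S \<times> words n S"
    using set_take_subset set_drop_subset by (fastforce simp: words_def)
qed (auto simp: words_def)

context magic_unitary
begin

lemma U_mult_same_row:
  "\<lbrakk>x \<in> V; y \<in> W; y' \<in> W\<rbrakk> \<Longrightarrow> U x y * U x y' = (if y = y' then U x y else 0)"
  using U_idem U_row_orthogonal by auto

lemma U_mult_same_column:
  "\<lbrakk>x \<in> V; x' \<in> V; y \<in> W\<rbrakk> \<Longrightarrow> U x y * U x' y = (if x = x' then U x y else 0)"
  using U_idem U_column_orthogonal by auto

lemma sum_U_mult_column:
  assumes "y \<in> W" "y' \<in> W"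
  shows "(\<Sum>x\<in>V. U x y * U x y') = (if y = y' then 1 else 0)"
proof -
  have "(\<Sum>x\<in>V. U x y * U x y') = (\<Sum>x\<in>V. if y = y' then U x y else 0)"
    using assms by (intro sum.cong) (simp_all add: U_mult_same_row)
  then show ?thesis using assms by (simp add: U_column_sum)
qed

lemma sum_U_mult_row:
  assumes "x \<in> V" "x' \<in> V"
  shows "(\<Sum>y\<in>W. U x y * U x' y) = (if x = x' then 1 else 0)"
proof -
  have "(\<Sum>y\<in>W. U x y * U x' y) = (\<Sum>y\<in>W. if x = x' then U x y else 0)"
    using assms by (intro sum.cong) (simp_all add: U_mult_same_column)
  then show ?thesis using assms by (simp add: U_row_sum)
qed

lemma algebra_unitary_words: "algebra_unitary (words n V) (words n W) (word_prod U)"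
proof
  show "finite (words n V)" "finite (words n W)"
    by (simp_all add: finite_V finite_W)
  show "(\<Sum>xs\<in>words n V. star (word_prod U xs ys) * word_prod U xs ys') = (if ys = ys' then 1 else 0)"
    if "ys \<in> words n W" "ys' \<in> words n W" for ys ys'
    using that
  proof (induction n arbitrary: ys ys')
    case (Suc n)
    then obtain y zs y' zs' where eq: "ys = y # zs" "ys' = y' # zs'"
      and mem: "y \<in> W" "zs \<in> words n W" "y' \<in> W" "zs' \<in> words n W"
      by (auto simp: words_Suc)
    have "(\<Sum>xs\<in>words (Suc n) V. star (word_prod U xs ys) * word_prod U xs ys')
        = (\<Sum>x\<in>V. \<Sum>xs\<in>words n V. star (word_prod U xs zs) * (U x y * U x y') * word_prod U xs zs')"
      using mem by (simp add: sum_words_Suc eq star_mult star_U mult.assoc)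
    also have "\<dots> = (\<Sum>xs\<in>words n V. star (word_prod U xs zs) * (\<Sum>x\<in>V. U x y * U x y') * word_prod U xs zs')"
      unfolding sum_distrib_left sum_distrib_right by (rule sum.swap)
    also have "\<dots> = (if ys = ys' then 1 else 0)"
      using Suc.IH[OF mem(2,4)] mem by (auto simp: sum_U_mult_column eq)
    finally show ?case .
  qed simp
  show "(\<Sum>ys\<in>words n W. word_prod U xs ys * star (word_prod U xs' ys)) = (if xs = xs' then 1 else 0)"
    if "xs \<in> words n V" "xs' \<in> words n V" for xs xs'
    using that
  proof (induction n arbitrary: xs xs')
    case (Suc n)
    then obtain x zs x' zs' where eq: "xs = x # zs" "xs' = x' # zs'"
      and mem: "x \<in> V" "zs \<in> words n V" "x' \<in> V" "zs' \<in> words n V"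
      by (auto simp: words_Suc)
    have "(\<Sum>ys\<in>words (Suc n) W. word_prod U xs ys * star (word_prod U xs' ys))
        = (\<Sum>y\<in>W. U x y * (\<Sum>ys\<in>words n W. word_prod U zs ys * star (word_prod U zs' ys)) * U x' y)"
      using mem by (simp add: sum_words_Suc eq star_mult star_U mult.assoc sum_distrib_left sum_distrib_right)
    also have "\<dots> = (if xs = xs' then 1 else 0)"
      using Suc.IH[OF mem(2,4)] mem by (auto simp: sum_U_mult_row eq)
    finally show ?case .
  qed simp
qed

lemma star_word_prod:
  "\<lbrakk>xs \<in> words n V; ys \<in> words n W\<rbrakk> \<Longrightarrow> star (word_prod U xs ys) = word_prod U (rev xs) (rev ys)"
proof (induction n arbitrary: xs ys)
  case (Suc n)
  then obtain x zs y zs' where eq: "xs = x # zs" "ys = y # zs'"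
    and mem: "x \<in> V" "zs \<in> words n V" "y \<in> W" "zs' \<in> words n W"
    by (auto simp: words_Suc)
  then have "length (rev zs) = length (rev zs')" by (simp add: words_def)
  then show ?case
    using Suc.IH[OF mem(2,4)] mem by (simp add: eq star_mult star_U word_prod_append)
qed simp

section \<open>The invariant functional on words and its relations\<close>

definition haar_word :: "nat \<Rightarrow> 'x list \<Rightarrow> 'y list \<Rightarrow> complex" where
  "haar_word n = algebra_unitary.haar (words n V) (words n W) (word_prod U)"

definition trace_word :: "('x \<times> 'y) list \<Rightarrow> complex" where
  "trace_word ps = haar_word (length ps) (map fst ps) (map snd ps)"

abbreviation "fixed_words n \<equiv> fixed_pairs (words n V) (words n W) (word_prod U)"

lemma fixed_words_Suc_iff:
  "(w, v) \<in> fixed_words (Suc n) \<longleftrightarrow>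
     (\<forall>x\<in>V. \<forall>xs\<in>words n V.
        (\<Sum>y\<in>W. U x y * (\<Sum>ys\<in>words n W. v (y # ys) *\<^sub>C word_prod U xs ys)) = w (x # xs) *\<^sub>C 1)"
  by (simp add: fixed_pairs_def sum_words_Suc ball_words_Suc mult_scaleC_right sum_distrib_left)

lemma haar_word_Nil: "haar_word 0 [] [] = 1"
proof -
  interpret algebra_unitary "words 0 V" "words 0 W" "word_prod U"
    by (rule algebra_unitary_words)
  have "(\<lambda>_. 1, \<lambda>_. 1) \<in> fixed_words 0"
    by (simp add: fixed_pairs_def)
  from haar_apply[OF this, of "[]"] show ?thesis
    by (simp add: haar_word_def)
qed

text \<open>Doubling the first letter embeds the shorter words into the longer ones. Idempotence
  makes the entries agree, and orthogonality along rows and columns makes the image a diagonal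
  block.\<close>

lemma haar_word_dup:
  assumes "x \<in> V" "y \<in> W" "xs \<in> words n V" "ys \<in> words n W"
  shows "haar_word (Suc (Suc n)) (x # x # xs) (y # y # ys) = haar_word (Suc n) (x # xs) (y # ys)"
proof -
  have dup: "hd zs # zs \<notin> (\<lambda>zs. hd zs # zs) ` words (Suc n) S \<Longrightarrow> zs \<notin> words (Suc n) S" for zs :: "'z list" and S
    by auto
  have "algebra_unitary.haar (words (Suc (Suc n)) V) (words (Suc (Suc n)) W) (word_prod U)
      ((\<lambda>zs. hd zs # zs) (x # xs)) ((\<lambda>zs. hd zs # zs) (y # ys))
    = algebra_unitary.haar (words (Suc n) V) (words (Suc n) W) (word_prod U) (x # xs) (y # ys)"
  proof (rule haar_embed[OF algebra_unitary_words algebra_unitary_words])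
    show "word_prod U (hd xs # xs) (hd ys # ys) = word_prod U xs ys"
      if "xs \<in> words (Suc n) V" "ys \<in> words (Suc n) W" for xs ys
      using that by (auto simp: words_Suc U_idem simp flip: mult.assoc)
    show "word_prod U (hd xs # xs) l = 0"
      if xs: "xs \<in> words (Suc n) V" and l: "l \<in> words (Suc (Suc n)) W"
        and nin: "l \<notin> (\<lambda>zs. hd zs # zs) ` words (Suc n) W" for xs l
    proof -
      obtain y y' ys where l': "l = y # y' # ys" "y \<in> W" "y' \<in> W" "ys \<in> words n W"
        using l by (auto simp: words_Suc)
      then have "y \<noteq> y'" using nin by (auto simp: image_iff dest!: bspec[of _ _ "y # ys"])
      then show ?thesis
        using xs l' by (auto simp: words_Suc U_row_orthogonal simp flip: mult.assoc)
    qed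
    show "word_prod U k (hd ys # ys) = 0"
      if k: "k \<in> words (Suc (Suc n)) V" and ys: "ys \<in> words (Suc n) W"
        and nin: "k \<notin> (\<lambda>zs. hd zs # zs) ` words (Suc n) V" for k ys
    proof -
      obtain x x' xs where k': "k = x # x' # xs" "x \<in> V" "x' \<in> V" "xs \<in> words n V"
        using k by (auto simp: words_Suc)
      then have "x \<noteq> x'" using nin by (auto simp: image_iff dest!: bspec[of _ _ "x # xs"])
      then show ?thesis
        using ys k' by (auto simp: words_Suc U_column_orthogonal simp flip: mult.assoc)
    qed
  qed (use assms in \<open>auto simp: inj_on_def words_Suc\<close>)
  then show ?thesis by (simp add: haar_word_def)
qed

text \<open>Words are coloured by the relation between their first two letters; the hypothesis on
  \<open>U\<close> says that the tensor power respects this colouring.\<close>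

lemma haar_word_eq_0:
  assumes zero: "\<And>x x' y y'. \<lbrakk>x \<in> V; x' \<in> V; y \<in> W; y' \<in> W; r x x' \<noteq> r' y y'\<rbrakk> \<Longrightarrow> U x y * U x' y' = 0"
    and mem: "x \<in> V" "x' \<in> V" "xs \<in> words n V" "y \<in> W" "y' \<in> W" "ys \<in> words n W"
    and ne: "r x x' \<noteq> r' y y'"
  shows "haar_word (Suc (Suc n)) (x # x' # xs) (y # y' # ys) = 0"
proof -
  interpret algebra_unitary "words (Suc (Suc n)) V" "words (Suc (Suc n)) W" "word_prod U"
    by (rule algebra_unitary_words)
  show ?thesis
    unfolding haar_word_def
  proof (rule haar_eq_0[where r = "\<lambda>xs. r (xs ! 0) (xs ! 1)" and r' = "\<lambda>ys. r' (ys ! 0) (ys ! 1)"])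
    show "word_prod U i j = 0"
      if "i \<in> words (Suc (Suc n)) V" "j \<in> words (Suc (Suc n)) W" "r (i ! 0) (i ! 1) \<noteq> r' (j ! 0) (j ! 1)" for i j
      using that by (auto simp: words_Suc zero simp flip: mult.assoc)
  qed (use mem ne in auto)
qed

text \<open>Row sums equal to one make the constant vector 1 fixed with partner 1; the lift is its
  tensor product with the given pair.\<close>

lemma fixed_words_lift:
  assumes "(w, v) \<in> fixed_words n"
  shows "(w \<circ> tl, v \<circ> tl) \<in> fixed_words (Suc n)"
  unfolding fixed_words_Suc_iff
  using assms by (simp add: fixed_pairs_def mult_scaleC_right U_row_sum flip: scaleC_sum_right)

text \<open>The adjoint operation to lifting; it preserves fixed pairs because the columns sum to
  one.\<close>

lemma fixed_words_sum_first:
  assumes "(w, v) \<in> fixed_words (Suc n)"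
  shows "(\<lambda>xs. \<Sum>x\<in>V. w (x # xs), \<lambda>ys. \<Sum>y\<in>W. v (y # ys)) \<in> fixed_words n"
proof -
  have "(\<Sum>ys\<in>words n W. (\<Sum>y\<in>W. v (y # ys)) *\<^sub>C word_prod U xs ys) = (\<Sum>x\<in>V. w (x # xs)) *\<^sub>C 1"
    if "xs \<in> words n V" for xs
  proof -
    have "(\<Sum>x\<in>V. w (x # xs)) *\<^sub>C (1::'a)
        = (\<Sum>x\<in>V. \<Sum>y\<in>W. U x y * (\<Sum>ys\<in>words n W. v (y # ys) *\<^sub>C word_prod U xs ys))"
      using assms that by (simp add: fixed_words_Suc_iff scaleC_sum_left)
    also have "\<dots> = (\<Sum>y\<in>W. (\<Sum>x\<in>V. U x y) * (\<Sum>ys\<in>words n W. v (y # ys) *\<^sub>C word_prod U xs ys))"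
      unfolding sum_distrib_right by (rule sum.swap)
    also have "\<dots> = (\<Sum>ys\<in>words n W. (\<Sum>y\<in>W. v (y # ys)) *\<^sub>C word_prod U xs ys)"
      unfolding scaleC_sum_left by (subst sum.swap) (simp add: U_column_sum)
    finally show ?thesis ..
  qed
  then show ?thesis by (simp add: fixed_pairs_def)
qed

text \<open>Summing out the first letter of a fixed row gives a fixed row, and its value on
  \<open>v\<close> is the value of the original row on the lift of \<open>v\<close>.\<close>

lemma haar_word_row_sum:
  assumes x: "x \<in> V" and xs: "xs \<in> words n V" and ys: "ys \<in> words n W"
  shows "(\<Sum>y\<in>W. haar_word (Suc n) (x # xs) (y # ys)) = haar_word n xs ys"
proof -
  interpret A: algebra_unitary "words n V" "words n W" "word_prod U"
    by (rule algebra_unitary_words)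
  interpret B: algebra_unitary "words (Suc n) V" "words (Suc n) W" "word_prod U"
    by (rule algebra_unitary_words)
  obtain w1 where w1: "(w1, \<lambda>ys. cnj (B.haar (x # xs) ys)) \<in> fixed_words (Suc n)"
    using B.haar_row[of "x # xs"] x xs by auto
  obtain w2 where w2: "(w2, \<lambda>ys. cnj (A.haar xs ys)) \<in> fixed_words n"
    using A.haar_row xs by blast
  have "(\<Sum>y\<in>W. B.haar (x # xs) (y # ys)) = A.haar xs ys"
  proof (rule A.row_functional_unique[OF _ w2 _ ys])
    show "(\<lambda>xs. \<Sum>x\<in>V. w1 (x # xs), \<lambda>ys. cnj (\<Sum>y\<in>W. B.haar (x # xs) (y # ys))) \<in> fixed_words n"
      using fixed_words_sum_first[OF w1] by simp
    fix w v assume wv: "(w, v) \<in> fixed_words n"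
    have "(\<Sum>ys\<in>words n W. (\<Sum>y\<in>W. B.haar (x # xs) (y # ys)) * v ys)
        = (\<Sum>ys\<in>words (Suc n) W. B.haar (x # xs) ys * (v \<circ> tl) ys)"
      unfolding sum_words_Suc sum_distrib_right by (subst sum.swap) simp
    also have "\<dots> = w xs"
      using B.haar_apply[OF fixed_words_lift[OF wv], of "x # xs"] x xs by simp
    also have "\<dots> = (\<Sum>ys\<in>words n W. A.haar xs ys * v ys)"
      using A.haar_apply[OF wv xs] by simp
    finally show "(\<Sum>ys\<in>words n W. (\<Sum>y\<in>W. B.haar (x # xs) (y # ys)) * v ys)
        = (\<Sum>ys\<in>words n W. A.haar xs ys * v ys)" .
  qed
  then show ?thesis by (simp add: haar_word_def)
qed

text \<open>This time the comparison takes place on the longer words: the right-hand side is read as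
  the lift of a row, and its value on \<open>v\<close> is found by summing out the first letter of
  \<open>v\<close>.\<close>

lemma haar_word_column_sum:
  assumes y: "y \<in> W" and xs: "xs \<in> words n V" and ys: "ys \<in> words n W"
  shows "(\<Sum>x\<in>V. haar_word (Suc n) (x # xs) (y # ys)) = haar_word n xs ys"
proof -
  interpret A: algebra_unitary "words n V" "words n W" "word_prod U"
    by (rule algebra_unitary_words)
  interpret B: algebra_unitary "words (Suc n) V" "words (Suc n) W" "word_prod U"
    by (rule algebra_unitary_words)
  define w1 where "w1 x = (SOME w. (w, \<lambda>ys. cnj (B.haar (x # xs) ys)) \<in> fixed_words (Suc n))" for x
  have w1: "(w1 x, \<lambda>ys. cnj (B.haar (x # xs) ys)) \<in> fixed_words (Suc n)" if "x \<in> V" for x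
  proof -
    have "\<exists>w. (w, \<lambda>ys. cnj (B.haar (x # xs) ys)) \<in> fixed_words (Suc n)"
      using B.haar_row[of "x # xs"] that xs by auto
    then show ?thesis unfolding w1_def by (rule someI_ex)
  qed
  obtain w2 where w2: "(w2, \<lambda>ys. cnj (A.haar xs ys)) \<in> fixed_words n"
    using A.haar_row xs by blast
  have "(\<Sum>x\<in>V. B.haar (x # xs) (y # ys)) = A.haar xs (tl (y # ys))"
  proof (rule B.row_functional_unique[where L = "\<lambda>l. \<Sum>x\<in>V. B.haar (x # xs) l"
        and R = "\<lambda>l. A.haar xs (tl l)"])
    show "(\<lambda>zs. \<Sum>x\<in>V. 1 * w1 x zs, \<lambda>ys. cnj (\<Sum>x\<in>V. B.haar (x # xs) ys)) \<in> fixed_words (Suc n)"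
      using fixed_pairs_sum[of V w1 "\<lambda>x ys. cnj (B.haar (x # xs) ys)" _ _ _ "\<lambda>_. 1", OF w1] by simp
    show "(w2 \<circ> tl, \<lambda>ys. cnj (A.haar xs (tl ys))) \<in> fixed_words (Suc n)"
      using fixed_words_lift[OF w2] by (simp add: o_def)
    show "y # ys \<in> words (Suc n) W" using y ys by simp
    fix w v assume wv: "(w, v) \<in> fixed_words (Suc n)"
    have "(\<Sum>ys\<in>words (Suc n) W. (\<Sum>x\<in>V. B.haar (x # xs) ys) * v ys)
        = (\<Sum>x\<in>V. \<Sum>ys\<in>words (Suc n) W. B.haar (x # xs) ys * v ys)"
      unfolding sum_distrib_right by (rule sum.swap)
    also have "\<dots> = (\<Sum>x\<in>V. w (x # xs))"
      using B.haar_apply[OF wv] xs by simp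
    also have "\<dots> = (\<Sum>ys\<in>words n W. A.haar xs ys * (\<Sum>y\<in>W. v (y # ys)))"
      using A.haar_apply[OF fixed_words_sum_first[OF wv] xs] by simp
    also have "\<dots> = (\<Sum>ys\<in>words (Suc n) W. A.haar xs (tl ys) * v ys)"
      unfolding sum_words_Suc sum_distrib_left by (subst sum.swap) simp
    finally show "(\<Sum>ys\<in>words (Suc n) W. (\<Sum>x\<in>V. B.haar (x # xs) ys) * v ys)
        = (\<Sum>ys\<in>words (Suc n) W. A.haar xs (tl ys) * v ys)" .
  qed
  then show ?thesis by (simp add: haar_word_def)
qed

end


section \<open>Rotation of words and traciality\<close>

lemma funpow_last_butlast:
  assumes "length l = Suc n"
  shows "((\<lambda>l. last l # butlast l) ^^ Suc n) l = l"
proof -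
  have "((\<lambda>l. last l # butlast l) ^^ m) ((rotate1 ^^ m) l) = l" for m
  proof (induction m)
    case (Suc m)
    have "(rotate1 ^^ m) l \<noteq> []"
      using assms by (metis length_0_conv length_rotate nat.distinct(1) rotate_def)
    then have "last (rotate1 ((rotate1 ^^ m) l)) # butlast (rotate1 ((rotate1 ^^ m) l)) = (rotate1 ^^ m) l"
      by (cases "(rotate1 ^^ m) l") auto
    moreover have "(rotate1 ^^ Suc m) l = rotate1 ((rotate1 ^^ m) l)" by simp
    ultimately have "((\<lambda>l. last l # butlast l) ^^ Suc m) ((rotate1 ^^ Suc m) l)
        = ((\<lambda>l. last l # butlast l) ^^ m) ((rotate1 ^^ m) l)"
      by (simp only: funpow_Suc_right[where f = "\<lambda>l. last l # butlast l"] o_apply)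
    then show ?case using Suc.IH by simp
  qed simp
  from this[of "Suc n"] show ?thesis
    using assms rotate_id[of "Suc n" l] unfolding rotate_def by simp
qed

lemma inj_on_rotate_words: "inj_on (\<lambda>l. last l # butlast l) (words (Suc n) S)"
  by (auto simp: inj_on_def words_Suc_snoc)

lemma image_rotate_words: "(\<lambda>l. last l # butlast l) ` words (Suc n) S = words (Suc n) S"
proof (intro equalityI subsetI)
  fix l assume "l \<in> words (Suc n) S"
  then obtain x xs where l: "l = x # xs" "x \<in> S" "xs \<in> words n S"
    by (auto simp: words_Suc)
  then show "l \<in> (\<lambda>l. last l # butlast l) ` words (Suc n) S"
    by (intro image_eqI[of _ _ "xs @ [x]"]) auto
next
  fix l assume "l \<in> (\<lambda>l. last l # butlast l) ` words (Suc n) S"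
  then obtain k where k: "l = last k # butlast k" "k \<in> words (Suc n) S"
    by (rule imageE)
  then obtain x xs where "k = xs @ [x]" "x \<in> S" "xs \<in> words n S"
    by (auto simp: words_Suc_snoc)
  then show "l \<in> words (Suc n) S" using k by simp
qed

text \<open>Extension along the rotation composes with its inverse. Rotation has order dividing
  \<open>Suc n\<close> on these words, so the inverse is the \<open>n\<close>-th iterate, and
  stability of fixed pairs under rotation in one direction suffices.\<close>

lemma extension_rotate_words:
  assumes "l \<in> words (Suc n) S"
  shows "extension (words (Suc n) S) (\<lambda>l. last l # butlast l) f l = f (((\<lambda>l. last l # butlast l) ^^ n) l)"
proof -
  have "l \<in> (\<lambda>l. last l # butlast l) ` words (Suc n) S"
    using assms by (simp only: image_rotate_words)
  then obtain k where k: "l = last k # butlast k" "k \<in> words (Suc n) S"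
    by (rule imageE)
  have "((\<lambda>l. last l # butlast l) ^^ n) l = ((\<lambda>l. last l # butlast l) ^^ Suc n) k"
    by (simp only: k(1) funpow_Suc_right o_apply)
  also have "\<dots> = k"
    using k(2) by (intro funpow_last_butlast) (simp add: words_def)
  finally show ?thesis
    using extension_apply[OF inj_on_rotate_words k(2), of f] k(1) by simp
qed

context magic_unitary
begin

text \<open>Inverting \<open>U\<close> on the first tensor factor isolates the remaining sum
  \<open>A z\<close>; multiplying by \<open>U x z\<close> on the right and summing over
  \<open>z\<close> puts that factor at the end. Both steps use unitarity in the form available for
  self-adjoint entries.\<close>

lemma fixed_words_rotate:
  assumes "(w, v) \<in> fixed_words (Suc n)"
  shows "(\<lambda>l. w (last l # butlast l), \<lambda>l. v (last l # butlast l)) \<in> fixed_words (Suc n)"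
proof -
  have "(\<Sum>l\<in>words (Suc n) W. v (last l # butlast l) *\<^sub>C word_prod U (xs @ [x]) l) = w (x # xs) *\<^sub>C 1"
    if x: "x \<in> V" and xs: "xs \<in> words n V" for x xs
  proof -
    define A where "A z = (\<Sum>ys\<in>words n W. v (z # ys) *\<^sub>C word_prod U xs ys)" for z
    have fixed: "(\<Sum>y\<in>W. U x' y * A y) = w (x' # xs) *\<^sub>C 1" if "x' \<in> V" for x'
      using assms that xs by (simp add: fixed_words_Suc_iff A_def)
    have A: "A z = (\<Sum>x'\<in>V. w (x' # xs) *\<^sub>C U x' z)" if z: "z \<in> W" for z
    proof -
      have "(\<Sum>x'\<in>V. w (x' # xs) *\<^sub>C U x' z) = (\<Sum>x'\<in>V. U x' z * (\<Sum>y\<in>W. U x' y * A y))"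
        by (intro sum.cong refl) (simp add: fixed mult_scaleC_right)
      also have "\<dots> = (\<Sum>y\<in>W. (\<Sum>x'\<in>V. U x' z * U x' y) * A y)"
        unfolding sum_distrib_left sum_distrib_right by (subst sum.swap) (simp add: mult.assoc)
      also have "\<dots> = (\<Sum>y\<in>W. if z = y then A y else 0)"
        using z by (intro sum.cong refl) (simp add: sum_U_mult_column)
      finally show ?thesis using z by (simp add: finite_W)
    qed
    have "(\<Sum>l\<in>words (Suc n) W. v (last l # butlast l) *\<^sub>C word_prod U (xs @ [x]) l) = (\<Sum>z\<in>W. A z * U x z)"
      unfolding sum_words_Suc_snoc A_def sum_distrib_right
      using xs by (intro sum.cong refl) (auto simp: words_def word_prod_append mult_scaleC_left)
    also have "\<dots> = (\<Sum>x'\<in>V. w (x' # xs) *\<^sub>C (\<Sum>z\<in>W. U x' z * U x z))"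
      unfolding scaleC_sum_right
      by (subst sum.swap) (simp add: A sum_distrib_right mult_scaleC_left)
    also have "\<dots> = (\<Sum>x'\<in>V. if x' = x then w (x # xs) *\<^sub>C 1 else 0)"
      using x by (intro sum.cong refl) (simp add: sum_U_mult_row)
    finally show ?thesis using x by (simp add: finite_V)
  qed
  then show ?thesis
    by (auto simp: fixed_pairs_def words_Suc_snoc[of n V])
qed

lemma haar_word_rotate:
  assumes "x \<in> V" "y \<in> W" "xs \<in> words n V" "ys \<in> words n W"
  shows "haar_word (Suc n) (x # xs) (y # ys) = haar_word (Suc n) (xs @ [x]) (ys @ [y])"
proof -
  let ?r = "\<lambda>l. last l # butlast l"
  have iter: "(\<lambda>l. w ((?r ^^ m) l), \<lambda>l. v ((?r ^^ m) l)) \<in> fixed_words (Suc n)"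
    if "(w, v) \<in> fixed_words (Suc n)" for w v m
  proof (induction m)
    case (Suc m)
    from fixed_words_rotate[OF Suc.IH] show ?case
      by (simp only: funpow_Suc_right o_apply)
  qed (use that in simp)
  have "algebra_unitary.haar (words (Suc n) V) (words (Suc n) W) (word_prod U) (?r (xs @ [x])) (?r (ys @ [y]))
    = algebra_unitary.haar (words (Suc n) V) (words (Suc n) W) (word_prod U) (xs @ [x]) (ys @ [y])"
  proof (rule haar_embed_fixed_pairs[OF algebra_unitary_words algebra_unitary_words
        inj_on_rotate_words _ inj_on_rotate_words])
    show "(w \<circ> ?r, v \<circ> ?r) \<in> fixed_words (Suc n)" if "(w, v) \<in> fixed_words (Suc n)" for w v
      using fixed_words_rotate[OF that] by (simp add: o_def)
    show "(extension (words (Suc n) V) ?r w, extension (words (Suc n) W) ?r v) \<in> fixed_words (Suc n)"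
      if "(w, v) \<in> fixed_words (Suc n)" for w v
      by (rule fixed_pairs_cong[OF iter[OF that, of n]]) (simp_all add: extension_rotate_words)
  qed (use assms in \<open>auto simp: image_rotate_words\<close>)
  then show ?thesis by (simp add: haar_word_def)
qed

text \<open>The star reverses words, so \<open>xs @ rev xs'\<close> turns an entry of the even
  tensor power into one entry of the half power times the star of another. Unitarity of the pair
  matrix and its functional are transported along this bijection.\<close>

lemma pair_unitary_words:
  "pair_unitary (words n V) (words n W) (word_prod U)" (is ?pair)
  and haar_word_pair:
  "\<lbrakk>xs \<in> words n V; xs' \<in> words n V; ys \<in> words n W; ys' \<in> words n W\<rbrakk> \<Longrightarrow>
     haar_word (2 * n) (xs @ rev xs') (ys @ rev ys') =
     algebra_unitary.haar (words n V \<times> words n V) (words n W \<times> words n W)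
       (\<lambda>(i, i') (j, j'). word_prod U i j * star (word_prod U i' j')) (xs, xs') (ys, ys')"
proof -
  let ?s = "\<lambda>(xs, xs'). xs @ rev xs'"
  have eq: "word_prod U (?s i) (?s j) = (case i of (i, i') \<Rightarrow> \<lambda>(j, j'). word_prod U i j * star (word_prod U i' j')) j"
    if "i \<in> words n V \<times> words n V" "j \<in> words n W \<times> words n W" for i j
    using that by (auto simp: word_prod_append star_word_prod) (auto simp: words_def word_prod_append)
  have unitary: "algebra_unitary (words n V \<times> words n V) (words n W \<times> words n W)
      (\<lambda>(i, i') (j, j'). word_prod U i j * star (word_prod U i' j'))"
    by (rule algebra_unitary_reindex[OF algebra_unitary_words bij_betw_append_rev_words
        bij_betw_append_rev_words eq])
  show ?pair
    by (intro pair_unitary.intro algebra_unitary_words unitary)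
  note bij = bij_betw_append_rev_words[unfolded bij_betw_def]
  assume mem: "xs \<in> words n V" "xs' \<in> words n V" "ys \<in> words n W" "ys' \<in> words n W"
  have "algebra_unitary.haar (words (2 * n) V) (words (2 * n) W) (word_prod U) (?s (xs, xs')) (?s (ys, ys')) =
     algebra_unitary.haar (words n V \<times> words n V) (words n W \<times> words n W)
       (\<lambda>(i, i') (j, j'). word_prod U i j * star (word_prod U i' j')) (xs, xs') (ys, ys')"
    by (rule haar_embed[OF unitary algebra_unitary_words])
       (use bij[of n V] bij[of n W] eq mem in auto)
  then show "haar_word (2 * n) (xs @ rev xs') (ys @ rev ys') =
     algebra_unitary.haar (words n V \<times> words n V) (words n W \<times> words n W)
       (\<lambda>(i, i') (j, j'). word_prod U i j * star (word_prod U i' j')) (xs, xs') (ys, ys')"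
    by (simp add: haar_word_def)
qed

lemma map_fst_snd_words:
  assumes "set ps \<subseteq> V \<times> W"
  shows "map fst ps \<in> words (length ps) V" "map snd ps \<in> words (length ps) W"
  using assms by (auto simp: words_def)

lemma trace_word_Nil [simp]: "trace_word [] = 1"
  by (simp add: trace_word_def haar_word_Nil)

lemma trace_word_dup:
  assumes "p \<in> V \<times> W" "set ps \<subseteq> V \<times> W"
  shows "trace_word (p # p # ps) = trace_word (p # ps)"
  using assms map_fst_snd_words[OF assms(2)] by (auto simp: trace_word_def haar_word_dup)

lemma trace_word_eq_0:
  assumes "\<And>x x' y y'. \<lbrakk>x \<in> V; x' \<in> V; y \<in> W; y' \<in> W; r x x' \<noteq> r' y y'\<rbrakk> \<Longrightarrow> U x y * U x' y' = 0"
    and "x \<in> V" "x' \<in> V" "y \<in> W" "y' \<in> W" "r x x' \<noteq> r' y y'" "set ps \<subseteq> V \<times> W"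
  shows "trace_word ((x, y) # (x', y') # ps) = 0"
  using assms(2-6) map_fst_snd_words[OF assms(7)]
  by (auto simp: trace_word_def intro: haar_word_eq_0[where r = r and r' = r', OF assms(1)])

lemma trace_word_row_sum:
  assumes "x \<in> V" "set ps \<subseteq> V \<times> W"
  shows "(\<Sum>y\<in>W. trace_word ((x, y) # ps)) = trace_word ps"
  using assms map_fst_snd_words[OF assms(2)] by (simp add: trace_word_def haar_word_row_sum)

lemma trace_word_column_sum:
  assumes "y \<in> W" "set ps \<subseteq> V \<times> W"
  shows "(\<Sum>x\<in>V. trace_word ((x, y) # ps)) = trace_word ps"
  using assms map_fst_snd_words[OF assms(2)] by (simp add: trace_word_def haar_word_column_sum)

lemma trace_word_rotate:
  assumes "p \<in> V \<times> W" "set ps \<subseteq> V \<times> W"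
  shows "trace_word (ps @ [p]) = trace_word (p # ps)"
  using assms map_fst_snd_words[OF assms(2)] by (auto simp: trace_word_def haar_word_rotate)

lemma trace_word_psd_words:
  "(\<Sum>p\<in>words n (V \<times> W). \<Sum>q\<in>words n (V \<times> W). cnj (c p) * c q * trace_word (p @ rev q)) \<in> \<real>\<^sub>\<ge>\<^sub>0"
proof -
  interpret pair_unitary "words n V" "words n W" "word_prod U"
    by (rule pair_unitary_words)
  let ?R = "words n (V \<times> W)" and ?Q = "words n V \<times> words n W"
  let ?b = "\<lambda>ps. (map fst ps, map snd ps)"
  have bij: "bij_betw ?b ?R ?Q"
  proof (rule bij_betwI[where g = "\<lambda>(xs, ys). zip xs ys"])
    show "?b \<in> ?R \<rightarrow> ?Q"
    proof
      fix ps assume "ps \<in> ?R"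
      then have "set ps \<subseteq> V \<times> W" "length ps = n" by (auto simp: words_def)
      then show "?b ps \<in> ?Q" using map_fst_snd_words[of ps] by simp
    qed
  qed (auto simp: words_def zip_map_fst_snd dest: set_zip_leftD set_zip_rightD)
  define f where "f P Q = cnj (c (zip (fst P) (snd P))) * c (zip (fst Q) (snd Q)) *
      pair.haar (fst P, fst Q) (snd P, snd Q)" for P Q
  have f: "f (?b p) (?b q) = cnj (c p) * c q * trace_word (p @ rev q)" if "p \<in> ?R" "q \<in> ?R" for p q
  proof -
    have "length p = n" "length q = n" "set p \<subseteq> V \<times> W" "set q \<subseteq> V \<times> W"
      using that by (auto simp: words_def)
    then have "trace_word (p @ rev q) = pair.haar (map fst p, map fst q) (map snd p, map snd q)"
      using map_fst_snd_words[of p] map_fst_snd_words[of q]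
        haar_word_pair[of "map fst p" n "map fst q" "map snd p" "map snd q"]
      by (simp add: trace_word_def rev_map mult_2)
    then show ?thesis by (simp add: f_def zip_map_fst_snd)
  qed
  have "(\<Sum>P\<in>?Q. \<Sum>Q\<in>?Q. f P Q) \<in> \<real>\<^sub>\<ge>\<^sub>0"
    using pair_haar_psd[of "\<lambda>P. c (zip (fst P) (snd P))"] by (simp add: f_def split_beta)
  also have "(\<Sum>P\<in>?Q. \<Sum>Q\<in>?Q. f P Q) = (\<Sum>p\<in>?R. \<Sum>q\<in>?R. f (?b p) (?b q))"
    unfolding sum.reindex_bij_betw[OF bij, symmetric] ..
  also have "\<dots> = (\<Sum>p\<in>?R. \<Sum>q\<in>?R. cnj (c p) * c q * trace_word (p @ rev q))"
    by (intro sum.cong refl f)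
  finally show ?thesis .
qed

lemma trace_word_pad_left:
  assumes "x0 \<in> V" "set p \<subseteq> V \<times> W"
  shows "(\<Sum>zs\<in>words k W. trace_word (map (Pair x0) zs @ p)) = trace_word p"
proof (induction k)
  case (Suc k)
  have "(\<Sum>zs\<in>words (Suc k) W. trace_word (map (Pair x0) zs @ p))
      = (\<Sum>zs\<in>words k W. \<Sum>z\<in>W. trace_word ((x0, z) # map (Pair x0) zs @ p))"
    unfolding sum_words_Suc by (subst sum.swap) simp
  also have "\<dots> = (\<Sum>zs\<in>words k W. trace_word (map (Pair x0) zs @ p))"
    using assms by (intro sum.cong refl trace_word_row_sum) (auto simp: words_def)
  finally show ?case using Suc.IH by simp
qed simp

text \<open>A letter at the end is rotated to the front before it is summed out.\<close>

lemma trace_word_pad_right: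
  assumes "x0 \<in> V" "set p \<subseteq> V \<times> W"
  shows "(\<Sum>zs\<in>words k W. trace_word (p @ rev (map (Pair x0) zs))) = trace_word p"
proof (induction k)
  case (Suc k)
  have "(\<Sum>zs\<in>words (Suc k) W. trace_word (p @ rev (map (Pair x0) zs)))
      = (\<Sum>zs\<in>words k W. \<Sum>z\<in>W. trace_word ((p @ rev (map (Pair x0) zs)) @ [(x0, z)]))"
    unfolding sum_words_Suc by (subst sum.swap) simp
  also have "\<dots> = (\<Sum>zs\<in>words k W. \<Sum>z\<in>W. trace_word ((x0, z) # (p @ rev (map (Pair x0) zs))))"
    using assms by (intro sum.cong refl trace_word_rotate) (auto simp: words_def)
  also have "\<dots> = (\<Sum>zs\<in>words k W. trace_word (p @ rev (map (Pair x0) zs)))"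
    using assms by (intro sum.cong refl trace_word_row_sum) (auto simp: words_def)
  finally show ?case using Suc.IH by simp
qed simp

text \<open>
  Summing over all paddings of a word by letters in the row \<open>x0\<close> does not change the functional,
  so positivity need only be checked for words of equal length.
\<close>

theorem trace_word_psd:
  assumes x0: "x0 \<in> V" and A: "finite A" "\<And>p. p \<in> A \<Longrightarrow> set p \<subseteq> V \<times> W"
  shows "(\<Sum>p\<in>A. \<Sum>q\<in>A. cnj (c p) * c q * trace_word (p @ rev q)) \<in> \<real>\<^sub>\<ge>\<^sub>0"
proof -
  \<comment> \<open>The inserted 0 keeps the maximum defined for empty \<open>A\<close>.\<close>
  define N where "N = Max (insert 0 (length ` A))"
  have N: "length p \<le> N" if "p \<in> A" for p
    using that A by (simp add: N_def)
  let ?R = "words N (V \<times> W)"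
  define pad where "pad p = (\<lambda>zs. map (Pair x0) zs @ p) ` words (N - length p) W" for p :: "('x \<times> 'y) list"
  \<comment> \<open>The padded words of different \<open>p\<close> may coincide, so the coefficient
    of \<open>r\<close> collects every \<open>p\<close> that can be padded to
    \<open>r\<close>.\<close>
  define C where "C r = (\<Sum>p\<in>A. c p * of_bool (r \<in> pad p))" for r
  have fin: "finite ?R" by (simp add: finite_V finite_W)
  have padR: "pad p \<subseteq> ?R" if "p \<in> A" for p
    using x0 A(2)[OF that] N[OF that] by (auto simp: pad_def words_def)
  have sum_pad: "(\<Sum>zs\<in>words (N - length p) W. g (map (Pair x0) zs @ p)) = (\<Sum>r\<in>?R. of_bool (r \<in> pad p) * g r)"
    if "p \<in> A" for p and g :: "('x \<times> 'y) list \<Rightarrow> complex"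
  proof -
    have "inj_on (\<lambda>zs. map (Pair x0) zs @ p) (words (N - length p) W)"
      using inj_map_eq_map[of "Pair x0"] by (auto simp: inj_on_def)
    then have "(\<Sum>zs\<in>words (N - length p) W. g (map (Pair x0) zs @ p)) = (\<Sum>r\<in>pad p. g r)"
      unfolding pad_def by (subst sum.reindex) (auto simp: o_def)
    also have "\<dots> = (\<Sum>r\<in>?R. of_bool (r \<in> pad p) * g r)"
      using padR[OF that] fin by (intro sum.mono_neutral_cong_left) auto
    finally show ?thesis .
  qed
  have cnj_of_bool: "cnj (of_bool b) = of_bool b" for b
    by (cases b) auto
  have left: "(\<Sum>p\<in>A. cnj (c p) * trace_word (p @ rev q)) = (\<Sum>r\<in>?R. cnj (C r) * trace_word (r @ rev q))"
    if q: "set q \<subseteq> V \<times> W" for q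
  proof -
    have "(\<Sum>p\<in>A. cnj (c p) * trace_word (p @ rev q))
        = (\<Sum>p\<in>A. cnj (c p) * (\<Sum>r\<in>?R. of_bool (r \<in> pad p) * trace_word (r @ rev q)))"
    proof (intro sum.cong refl)
      fix p assume p: "p \<in> A"
      have "trace_word (p @ rev q) = (\<Sum>zs\<in>words (N - length p) W. trace_word (map (Pair x0) zs @ p @ rev q))"
        using trace_word_pad_left[OF x0, of "p @ rev q" "N - length p"] A(2)[OF p] q by auto
      also have "\<dots> = (\<Sum>r\<in>?R. of_bool (r \<in> pad p) * trace_word (r @ rev q))"
        using sum_pad[OF p, of "\<lambda>r. trace_word (r @ rev q)"] by simp
      finally show "cnj (c p) * trace_word (p @ rev q)
          = cnj (c p) * (\<Sum>r\<in>?R. of_bool (r \<in> pad p) * trace_word (r @ rev q))" by simp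
    qed
    also have "\<dots> = (\<Sum>r\<in>?R. cnj (C r) * trace_word (r @ rev q))"
      unfolding C_def cnj_sum sum_distrib_left sum_distrib_right
      by (subst sum.swap) (simp add: mult.assoc cnj_of_bool)
    finally show ?thesis .
  qed
  have right: "(\<Sum>q\<in>A. c q * trace_word (p @ rev q)) = (\<Sum>r\<in>?R. C r * trace_word (p @ rev r))"
    if p: "set p \<subseteq> V \<times> W" for p
  proof -
    have "(\<Sum>q\<in>A. c q * trace_word (p @ rev q))
        = (\<Sum>q\<in>A. c q * (\<Sum>r\<in>?R. of_bool (r \<in> pad q) * trace_word (p @ rev r)))"
    proof (intro sum.cong refl)
      fix q assume q: "q \<in> A"
      have "trace_word (p @ rev q) = (\<Sum>zs\<in>words (N - length q) W. trace_word (p @ rev (map (Pair x0) zs @ q)))"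
        using trace_word_pad_right[OF x0, of "p @ rev q" "N - length q"] A(2)[OF q] p by auto
      also have "\<dots> = (\<Sum>r\<in>?R. of_bool (r \<in> pad q) * trace_word (p @ rev r))"
        using sum_pad[OF q, of "\<lambda>r. trace_word (p @ rev r)"] by simp
      finally show "c q * trace_word (p @ rev q)
          = c q * (\<Sum>r\<in>?R. of_bool (r \<in> pad q) * trace_word (p @ rev r))" by simp
    qed
    also have "\<dots> = (\<Sum>r\<in>?R. C r * trace_word (p @ rev r))"
      unfolding C_def sum_distrib_left sum_distrib_right by (subst sum.swap) (simp add: mult.assoc)
    finally show ?thesis .
  qed
  have "(\<Sum>p\<in>A. \<Sum>q\<in>A. cnj (c p) * c q * trace_word (p @ rev q))
      = (\<Sum>p\<in>A. cnj (c p) * (\<Sum>r\<in>?R. C r * trace_word (p @ rev r)))"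
    using right A(2) by (simp add: sum_distrib_left mult.assoc flip: right)
  also have "\<dots> = (\<Sum>r\<in>?R. C r * (\<Sum>p\<in>A. cnj (c p) * trace_word (p @ rev r)))"
    unfolding sum_distrib_left by (subst sum.swap) (simp add: mult_ac)
  also have "\<dots> = (\<Sum>r\<in>?R. C r * (\<Sum>p\<in>?R. cnj (C p) * trace_word (p @ rev r)))"
    by (intro sum.cong refl) (simp add: left words_def)
  also have "\<dots> = (\<Sum>p\<in>?R. \<Sum>q\<in>?R. cnj (C p) * C q * trace_word (p @ rev q))"
    unfolding sum_distrib_left by (subst sum.swap) (simp add: mult_ac)
  finally show ?thesis
    using trace_word_psd_words[where n = N and c = C] by simp
qed

end


section \<open>The Hilbert space of a positive kernel\<close>

text \<open>A list is a formal combination of indices and stands for the function sending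
  \<open>n\<close> to \<open>lin (k n) s\<close>. Working with these functions identifies the null
  vectors of the kernel without a quotient and keeps the carrier inside
  \<open>nat \<Rightarrow> complex\<close>, as the strategies require.\<close>

definition lin :: "(nat \<Rightarrow> complex) \<Rightarrow> (complex \<times> nat) list \<Rightarrow> complex" where
  "lin g s = (\<Sum>(c, n)\<leftarrow>s. c * g n)"

definition scale :: "complex \<Rightarrow> (complex \<times> nat) list \<Rightarrow> (complex \<times> nat) list" where
  "scale c s = map (\<lambda>(d, n). (c * d, n)) s"

abbreviation sub :: "(complex \<times> nat) list \<Rightarrow> (complex \<times> nat) list \<Rightarrow> (complex \<times> nat) list" where
  "sub s t \<equiv> s @ scale (-1) t"

lemma lin_simps [simp]:
  "lin g [] = 0" "lin g ((c, n) # s) = c * g n + lin g s" "lin g (s @ t) = lin g s + lin g t"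
  by (simp_all add: lin_def)

lemma lin_scale [simp]: "lin g (scale c s) = c * lin g s"
  by (induction s) (auto simp: scale_def algebra_simps)

lemma lin_zero [simp]: "lin (\<lambda>_. 0) s = 0"
  by (induction s) auto

lemma lin_eq_sum:
  assumes "finite A" "snd ` set s \<subseteq> A"
  shows "lin g s = (\<Sum>n\<in>A. lin (\<lambda>m. of_bool (m = n)) s * g n)"
  using assms(2)
proof (induction s)
  case (Cons p s)
  obtain c m where p: "p = (c, m)" by (cases p)
  have "(\<Sum>n\<in>A. (c * of_bool (m = n) + lin (\<lambda>m. of_bool (m = n)) s) * g n)
      = (\<Sum>n\<in>A. if m = n then c * g m else 0) + (\<Sum>n\<in>A. lin (\<lambda>m. of_bool (m = n)) s * g n)"
    unfolding sum.distrib[symmetric] by (intro sum.cong) (auto simp: algebra_simps)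
  then show ?case using Cons assms(1) by (simp add: p)
qed simp

locale psd_kernel =
  fixes k :: "nat \<Rightarrow> nat \<Rightarrow> complex"
  assumes psd: "finite A \<Longrightarrow> (\<Sum>m\<in>A. \<Sum>n\<in>A. cnj (c m) * c n * k m n) \<in> \<real>\<^sub>\<ge>\<^sub>0"
begin

text \<open>The two conjugations turn the linear \<open>lin\<close> into an antilinear dependence on
  \<open>s\<close>.\<close>

definition B :: "(complex \<times> nat) list \<Rightarrow> (complex \<times> nat) list \<Rightarrow> complex" where
  "B s t = cnj (lin (\<lambda>m. cnj (lin (k m) t)) s)"

lemma B_simps [simp]:
  "B (s @ s') t = B s t + B s' t" "B s (t @ t') = B s t + B s t'"
  "B (scale c s) t = cnj c * B s t" "B s (scale c t) = c * B s t"
  "B [] t = 0" "B [(c, n)] t = cnj c * lin (k n) t"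
proof -
  show "B s (t @ t') = B s t + B s t'" "B s (scale c t) = c * B s t"
    by (induction s) (auto simp: B_def algebra_simps)
qed (simp_all add: B_def)

lemma kernel_diagonal: "k m m \<in> \<real>\<^sub>\<ge>\<^sub>0"
  using psd[of "{m}" "\<lambda>_. 1"] by simp

text \<open>Polarisation: the coefficient vectors \<open>(1, 1)\<close> and \<open>(1, \<i>)\<close>
  give the imaginary and the real part.\<close>

lemma kernel_hermitian: "k n m = cnj (k m n)"
proof (cases "m = n")
  case True
  then show ?thesis using kernel_diagonal[of m] by (auto simp: complex_nonneg_Reals_iff complex_eq_iff)
next
  case False
  have "Im (k m m) = 0" "Im (k n n) = 0"
    using kernel_diagonal by (auto simp: complex_nonneg_Reals_iff)
  moreover have "Im (k m n + k n m) = 0"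
    using psd[of "{m, n}" "\<lambda>_. 1"] False calculation by (simp add: complex_nonneg_Reals_iff)
  moreover have "Im (\<i> * k m n - \<i> * k n m) = 0"
    using psd[of "{m, n}" "\<lambda>j. if j = m then 1 else \<i>"] False calculation
    by (simp add: complex_nonneg_Reals_iff)
  ultimately show ?thesis by (simp add: complex_eq_iff)
qed

lemma B_hermitian: "B t s = cnj (B s t)"
proof (induction s)
  case Nil
  show ?case by (induction t) (auto simp: B_def)
next
  case (Cons p s)
  obtain c m where p: "p = (c, m)" by (cases p)
  have single: "B t [(c, m)] = cnj (B [(c, m)] t)"
  proof (induction t)
    case (Cons q t)
    obtain d n where q: "q = (d, n)" by (cases q)
    have "B (q # t) [(c, m)] = B [q] [(c, m)] + B t [(c, m)]"
      using B_simps(1)[of "[q]" t] by simp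
    then show ?case using Cons.IH kernel_hermitian[of n m] by (simp add: q algebra_simps)
  qed simp
  have "B t (p # s) = B t [p] + B t s" "B (p # s) t = B [p] t + B s t"
    using B_simps(2)[of t "[p]" s] B_simps(1)[of "[p]" s t] by simp_all
  then show ?case using single Cons.IH p by simp
qed

lemma B_self_nonneg: "B s s \<in> \<real>\<^sub>\<ge>\<^sub>0"
proof -
  define c where "c n = lin (\<lambda>m. of_bool (m = n)) s" for n
  let ?A = "snd ` set s"
  have lin: "lin g s = (\<Sum>n\<in>?A. c n * g n)" for g
    unfolding c_def by (rule lin_eq_sum) auto
  have "B s s = (\<Sum>m\<in>?A. \<Sum>n\<in>?A. cnj (c m) * c n * k m n)"
    by (simp add: B_def lin cnj_sum sum_distrib_left mult.assoc)
  then show ?thesis using psd[of ?A c] by simp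
qed

definition N :: "(complex \<times> nat) list \<Rightarrow> real" where
  "N s = sqrt (Re (B s s))"

lemma B_self: "B s s = complex_of_real ((N s)\<^sup>2)"
  using B_self_nonneg[of s] by (simp add: N_def complex_nonneg_Reals_iff complex_eq_iff)

lemma N_nonneg [simp]: "N s \<ge> 0"
  using B_self_nonneg[of s] by (simp add: N_def complex_nonneg_Reals_iff)

lemma Cauchy_Schwarz: "cmod (B s t) \<le> N s * N t"
proof -
  have expand: "0 \<le> (N s)\<^sup>2 - 2 * r * (cmod (B s t))\<^sup>2 + r\<^sup>2 * (cmod (B s t))\<^sup>2 * (N t)\<^sup>2" for r :: real
  proof -
    \<comment> \<open>This phase makes the cross terms real. The factor \<open>r\<close> is then
      chosen as the minimiser \<open>1 / (N t)\<^sup>2\<close>, or, if \<open>N t = 0\<close>, so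
      large that the expression becomes -1.\<close>
    let ?z = "- complex_of_real r * cnj (B s t)"
    have "B (s @ scale ?z t) (s @ scale ?z t)
        = B s s + ?z * B s t + cnj ?z * cnj (B s t) + cnj ?z * ?z * B t t"
      using B_hermitian[of t s] by (simp add: algebra_simps)
    also have "\<dots> = complex_of_real ((N s)\<^sup>2) - 2 * complex_of_real r * (B s t * cnj (B s t))
        + complex_of_real (r\<^sup>2) * (B s t * cnj (B s t)) * complex_of_real ((N t)\<^sup>2)"
      by (simp add: B_self power2_eq_square algebra_simps)
    also have "\<dots> = complex_of_real ((N s)\<^sup>2 - 2 * r * (cmod (B s t))\<^sup>2 + r\<^sup>2 * (cmod (B s t))\<^sup>2 * (N t)\<^sup>2)"
      unfolding complex_norm_square[symmetric] by simp
    finally show ?thesis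
      using B_self_nonneg[of "s @ scale ?z t"] by (simp only: nonneg_Reals_of_real_iff)
  qed
  have "(cmod (B s t))\<^sup>2 \<le> (N s)\<^sup>2 * (N t)\<^sup>2"
  proof (cases "N t = 0")
    case True
    have "(cmod (B s t))\<^sup>2 = 0"
    proof (rule ccontr)
      assume nz: "(cmod (B s t))\<^sup>2 \<noteq> 0"
      then have "2 * (((N s)\<^sup>2 + 1) / (2 * (cmod (B s t))\<^sup>2)) * (cmod (B s t))\<^sup>2 = (N s)\<^sup>2 + 1"
        by (simp add: field_simps)
      then show False
        using expand[of "((N s)\<^sup>2 + 1) / (2 * (cmod (B s t))\<^sup>2)"] True by simp
    qed
    then show ?thesis by simp
  next
    case False
    then have "(N s)\<^sup>2 - 2 * (1 / (N t)\<^sup>2) * (cmod (B s t))\<^sup>2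
        + (1 / (N t)\<^sup>2)\<^sup>2 * (cmod (B s t))\<^sup>2 * (N t)\<^sup>2 = (N s)\<^sup>2 - (cmod (B s t))\<^sup>2 / (N t)\<^sup>2"
      by (simp add: field_simps power2_eq_square)
    then have "(cmod (B s t))\<^sup>2 / (N t)\<^sup>2 \<le> (N s)\<^sup>2"
      using expand[of "1 / (N t)\<^sup>2"] by simp
    moreover have "(N t)\<^sup>2 > 0" using False by simp
    ultimately show ?thesis by (simp add: pos_divide_le_eq)
  qed
  then have "(cmod (B s t))\<^sup>2 \<le> (N s * N t)\<^sup>2"
    by (simp add: power_mult_distrib)
  then show ?thesis by (rule power2_le_imp_le) simp
qed

lemma N_append: "N (s @ t) \<le> N s + N t"
proof (rule power2_le_imp_le)
  have "complex_of_real ((N (s @ t))\<^sup>2) = B (s @ t) (s @ t)"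
    by (rule B_self[symmetric])
  also have "\<dots> = B s s + B s t + cnj (B s t) + B t t"
    using B_hermitian[of t s] by simp
  also have "\<dots> = complex_of_real ((N s)\<^sup>2 + 2 * Re (B s t) + (N t)\<^sup>2)"
    using complex_add_cnj[of "B s t"] by (simp add: B_self add.assoc)
  finally have "(N (s @ t))\<^sup>2 = (N s)\<^sup>2 + 2 * Re (B s t) + (N t)\<^sup>2"
    by (simp only: of_real_eq_iff)
  also have "\<dots> \<le> (N s)\<^sup>2 + 2 * (N s * N t) + (N t)\<^sup>2"
    using Cauchy_Schwarz[of s t] complex_Re_le_cmod[of "B s t"] by linarith
  finally show "(N (s @ t))\<^sup>2 \<le> (N s + N t)\<^sup>2"
    by (simp add: power2_sum)
qed simp

lemma N_scale [simp]: "N (scale c s) = cmod c * N s"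
proof -
  have "complex_of_real ((N (scale c s))\<^sup>2) = complex_of_real ((cmod c * N s)\<^sup>2)"
    unfolding power_mult_distrib of_real_mult complex_norm_square B_self[symmetric]
    by (simp add: mult_ac)
  then have "(N (scale c s))\<^sup>2 = (cmod c * N s)\<^sup>2"
    by (simp only: of_real_eq_iff)
  then show ?thesis by (simp add: power2_eq_iff_nonneg)
qed

lemma N_cong:
  assumes "\<And>n. lin (k n) s = lin (k n) t"
  shows "N s = N t"
proof -
  have "B u s = B u t" for u
    using assms by (simp add: B_def)
  then have "B s s = B t t" by (metis B_hermitian)
  then show ?thesis by (simp add: N_def)
qed

lemma N_sub_commute: "N (sub s t) = N (sub t s)"
proof -
  have "N (sub s t) = N (scale (-1) (sub t s))"
    by (rule N_cong) simp
  then show ?thesis by simp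
qed

lemma N_diff: "\<bar>N s - N t\<bar> \<le> N (sub s t)"
proof -
  have "N s = N (sub s t @ t)" "N t = N (sub t s @ s)"
    by (rule N_cong, simp)+
  then show ?thesis
    using N_append[of "sub s t" t] N_append[of "sub t s" s] N_sub_commute[of s t] by linarith
qed

section \<open>The completion, realised by pointwise limits\<close>

definition cauchy :: "(nat \<Rightarrow> (complex \<times> nat) list) \<Rightarrow> bool" where
  "cauchy s \<longleftrightarrow> (\<forall>e>0. \<exists>M. \<forall>i\<ge>M. \<forall>j\<ge>M. N (sub (s i) (s j)) < e)"

definition approx :: "(nat \<Rightarrow> (complex \<times> nat) list) \<Rightarrow> (nat \<Rightarrow> complex) \<Rightarrow> bool" where
  "approx s f \<longleftrightarrow> cauchy s \<and> (\<forall>n. (\<lambda>j. lin (k n) (s j)) \<longlonglongrightarrow> f n)"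

definition H :: "(nat \<Rightarrow> complex) set" where
  "H = {f. \<exists>s. approx s f}"

lemma cauchy_add:
  assumes "cauchy s" "cauchy t"
  shows "cauchy (\<lambda>j. s j @ t j)"
  unfolding cauchy_def
proof (intro allI impI)
  fix e :: real assume "e > 0"
  then have "e / 2 > 0" by simp
  then obtain M1 M2 where M: "\<And>i j. i \<ge> M1 \<Longrightarrow> j \<ge> M1 \<Longrightarrow> N (sub (s i) (s j)) < e / 2"
    "\<And>i j. i \<ge> M2 \<Longrightarrow> j \<ge> M2 \<Longrightarrow> N (sub (t i) (t j)) < e / 2"
    using assms unfolding cauchy_def by meson
  have "N (sub (s i @ t i) (s j @ t j)) < e" if "i \<ge> max M1 M2" "j \<ge> max M1 M2" for i j
  proof -
    have "N (sub (s i @ t i) (s j @ t j)) = N (sub (s i) (s j) @ sub (t i) (t j))"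
      by (rule N_cong) (simp add: algebra_simps)
    also have "\<dots> \<le> N (sub (s i) (s j)) + N (sub (t i) (t j))"
      by (rule N_append)
    also have "\<dots> < e" using M[of i j] that by fastforce
    finally show ?thesis .
  qed
  then show "\<exists>M. \<forall>i\<ge>M. \<forall>j\<ge>M. N (sub (s i @ t i) (s j @ t j)) < e" by blast
qed

lemma cauchy_scale:
  assumes "cauchy s"
  shows "cauchy (\<lambda>j. scale c (s j))"
  unfolding cauchy_def
proof (intro allI impI)
  fix e :: real assume "e > 0"
  then have "e / (cmod c + 1) > 0" by (simp add: add_nonneg_pos)
  then obtain M where M: "\<And>i j. i \<ge> M \<Longrightarrow> j \<ge> M \<Longrightarrow> N (sub (s i) (s j)) < e / (cmod c + 1)"
    using assms unfolding cauchy_def by meson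
  have "N (sub (scale c (s i)) (scale c (s j))) < e" if "i \<ge> M" "j \<ge> M" for i j
  proof -
    have "N (sub (scale c (s i)) (scale c (s j))) = N (scale c (sub (s i) (s j)))"
      by (rule N_cong) (simp add: algebra_simps)
    also have "\<dots> \<le> (cmod c + 1) * N (sub (s i) (s j))"
      by (simp add: mult_right_mono)
    also have "\<dots> < (cmod c + 1) * (e / (cmod c + 1))"
      using M[OF that] by (intro mult_strict_left_mono) (auto simp: add_nonneg_pos)
    also have "\<dots> = e"
    proof -
      have "cmod c + 1 \<noteq> 0" using norm_ge_zero[of c] by linarith
      then show ?thesis by simp
    qed
    finally show ?thesis .
  qed
  then show "\<exists>M. \<forall>i\<ge>M. \<forall>j\<ge>M. N (sub (scale c (s i)) (scale c (s j))) < e" by blast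
qed

lemma approx_add: "approx s f \<Longrightarrow> approx t g \<Longrightarrow> approx (\<lambda>j. s j @ t j) (\<lambda>n. f n + g n)"
  by (simp add: approx_def cauchy_add tendsto_add)

lemma approx_scale: "approx s f \<Longrightarrow> approx (\<lambda>j. scale c (s j)) (\<lambda>n. c * f n)"
  by (simp add: approx_def cauchy_scale tendsto_mult_left)

lemma approx_diff: "approx s f \<Longrightarrow> approx t g \<Longrightarrow> approx (\<lambda>j. sub (s j) (t j)) (\<lambda>n. f n - g n)"
  using approx_add[OF _ approx_scale[of t g "-1"]] by simp

lemma approx_const: "approx (\<lambda>_. s) (\<lambda>n. lin (k n) s)"
proof -
  have "N (sub s s) = N []" by (rule N_cong) simp
  then have "N (sub s s) = 0" by (simp add: N_def)
  then show ?thesis by (simp add: approx_def cauchy_def)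
qed

lemma cauchy_bounded:
  assumes "cauchy s"
  obtains C where "C > 0" "\<And>j. N (s j) \<le> C"
proof -
  have "Cauchy (\<lambda>j. N (s j))"
    unfolding Cauchy_def dist_real_def
  proof (intro allI impI)
    fix e :: real assume "e > 0"
    then obtain M where "\<And>i j. i \<ge> M \<Longrightarrow> j \<ge> M \<Longrightarrow> N (sub (s i) (s j)) < e"
      using assms unfolding cauchy_def by meson
    then show "\<exists>M. \<forall>m\<ge>M. \<forall>n\<ge>M. \<bar>N (s m) - N (s n)\<bar> < e"
      using N_diff order_le_less_trans by meson
  qed
  then obtain C where "C > 0" "\<And>j. norm (N (s j)) \<le> C"
    using Cauchy_Bseq Bseq_def by metis
  then show ?thesis using that by auto
qed

lemma tendsto_B_left:
  assumes "\<And>n. (\<lambda>j. lin (k n) (s j)) \<longlonglongrightarrow> f n"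
  shows "(\<lambda>j. B u (s j)) \<longlonglongrightarrow> cnj (lin (\<lambda>m. cnj (f m)) u)"
  unfolding B_def
proof (intro tendsto_cnj, induction u)
  case (Cons p u)
  obtain c m where "p = (c, m)" by (cases p)
  then show ?case
    using Cons by (auto intro!: tendsto_add tendsto_mult_left tendsto_cnj assms)
qed simp

text \<open>This makes the limit functions represent the completion faithfully: a Cauchy sequence
  with pointwise limit 0 tends to 0 in norm.\<close>

lemma N_tendsto_0:
  assumes "approx s (\<lambda>_. 0)"
  shows "(\<lambda>j. N (s j)) \<longlonglongrightarrow> 0"
proof -
  have s: "cauchy s" "\<And>n. (\<lambda>j. lin (k n) (s j)) \<longlonglongrightarrow> 0"
    using assms by (auto simp: approx_def)
  obtain C where C: "C > 0" "\<And>j. N (s j) \<le> C"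
    using cauchy_bounded[OF s(1)] by blast
  have "(\<lambda>j. (N (s j))\<^sup>2) \<longlonglongrightarrow> 0"
    unfolding LIMSEQ_def dist_real_def
  proof (intro allI impI)
    fix e :: real assume e: "e > 0"
    then have "e / (2 * C) > 0" using C by simp
    then obtain M where M: "\<And>i j. i \<ge> M \<Longrightarrow> j \<ge> M \<Longrightarrow> N (sub (s i) (s j)) < e / (2 * C)"
      using s(1) unfolding cauchy_def by meson
    have "(\<lambda>j. B (s M) (s j)) \<longlonglongrightarrow> 0"
      using tendsto_B_left[of s "\<lambda>_. 0" "s M"] s(2) by simp
    then obtain M' where M': "\<And>j. j \<ge> M' \<Longrightarrow> cmod (B (s M) (s j)) < e / 2"
      using e unfolding LIMSEQ_def dist_norm by (metis diff_zero half_gt_zero)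
    have "(N (s j))\<^sup>2 < e" if "j \<ge> max M M'" for j
    proof -
      \<comment> \<open>The first term is small by the Cauchy property and boundedness; in the
        second the formal sum \<open>s M\<close> is fixed, so it involves only finitely many
        pointwise limits.\<close>
      have "complex_of_real ((N (s j))\<^sup>2) = B (sub (s j) (s M)) (s j) + B (s M) (s j)"
        by (simp add: B_self)
      then have "(N (s j))\<^sup>2 = cmod (B (sub (s j) (s M)) (s j) + B (s M) (s j))"
        by (metis abs_of_nonneg norm_of_real zero_le_power2)
      also have "\<dots> \<le> cmod (B (sub (s j) (s M)) (s j)) + cmod (B (s M) (s j))"
        by (rule norm_triangle_ineq)
      also have "\<dots> \<le> N (sub (s j) (s M)) * N (s j) + cmod (B (s M) (s j))"
        by (intro add_right_mono Cauchy_Schwarz)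
      also have "\<dots> \<le> e / (2 * C) * C + cmod (B (s M) (s j))"
        using M[of j M] C e that by (intro add_mono mult_mono) auto
      also have "\<dots> < e"
        using M'[of j] C that by simp
      finally show ?thesis .
    qed
    then show "\<exists>M. \<forall>j\<ge>M. \<bar>(N (s j))\<^sup>2 - 0\<bar> < e"
      by (intro exI[of _ "max M M'"]) auto
  qed
  then have "(\<lambda>j. sqrt ((N (s j))\<^sup>2)) \<longlonglongrightarrow> sqrt 0"
    by (rule tendsto_real_sqrt)
  then show ?thesis by simp
qed

lemma convergent_B:
  assumes "cauchy s" "cauchy t"
  shows "convergent (\<lambda>j. B (s j) (t j))"
proof -
  obtain C where C: "C > 0" "\<And>j. N (s j) \<le> C" using cauchy_bounded[OF assms(1)] by blast
  obtain D where D: "D > 0" "\<And>j. N (t j) \<le> D" using cauchy_bounded[OF assms(2)] by blast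
  have "Cauchy (\<lambda>j. B (s j) (t j))"
    unfolding Cauchy_def dist_norm
  proof (intro allI impI)
    fix e :: real assume e: "e > 0"
    then have "e / (2 * D) > 0" "e / (2 * C) > 0" using C D by simp_all
    then obtain M1 M2 where M: "\<And>i j. i \<ge> M1 \<Longrightarrow> j \<ge> M1 \<Longrightarrow> N (sub (s i) (s j)) < e / (2 * D)"
      "\<And>i j. i \<ge> M2 \<Longrightarrow> j \<ge> M2 \<Longrightarrow> N (sub (t i) (t j)) < e / (2 * C)"
      using assms unfolding cauchy_def by meson
    have "cmod (B (s i) (t i) - B (s j) (t j)) < e" if "i \<ge> max M1 M2" "j \<ge> max M1 M2" for i j
    proof -
      have "B (s i) (t i) - B (s j) (t j) = B (sub (s i) (s j)) (t i) + B (s j) (sub (t i) (t j))"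
        by simp
      also have "cmod \<dots> \<le> cmod (B (sub (s i) (s j)) (t i)) + cmod (B (s j) (sub (t i) (t j)))"
        by (rule norm_triangle_ineq)
      also have "\<dots> \<le> N (sub (s i) (s j)) * N (t i) + N (s j) * N (sub (t i) (t j))"
        by (intro add_mono Cauchy_Schwarz)
      also have "\<dots> \<le> N (sub (s i) (s j)) * D + C * N (sub (t i) (t j))"
        using C D by (intro add_mono mult_left_mono mult_right_mono) auto
      also have "\<dots> < e / (2 * D) * D + C * (e / (2 * C))"
        using M[of i j] C D that by (intro add_strict_mono mult_strict_left_mono mult_strict_right_mono) auto
      also have "\<dots> = e" using C D by simp
      finally show ?thesis .
    qed
    then show "\<exists>M. \<forall>m\<ge>M. \<forall>n\<ge>M. cmod (B (s m) (t m) - B (s n) (t n)) < e" by blast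
  qed
  then show ?thesis by (simp add: Cauchy_convergent_iff)
qed

lemma approx_unique:
  assumes "approx s f" "approx s' f"
  shows "(\<lambda>j. N (sub (s j) (s' j))) \<longlonglongrightarrow> 0"
  by (rule N_tendsto_0) (use approx_diff[OF assms] in simp)

definition inner :: "(nat \<Rightarrow> complex) \<Rightarrow> (nat \<Rightarrow> complex) \<Rightarrow> complex" where
  "inner f g = lim (\<lambda>j. B ((SOME s. approx s f) j) ((SOME s. approx s g) j))"

text \<open>Any approximating sequences may replace the chosen ones: two of them for the same
  function differ by a null sequence.\<close>

lemma tendsto_inner:
  assumes s: "approx s f" and t: "approx t g"
  shows "(\<lambda>j. B (s j) (t j)) \<longlonglongrightarrow> inner f g"
proof -
  define s' where "s' = (SOME s. approx s f)"
  define t' where "t' = (SOME s. approx s g)"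
  have s': "approx s' f" and t': "approx t' g"
    unfolding s'_def t'_def by (rule someI[of "\<lambda>s. approx s _"], rule assms)+
  have lim: "(\<lambda>j. B (s' j) (t' j)) \<longlonglongrightarrow> inner f g"
    unfolding inner_def s'_def[symmetric] t'_def[symmetric]
    using s' t' by (intro convergent_LIMSEQ_iff[THEN iffD1] convergent_B) (auto simp: approx_def)
  obtain C where C: "\<And>j. N (t j) \<le> C" using cauchy_bounded t by (metis approx_def)
  obtain D where D: "\<And>j. N (s' j) \<le> D" using cauchy_bounded s' by (metis approx_def)
  have "(\<lambda>j. N (sub (s j) (s' j)) * C + D * N (sub (t j) (t' j))) \<longlonglongrightarrow> 0 * C + D * 0"
    using approx_unique[OF s s'] approx_unique[OF t t'] by (intro tendsto_intros)
  then have "(\<lambda>j. N (sub (s j) (s' j)) * C + D * N (sub (t j) (t' j))) \<longlonglongrightarrow> 0"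
    by simp
  note lim0 = this
  have le: "cmod (B (s j) (t j) - B (s' j) (t' j)) \<le> N (sub (s j) (s' j)) * C + D * N (sub (t j) (t' j))" for j
  proof -
    have "B (s j) (t j) - B (s' j) (t' j) = B (sub (s j) (s' j)) (t j) + B (s' j) (sub (t j) (t' j))"
      by simp
    also have "cmod \<dots> \<le> cmod (B (sub (s j) (s' j)) (t j)) + cmod (B (s' j) (sub (t j) (t' j)))"
      by (rule norm_triangle_ineq)
    also have "\<dots> \<le> N (sub (s j) (s' j)) * N (t j) + N (s' j) * N (sub (t j) (t' j))"
      by (intro add_mono Cauchy_Schwarz)
    also have "\<dots> \<le> N (sub (s j) (s' j)) * C + D * N (sub (t j) (t' j))"
      using C D by (intro add_mono mult_left_mono mult_right_mono) auto
    finally show ?thesis .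
  qed
  have "(\<lambda>j. B (s j) (t j) - B (s' j) (t' j)) \<longlonglongrightarrow> 0"
    by (rule Lim_null_comparison[OF always_eventually lim0]) (use le in auto)
  from tendsto_add[OF this lim] show ?thesis by simp
qed

lemma tendsto_norm_inner:
  assumes "approx s f"
  shows "(\<lambda>j. N (s j)) \<longlonglongrightarrow> sqrt (Re (inner f f))"
  unfolding N_def by (intro tendsto_intros tendsto_inner assms)

definition space :: "(nat \<Rightarrow> complex) inner_module" where
  "space = \<lparr>carrier = H, mult = (\<lambda>f g. f), one = (\<lambda>_. 0), zero = (\<lambda>_. 0),
     add = (\<lambda>f g n. f n + g n), smult = (\<lambda>c f n. c * f n), inner_prod = inner\<rparr>"

lemma space_simps [simp]:
  "carrier space = H" "zero space = (\<lambda>_. 0)" "add space = (\<lambda>f g n. f n + g n)"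
  "smult space = (\<lambda>c f n. c * f n)" "inner_prod space = inner"
  by (simp_all add: space_def)

lemma H_zero: "(\<lambda>_. 0) \<in> H"
  using approx_const[of "[]"] by (auto simp: H_def)

lemma H_add: "f \<in> H \<Longrightarrow> g \<in> H \<Longrightarrow> (\<lambda>n. f n + g n) \<in> H"
  unfolding H_def using approx_add by blast

lemma H_scale: "f \<in> H \<Longrightarrow> (\<lambda>n. c * f n) \<in> H"
  unfolding H_def using approx_scale by blast

lemma H_lin: "(\<lambda>n. lin (k n) s) \<in> H"
  using approx_const by (auto simp: H_def)

lemma abelian_group_space: "abelian_group space"
proof (rule abelian_groupI)
  fix f assume "f \<in> carrier space"
  then have "(\<lambda>n. - f n) \<in> H" using H_scale[of f "-1"] by simp
  then show "\<exists>y\<in>carrier space. y \<oplus>\<^bsub>space\<^esub> f = \<zero>\<^bsub>space\<^esub>"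
    by (auto intro!: bexI[of _ "\<lambda>n. - f n"])
qed (auto simp: H_zero H_add algebra_simps)

lemma module_space: "module ring_of_type_algebra space"
proof (rule moduleI)
  show "cring (ring_of_type_algebra :: complex ring)"
    by (rule cring_from_type_algebra)
  show "abelian_group space" by (rule abelian_group_space)
qed (auto simp: ring_of_type_algebra_def H_scale algebra_simps)

lemma a_minus_space:
  assumes "f \<in> H" "g \<in> H"
  shows "f \<ominus>\<^bsub>space\<^esub> g = (\<lambda>n. f n - g n)"
proof -
  interpret abelian_group space by (rule abelian_group_space)
  have "(\<lambda>n. - g n) \<in> H" using H_scale[OF assms(2), of "-1"] by simp
  then have "\<ominus>\<^bsub>space\<^esub> g = (\<lambda>n. - g n)"
    using minus_equality[of "\<lambda>n. - g n" g] assms by simp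
  then show ?thesis by (simp add: a_minus_def)
qed

lemma inner_self:
  assumes "f \<in> H"
  shows "Im (inner f f) = 0" "Re (inner f f) \<ge> 0"
proof -
  obtain s where s: "approx s f" using assms by (auto simp: H_def)
  note lim = tendsto_inner[OF s s]
  have "(\<lambda>j. Im (B (s j) (s j))) \<longlonglongrightarrow> Im (inner f f)"
    by (intro tendsto_intros lim)
  then show "Im (inner f f) = 0"
    by (simp add: B_self LIMSEQ_const_iff)
  have "(\<lambda>j. Re (B (s j) (s j))) \<longlonglongrightarrow> Re (inner f f)"
    by (intro tendsto_intros lim)
  then show "Re (inner f f) \<ge> 0"
    by (rule LIMSEQ_le_const) (simp add: B_self)
qed

lemma inner_self_eq_0:
  assumes "f \<in> H" "Re (inner f f) = 0"
  shows "f n = 0"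
proof -
  obtain s where s: "approx s f" using assms by (auto simp: H_def)
  have "(\<lambda>j. N [(1, n)] * N (s j)) \<longlonglongrightarrow> N [(1, n)] * 0"
    using tendsto_norm_inner[OF s] assms(2) by (intro tendsto_intros) simp
  note lim0 = this
  have le: "cmod (lin (k n) (s j)) \<le> N [(1, n)] * N (s j)" for j
    using Cauchy_Schwarz[of "[(1, n)]" "s j"] by simp
  have "(\<lambda>j. lin (k n) (s j)) \<longlonglongrightarrow> 0"
    by (rule Lim_null_comparison[OF always_eventually lim0[unfolded mult_zero_right]]) (use le in auto)
  then show ?thesis
    using s LIMSEQ_unique by (auto simp: approx_def)
qed

lemma vec_norm_space: "vec_norm space f = sqrt (Re (inner f f))"
  by (simp add: vec_norm_def)

lemma vec_norm_triangle:
  assumes "f \<in> H" "g \<in> H"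
  shows "vec_norm space (\<lambda>n. f n + g n) \<le> vec_norm space f + vec_norm space g"
proof -
  obtain s t where st: "approx s f" "approx t g" using assms by (auto simp: H_def)
  show ?thesis
    unfolding vec_norm_space
  proof (rule LIMSEQ_le)
    show "(\<lambda>j. N (s j @ t j)) \<longlonglongrightarrow> sqrt (Re (inner (\<lambda>n. f n + g n) (\<lambda>n. f n + g n)))"
      by (intro tendsto_norm_inner approx_add st)
    show "(\<lambda>j. N (s j) + N (t j)) \<longlonglongrightarrow> sqrt (Re (inner f f)) + sqrt (Re (inner g g))"
      by (intro tendsto_add tendsto_norm_inner st)
  qed (use N_append in auto)
qed

lemma vec_norm_diff_commute:
  assumes "f \<in> H" "g \<in> H"
  shows "vec_norm space (\<lambda>n. f n - g n) = vec_norm space (\<lambda>n. g n - f n)"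
proof -
  obtain s t where st: "approx s f" "approx t g" using assms by (auto simp: H_def)
  have "(\<lambda>j. N (sub (s j) (t j))) \<longlonglongrightarrow> vec_norm space (\<lambda>n. f n - g n)"
    unfolding vec_norm_space by (intro tendsto_norm_inner approx_diff st)
  moreover have "(\<lambda>j. N (sub (t j) (s j))) \<longlonglongrightarrow> vec_norm space (\<lambda>n. g n - f n)"
    unfolding vec_norm_space by (intro tendsto_norm_inner approx_diff st)
  ultimately show ?thesis
    using N_sub_commute LIMSEQ_unique by auto
qed

lemma H_diff: "f \<in> H \<Longrightarrow> g \<in> H \<Longrightarrow> (\<lambda>n. f n - g n) \<in> H"
  unfolding H_def using approx_diff by blast

lemma vec_norm_diff_triangle:
  assumes "f \<in> H" "g \<in> H" "h \<in> H"
  shows "vec_norm space (\<lambda>n. f n - h n) \<le> vec_norm space (\<lambda>n. f n - g n) + vec_norm space (\<lambda>n. g n - h n)"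
  using vec_norm_triangle[OF H_diff[OF assms(1,2)] H_diff[OF assms(2,3)]] by simp

lemma vec_norm_lin: "vec_norm space (\<lambda>n. lin (k n) s - lin (k n) t) = N (sub s t)"
proof -
  have "(\<lambda>j. N (sub s t)) \<longlonglongrightarrow> vec_norm space (\<lambda>n. lin (k n) s - lin (k n) t)"
    unfolding vec_norm_space
    by (intro tendsto_norm_inner approx_diff approx_const)
  then show ?thesis by (simp add: LIMSEQ_const_iff)
qed

lemma tendsto_formal_sums:
  assumes "approx s f"
  shows "(\<lambda>i. vec_norm space (\<lambda>n. f n - lin (k n) (s i))) \<longlonglongrightarrow> 0"
  unfolding LIMSEQ_def dist_real_def
proof (intro allI impI)
  fix e :: real assume "e > 0"
  then have "e / 2 > 0" by simp
  then obtain M where M: "\<And>i j. i \<ge> M \<Longrightarrow> j \<ge> M \<Longrightarrow> N (sub (s i) (s j)) < e / 2"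
    using assms unfolding approx_def cauchy_def by meson
  have "\<bar>vec_norm space (\<lambda>n. f n - lin (k n) (s i)) - 0\<bar> < e" if "i \<ge> M" for i
  proof -
    have lim: "(\<lambda>j. N (sub (s j) (s i))) \<longlonglongrightarrow> vec_norm space (\<lambda>n. f n - lin (k n) (s i))"
      unfolding vec_norm_space by (intro tendsto_norm_inner approx_diff approx_const assms)
    then have "vec_norm space (\<lambda>n. f n - lin (k n) (s i)) \<le> e / 2"
      using M that by (intro LIMSEQ_le_const2[OF lim] exI[of _ M]) (auto intro: less_imp_le)
    moreover have "0 \<le> vec_norm space (\<lambda>n. f n - lin (k n) (s i))"
      by (rule LIMSEQ_le_const[OF lim]) auto
    ultimately show ?thesis using \<open>e > 0\<close> by simp
  qed
  then show "\<exists>no. \<forall>i\<ge>no. \<bar>vec_norm space (\<lambda>n. f n - lin (k n) (s i)) - 0\<bar> < e" by blast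
qed

text \<open>Each \<open>f m\<close> is replaced by a formal sum \<open>t m\<close> at distance less
  than \<open>1 / (m + 1)\<close>. The sequence \<open>t\<close> is Cauchy, and its pointwise limit
  is the limit of \<open>f\<close>.\<close>

lemma space_complete:
  assumes f: "\<And>n. f n \<in> H"
    and cauchy: "\<And>e. e > 0 \<Longrightarrow> \<exists>M. \<forall>m\<ge>M. \<forall>n\<ge>M. vec_norm space (\<lambda>x. f m x - f n x) < e"
  shows "\<exists>g\<in>H. (\<lambda>n. vec_norm space (\<lambda>x. f n x - g x)) \<longlonglongrightarrow> 0"
proof -
  have "\<exists>t. vec_norm space (\<lambda>x. f m x - lin (k x) t) < inverse (real (Suc m))" for m
  proof -
    obtain s where s: "approx s (f m)" using f[of m] by (auto simp: H_def)
    have "inverse (real (Suc m)) > 0" by simp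
    then have "\<forall>\<^sub>F i in sequentially. vec_norm space (\<lambda>x. f m x - lin (k x) (s i)) < inverse (real (Suc m))"
      by (rule order_tendstoD(2)[OF tendsto_formal_sums[OF s]])
    then show ?thesis
      by (auto simp: eventually_sequentially)
  qed
  then obtain t where t: "\<And>m. vec_norm space (\<lambda>x. f m x - lin (k x) (t m)) < inverse (real (Suc m))"
    by metis
  have "cauchy t"
    unfolding cauchy_def
  proof (intro allI impI)
    fix e :: real assume "e > 0"
    then have e3: "e / 3 > 0" by simp
    obtain M1 where M1: "\<And>m n. m \<ge> M1 \<Longrightarrow> n \<ge> M1 \<Longrightarrow> vec_norm space (\<lambda>x. f m x - f n x) < e / 3"
      using cauchy[OF e3] by blast
    obtain M2 where M2: "inverse (real (Suc M2)) < e / 3"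
      using reals_Archimedean[OF e3] by blast
    have small: "vec_norm space (\<lambda>x. f m x - lin (k x) (t m)) < e / 3" if "m \<ge> M2" for m
    proof -
      have "inverse (real (Suc m)) \<le> inverse (real (Suc M2))"
        using that by (intro le_imp_inverse_le) auto
      then show ?thesis using t[of m] M2 by linarith
    qed
    have "N (sub (t m) (t n)) < e" if "m \<ge> max M1 M2" "n \<ge> max M1 M2" for m n
    proof -
      have "N (sub (t m) (t n)) = vec_norm space (\<lambda>x. lin (k x) (t m) - lin (k x) (t n))"
        by (simp add: vec_norm_lin)
      also have "\<dots> \<le> vec_norm space (\<lambda>x. lin (k x) (t m) - f m x) + vec_norm space (\<lambda>x. f m x - lin (k x) (t n))"
        by (intro vec_norm_diff_triangle H_lin f)
      also have "\<dots> \<le> vec_norm space (\<lambda>x. lin (k x) (t m) - f m x)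
          + (vec_norm space (\<lambda>x. f m x - f n x) + vec_norm space (\<lambda>x. f n x - lin (k x) (t n)))"
        by (intro add_left_mono vec_norm_diff_triangle H_lin f)
      also have "vec_norm space (\<lambda>x. lin (k x) (t m) - f m x) = vec_norm space (\<lambda>x. f m x - lin (k x) (t m))"
        by (intro vec_norm_diff_commute H_lin f)
      finally show ?thesis
        using small[of m] small[of n] M1[of m n] that by auto
    qed
    then show "\<exists>M. \<forall>i\<ge>M. \<forall>j\<ge>M. N (sub (t i) (t j)) < e" by blast
  qed
  have "convergent (\<lambda>j. lin (k n) (t j))" for n
  proof -
    have "cauchy (\<lambda>_. [(1, n)])" using approx_const by (auto simp: approx_def)
    then have "convergent (\<lambda>j. B [(1, n)] (t j))"
      using \<open>cauchy t\<close> by (rule convergent_B)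
    then show ?thesis by simp
  qed
  then have g: "approx t (\<lambda>n. lim (\<lambda>j. lin (k n) (t j)))" (is "approx t ?g")
    using \<open>cauchy t\<close> by (auto simp: approx_def convergent_LIMSEQ_iff)
  then have "?g \<in> H" by (auto simp: H_def)
  have "(\<lambda>n. inverse (real (Suc n)) + vec_norm space (\<lambda>x. ?g x - lin (k x) (t n))) \<longlonglongrightarrow> 0 + 0"
    by (intro tendsto_add LIMSEQ_inverse_real_of_nat tendsto_formal_sums g)
  then have lim: "(\<lambda>n. inverse (real (Suc n)) + vec_norm space (\<lambda>x. ?g x - lin (k x) (t n))) \<longlonglongrightarrow> 0"
    by simp
  have "norm (vec_norm space (\<lambda>x. f n x - ?g x)) \<le> inverse (real (Suc n)) + vec_norm space (\<lambda>x. ?g x - lin (k x) (t n))" for n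
  proof -
    have "vec_norm space (\<lambda>x. f n x - ?g x)
        \<le> vec_norm space (\<lambda>x. f n x - lin (k x) (t n)) + vec_norm space (\<lambda>x. lin (k x) (t n) - ?g x)"
      by (intro vec_norm_diff_triangle H_lin f \<open>?g \<in> H\<close>)
    also have "vec_norm space (\<lambda>x. lin (k x) (t n) - ?g x) = vec_norm space (\<lambda>x. ?g x - lin (k x) (t n))"
      by (intro vec_norm_diff_commute H_lin \<open>?g \<in> H\<close>)
    finally have "vec_norm space (\<lambda>x. f n x - ?g x) \<le> inverse (real (Suc n)) + vec_norm space (\<lambda>x. ?g x - lin (k x) (t n))"
      using t[of n] by linarith
    moreover have "vec_norm space (\<lambda>x. f n x - ?g x) \<ge> 0"
      unfolding vec_norm_space using inner_self(2)[OF H_diff[OF f \<open>?g \<in> H\<close>]] by simp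
    ultimately show ?thesis by simp
  qed
  note le = this
  have lim0: "(\<lambda>n. vec_norm space (\<lambda>x. f n x - ?g x)) \<longlonglongrightarrow> 0"
    by (rule Lim_null_comparison[OF always_eventually lim]) (use le in auto)
  show ?thesis
    by (rule bexI[of _ ?g]) (rule lim0, fact)
qed

theorem complex_hilbert_space_space: "complex_hilbert_space space"
proof (intro complex_hilbert_space.intro module_space complex_hilbert_space_axioms.intro)
  fix u v w assume "u \<in> carrier space" "v \<in> carrier space" "w \<in> carrier space"
  then obtain a b c where abc: "approx a u" "approx b v" "approx c w" by (auto simp: H_def)
  have "(\<lambda>j. B (a j) (b j @ c j)) \<longlonglongrightarrow> inner u (\<lambda>n. v n + w n)"
    by (intro tendsto_inner approx_add abc)
  moreover have "(\<lambda>j. B (a j) (b j) + B (a j) (c j)) \<longlonglongrightarrow> inner u v + inner u w"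
    by (intro tendsto_add tendsto_inner abc)
  ultimately show "inner_prod space u (v \<oplus>\<^bsub>space\<^esub> w) = inner_prod space u v + inner_prod space u w"
    using LIMSEQ_unique by auto
next
  fix u v c assume "u \<in> carrier space" "v \<in> carrier space"
  then obtain a b where ab: "approx a u" "approx b v" by (auto simp: H_def)
  have "(\<lambda>j. B (a j) (scale c (b j))) \<longlonglongrightarrow> inner u (\<lambda>n. c * v n)"
    by (intro tendsto_inner approx_scale ab)
  moreover have "(\<lambda>j. c * B (a j) (b j)) \<longlonglongrightarrow> c * inner u v"
    by (intro tendsto_mult_left tendsto_inner ab)
  ultimately show "inner_prod space u (c \<odot>\<^bsub>space\<^esub> v) = c * inner_prod space u v"
    using LIMSEQ_unique by auto
next
  fix u v assume "u \<in> carrier space" "v \<in> carrier space"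
  then obtain a b where ab: "approx a u" "approx b v" by (auto simp: H_def)
  have "(\<lambda>j. B (b j) (a j)) \<longlonglongrightarrow> inner v u"
    by (intro tendsto_inner ab)
  moreover have "(\<lambda>j. B (b j) (a j)) \<longlonglongrightarrow> cnj (inner u v)"
    unfolding B_hermitian[of "b _" "a _"] by (intro tendsto_cnj tendsto_inner ab)
  ultimately show "inner_prod space v u = cnj (inner_prod space u v)"
    using LIMSEQ_unique by simp
next
  fix v assume v: "v \<in> carrier space" "v \<noteq> \<zero>\<^bsub>space\<^esub>"
  then show "0 < Re (inner_prod space v v)"
    using inner_self[of v] inner_self_eq_0[of v] by fastforce
next
  fix f :: "nat \<Rightarrow> nat \<Rightarrow> complex"
  assume f: "\<And>n. f n \<in> carrier space"
    and cauchy: "\<And>e. 0 < e \<Longrightarrow> \<exists>M. \<forall>m\<ge>M. \<forall>n\<ge>M. vec_norm space (f m \<ominus>\<^bsub>space\<^esub> f n) < e"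
  have f': "f n \<in> H" for n using f by simp
  obtain g where "g \<in> H" "(\<lambda>n. vec_norm space (\<lambda>x. f n x - g x)) \<longlonglongrightarrow> 0"
    using space_complete[of f] cauchy f' by (auto simp: a_minus_space)
  then show "\<exists>x\<in>carrier space. (\<lambda>n. vec_norm space (f n \<ominus>\<^bsub>space\<^esub> x)) \<longlonglongrightarrow> 0"
    using f' by (intro bexI[of _ g]) (simp_all add: a_minus_space)
qed

lemma reproducing:
  assumes "f \<in> H"
  shows "inner (\<lambda>n. k n m) f = f m"
proof -
  obtain s where s: "approx s f" using assms by (auto simp: H_def)
  have "approx (\<lambda>_. [(1, m)]) (\<lambda>n. k n m)"
    using approx_const[of "[(1, m)]"] by simp
  from tendsto_inner[OF this s] have "(\<lambda>j. lin (k m) (s j)) \<longlonglongrightarrow> inner (\<lambda>n. k n m) f"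
    by simp
  then show ?thesis using s LIMSEQ_unique by (auto simp: approx_def)
qed

lemma kernel_in_H: "(\<lambda>n. k n m) \<in> H"
  using H_lin[of "[(1, m)]"] by simp

text \<open>Every vector is a pointwise limit of combinations of kernel columns, so it inherits each
  linear relation between kernel rows.\<close>

lemma H_relation:
  assumes "f \<in> H" "\<And>j. (\<Sum>a\<in>A. k (m a) j) = k m' j"
  shows "(\<Sum>a\<in>A. f (m a)) = f m'"
proof -
  obtain s where s: "approx s f" using assms by (auto simp: H_def)
  have "(\<Sum>a\<in>A. lin (k (m a)) t) = lin (k m') t" for t
    by (induction t) (auto simp: assms(2) sum.distrib simp flip: sum_distrib_left)
  moreover have "(\<lambda>j. \<Sum>a\<in>A. lin (k (m a)) (s j)) \<longlonglongrightarrow> (\<Sum>a\<in>A. f (m a))"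
    using s by (intro tendsto_sum) (simp add: approx_def)
  ultimately have "(\<lambda>j. lin (k m') (s j)) \<longlonglongrightarrow> (\<Sum>a\<in>A. f (m a))" by simp
  moreover have "(\<lambda>j. lin (k m') (s j)) \<longlonglongrightarrow> f m'"
    using s by (simp add: approx_def)
  ultimately show ?thesis by (rule LIMSEQ_unique)
qed

lemma finsum_space:
  assumes "finite A" "\<And>a. a \<in> A \<Longrightarrow> g a \<in> H"
  shows "finsum space g A = (\<lambda>n. \<Sum>a\<in>A. g a n)"
  using assms
proof (induction A rule: finite_induct)
  interpret abelian_group space by (rule abelian_group_space)
  case empty
  show ?case by simp
next
  interpret abelian_group space by (rule abelian_group_space)
  case (insert a A)
  then show ?case by (subst finsum_insert) auto
qed

text \<open>Evaluation at \<open>n\<close> is the inner product with the column of \<open>n\<close>,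
  so relabelling indices by \<open>L\<close> corresponds to composing functions with
  \<open>L\<close>. Symmetry of the kernel under \<open>L\<close> makes this operation
  self-adjoint.\<close>

lemma projection_shift:
  assumes sym: "\<And>m n. k (L m) n = k m (L n)" and idem: "\<And>m. k (L (L m)) = k (L m)"
  shows "projection space (\<lambda>f n. f (L n))"
proof -
  define relabel where "relabel s = map (\<lambda>(c, n). (c, L n)) s" for s :: "(complex \<times> nat) list"
  have lin_relabel: "lin g (relabel s) = lin (\<lambda>n. g (L n)) s" for g s
    by (induction s) (auto simp: relabel_def)
  have lin_k: "lin (k n) (relabel s) = lin (k (L n)) s" for n s
    by (simp add: lin_relabel flip: sym)
  have B_relabel: "B (relabel s) t = B s (relabel t)" for s t
    by (simp add: B_def lin_relabel lin_k flip: sym)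
  \<comment> \<open>For a symmetric idempotent \<open>P\<close>, the squared norm of
    \<open>P s\<close> is \<open>B s (P s)\<close>, and Cauchy-Schwarz gives contractivity; no
    boundedness has to be assumed.\<close>
  have N_relabel: "N (relabel s) \<le> N s" for s
  proof -
    have "lin (k n) (relabel (relabel s)) = lin (k n) (relabel s)" for n
      by (simp add: lin_k idem)
    then have "B (relabel s) (relabel s) = B s (relabel s)"
      unfolding B_relabel by (simp add: B_def)
    then have "complex_of_real ((N (relabel s))\<^sup>2) = B s (relabel s)"
      by (simp only: B_self)
    then have "(N (relabel s))\<^sup>2 = cmod (B s (relabel s))"
      by (metis abs_of_nonneg norm_of_real zero_le_power2)
    then have "(N (relabel s))\<^sup>2 \<le> N s * N (relabel s)"
      using Cauchy_Schwarz[of s "relabel s"] by simp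
    then show ?thesis
      using N_nonneg[of "relabel s"] by (cases "N (relabel s) = 0") (auto simp: power2_eq_square)
  qed
  have approx_relabel: "approx (\<lambda>j. relabel (s j)) (\<lambda>n. f (L n))" if "approx s f" for s f
  proof -
    have "N (sub (relabel (s i)) (relabel (s j))) \<le> N (sub (s i) (s j))" for i j
    proof -
      have "sub (relabel (s i)) (relabel (s j)) = relabel (sub (s i) (s j))"
        by (simp add: relabel_def scale_def split_beta o_def)
      then show ?thesis using N_relabel by metis
    qed
    then have "cauchy (\<lambda>j. relabel (s j))"
      using that unfolding approx_def cauchy_def by (meson order_le_less_trans)
    then show ?thesis using that by (simp add: approx_def lin_k)
  qed
  then have mem: "(\<lambda>n. f (L n)) \<in> H" if "f \<in> H" for f
    using that by (auto simp: H_def)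
  show ?thesis
    unfolding projection_def bounded_operator_def
  proof (intro conjI ballI allI exI[of _ 1])
    show "(\<lambda>f n. f (L n)) \<in> carrier space \<rightarrow> carrier space"
      using mem by auto
    fix v assume "v \<in> carrier space"
    then have v: "v \<in> H" by simp
    then obtain s where s: "approx s v" by (auto simp: H_def)
    have "vec_norm space (\<lambda>n. v (L n)) \<le> vec_norm space v"
      unfolding vec_norm_space
      by (rule LIMSEQ_le[OF tendsto_norm_inner[OF approx_relabel[OF s]] tendsto_norm_inner[OF s]])
         (use N_relabel in auto)
    then show "vec_norm space (\<lambda>n. v (L n)) \<le> 1 * vec_norm space v" by simp
    show "(\<lambda>n. v (L (L n))) = (\<lambda>n. v (L n))"
    proof
      fix n show "v (L (L n)) = v (L n)"
        using H_relation[OF v, where A = "{()}" and m = "\<lambda>_. L (L n)" and m' = "L n"] by (simp add: idem)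
    qed
    fix w assume "w \<in> carrier space"
    then obtain t where t: "approx t w" by (auto simp: H_def)
    have "(\<lambda>j. B (relabel (s j)) (t j)) \<longlonglongrightarrow> inner (\<lambda>n. v (L n)) w"
      by (intro tendsto_inner approx_relabel s t)
    moreover have "(\<lambda>j. B (s j) (relabel (t j))) \<longlonglongrightarrow> inner v (\<lambda>n. w (L n))"
      by (intro tendsto_inner approx_relabel s t)
    ultimately show "inner_prod space (\<lambda>n. v (L n)) w = inner_prod space v (\<lambda>n. w (L n))"
      using LIMSEQ_unique by (auto simp: B_relabel)
  qed auto
qed

text \<open>The operator of an answer taken from the same graph as the question.\<close>

lemma projection_zero: "projection space (\<lambda>_ _. 0)"
proof -
  have zero: "inner f (\<lambda>_. 0) = 0" "inner (\<lambda>_. 0) f = 0" if f: "f \<in> H" for f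
  proof -
    obtain s where s: "approx s f" using f by (auto simp: H_def)
    have z: "approx (\<lambda>_. []) (\<lambda>_. 0)" using approx_const[of "[]"] by simp
    have "B t [] = 0" for t by (simp add: B_hermitian[of t "[]"])
    then show "inner f (\<lambda>_. 0) = 0" "inner (\<lambda>_. 0) f = 0"
      using tendsto_inner[OF s z] tendsto_inner[OF z s] by (simp_all add: LIMSEQ_const_iff)
  qed
  show ?thesis
    unfolding projection_def bounded_operator_def
    by (auto simp: zero H_zero vec_norm_def intro!: exI[of _ 0])
qed

end


section \<open>The quantum commuting strategy\<close>

context magic_unitary
begin

lemma trace_word_append_commute:
  "\<lbrakk>set ps \<subseteq> V \<times> W; set qs \<subseteq> V \<times> W\<rbrakk> \<Longrightarrow> trace_word (ps @ qs) = trace_word (qs @ ps)"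
proof (induction ps arbitrary: qs)
  case (Cons p ps)
  then have "trace_word (p # (ps @ qs)) = trace_word ((ps @ qs) @ [p])"
    by (intro trace_word_rotate[symmetric]) auto
  also have "\<dots> = trace_word (ps @ (qs @ [p]))" by simp
  also have "\<dots> = trace_word ((qs @ [p]) @ ps)"
    using Cons.prems by (intro Cons.IH) auto
  finally show ?case by simp
qed simp

definition enum :: "nat \<Rightarrow> ('x \<times> 'y) list" where
  "enum = from_nat_into (lists (V \<times> W))"

definition index :: "('x \<times> 'y) list \<Rightarrow> nat" where
  "index = to_nat_on (lists (V \<times> W))"

text \<open>The form \<open>tau (a * star b)\<close> on words; the star of a word in self-adjoint
  letters is its reversal.\<close>

definition kernel :: "nat \<Rightarrow> nat \<Rightarrow> complex" where
  "kernel m n = trace_word (enum m @ rev (enum n))"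

definition shift_left :: "'x \<times> 'y \<Rightarrow> nat \<Rightarrow> nat" where
  "shift_left p n = index (p # enum n)"

definition shift_right :: "'x \<times> 'y \<Rightarrow> nat \<Rightarrow> nat" where
  "shift_right p n = index (enum n @ [p])"

lemma set_enum: "set (enum n) \<subseteq> V \<times> W"
proof -
  have "enum n \<in> lists (V \<times> W)"
    unfolding enum_def by (rule from_nat_into) auto
  then show ?thesis by auto
qed

lemma enum_index:
  assumes "set ps \<subseteq> V \<times> W"
  shows "enum (index ps) = ps"
proof -
  have "countable (lists (V \<times> W))"
    using finite_V finite_W by (simp add: countable_finite)
  moreover have "ps \<in> lists (V \<times> W)" using assms by auto
  ultimately show ?thesis by (simp add: enum_def index_def)
qed

lemma enum_shift:
  assumes "p \<in> V \<times> W"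
  shows "enum (shift_left p n) = p # enum n" "enum (shift_right p n) = enum n @ [p]"
  using assms set_enum[of n] by (simp_all add: shift_left_def shift_right_def enum_index)

lemma shift_commute:
  assumes "p \<in> V \<times> W" "q \<in> V \<times> W"
  shows "shift_left p (shift_right q n) = shift_right q (shift_left p n)"
  using assms by (simp add: shift_left_def[of p "shift_right q n"] shift_right_def[of q "shift_left p n"] enum_shift)

text \<open>Over a nonempty alphabet there are infinitely many words, so the enumeration has no
  repetitions and positivity passes from sets of words to sets of indices.\<close>

lemma inj_enum:
  assumes "x0 \<in> V" "y0 \<in> W"
  shows "inj enum"
proof -
  have "range (\<lambda>n. replicate n (x0, y0)) \<subseteq> lists (V \<times> W)"
    using assms by auto
  moreover have "infinite (range (\<lambda>n. replicate n (x0, y0)))"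
    by (rule range_inj_infinite) (auto simp: inj_on_def dest: arg_cong[of _ _ length])
  ultimately have "infinite (lists (V \<times> W))"
    using finite_subset by blast
  moreover have "countable (lists (V \<times> W))"
    using finite_V finite_W by (simp add: countable_finite)
  ultimately show ?thesis
    unfolding enum_def using bij_betw_from_nat_into bij_betw_imp_inj_on by blast
qed

lemma psd_kernel_kernel:
  assumes "x0 \<in> V" "y0 \<in> W"
  shows "psd_kernel kernel"
proof
  fix A :: "nat set" and c :: "nat \<Rightarrow> complex"
  assume "finite A"
  note inj = inj_enum[OF assms]
  have "(\<Sum>p\<in>enum ` A. \<Sum>q\<in>enum ` A. cnj (c (inv_into UNIV enum p)) * c (inv_into UNIV enum q) * trace_word (p @ rev q)) \<in> \<real>\<^sub>\<ge>\<^sub>0"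
    using \<open>finite A\<close> set_enum by (intro trace_word_psd[OF assms(1)]) auto
  also have "(\<Sum>p\<in>enum ` A. \<Sum>q\<in>enum ` A. cnj (c (inv_into UNIV enum p)) * c (inv_into UNIV enum q) * trace_word (p @ rev q))
      = (\<Sum>m\<in>A. \<Sum>n\<in>A. cnj (c m) * c n * kernel m n)"
    by (simp add: sum.reindex inj_on_subset[OF inj] inv_f_f[OF inj] kernel_def)
  finally show "(\<Sum>m\<in>A. \<Sum>n\<in>A. cnj (c m) * c n * kernel m n) \<in> \<real>\<^sub>\<ge>\<^sub>0" .
qed

text \<open>Symmetry uses traciality: on the right the letter ends up at the end of the word and has
  to be rotated to the front.\<close>

lemma kernel_shift_left:
  assumes "p \<in> V \<times> W"
  shows "kernel (shift_left p m) n = kernel m (shift_left p n)"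
    and "kernel (shift_left p (shift_left p m)) = kernel (shift_left p m)"
proof -
  show "kernel (shift_left p m) n = kernel m (shift_left p n)"
    using trace_word_rotate[OF assms, of "enum m @ rev (enum n)"] set_enum assms
    by (simp add: kernel_def enum_shift)
  show "kernel (shift_left p (shift_left p m)) = kernel (shift_left p m)"
  proof
    fix n show "kernel (shift_left p (shift_left p m)) n = kernel (shift_left p m) n"
      using trace_word_dup[OF assms, of "enum m @ rev (enum n)"] set_enum assms
      by (simp add: kernel_def enum_shift)
  qed
qed

text \<open>Symmetry is immediate here; for idempotence the doubled letter stands in the middle of
  the word and is first brought to the front cyclically.\<close>

lemma kernel_shift_right:
  assumes "p \<in> V \<times> W"
  shows "kernel (shift_right p m) n = kernel m (shift_right p n)"
    and "kernel (shift_right p (shift_right p m)) = kernel (shift_right p m)"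
proof -
  show "kernel (shift_right p m) n = kernel m (shift_right p n)"
    using assms by (simp add: kernel_def enum_shift)
  show "kernel (shift_right p (shift_right p m)) = kernel (shift_right p m)"
  proof
    fix n
    have "trace_word (enum m @ (p # p # rev (enum n))) = trace_word ((p # p # rev (enum n)) @ enum m)"
      "trace_word (enum m @ (p # rev (enum n))) = trace_word ((p # rev (enum n)) @ enum m)"
      using set_enum assms by (intro trace_word_append_commute; simp)+
    then show "kernel (shift_right p (shift_right p m)) n = kernel (shift_right p m) n"
      using trace_word_dup[OF assms, of "rev (enum n) @ enum m"] set_enum assms
      by (simp add: kernel_def enum_shift)
  qed
qed

lemma kernel_shift_left_sum:
  shows "x \<in> V \<Longrightarrow> (\<Sum>y\<in>W. kernel (shift_left (x, y) m) n) = kernel m n"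
    and "y \<in> W \<Longrightarrow> (\<Sum>x\<in>V. kernel (shift_left (x, y) m) n) = kernel m n"
  using trace_word_row_sum[of x "enum m @ rev (enum n)"] trace_word_column_sum[of y "enum m @ rev (enum n)"]
    set_enum by (simp_all add: kernel_def enum_shift)

lemma kernel_shift_right_eq:
  assumes "p \<in> V \<times> W"
  shows "kernel (shift_right p m) n = trace_word (p # rev (enum n) @ enum m)"
  using assms set_enum trace_word_append_commute[of "enum m" "p # rev (enum n)"]
  by (simp add: kernel_def enum_shift)

lemma kernel_shift_right_sum:
  shows "x \<in> V \<Longrightarrow> (\<Sum>y\<in>W. kernel (shift_right (x, y) m) n) = kernel m n"
    and "y \<in> W \<Longrightarrow> (\<Sum>x\<in>V. kernel (shift_right (x, y) m) n) = kernel m n"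
  using trace_word_row_sum[of x "rev (enum n) @ enum m"] trace_word_column_sum[of y "rev (enum n) @ enum m"]
    trace_word_append_commute[of "enum m" "rev (enum n)"] set_enum
  by (simp_all add: kernel_shift_right_eq) (simp_all add: kernel_def)

end

text \<open>Asking \<open>g\<close> and hearing \<open>h\<close>, or the reverse, is the same event
  and gets the same projection; this makes the row sums and column sums of the magic unitary the two
  completeness relations.\<close>

fun answer_operator ::
    "('v \<times> 'w \<Rightarrow> nat \<Rightarrow> nat) \<Rightarrow> 'v + 'w \<Rightarrow> 'v + 'w \<Rightarrow> (nat \<Rightarrow> complex) \<Rightarrow> nat \<Rightarrow> complex" where
  "answer_operator L (Inl g) (Inr h) = (\<lambda>f n. f (L (g, h) n))"
| "answer_operator L (Inr h) (Inl g) = (\<lambda>f n. f (L (g, h) n))"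
| "answer_operator L _ _ = (\<lambda>_ _. 0)"

lemma answer_operator_cases:
  obtains g h where "{x, a} = {Inl g, Inr h}" "\<And>L. answer_operator L x a = (\<lambda>f n. f (L (g, h) n))"
  | "\<And>L. answer_operator L x a = (\<lambda>_ _. 0)"
  by (cases x; cases a) (auto simp: insert_commute)

text \<open>A question from the first graph is answered along a row and one from the second graph
  along a column; \<open>H_relation\<close> carries the corresponding sum relation from the kernel
  to all vectors.\<close>

lemma (in psd_kernel) pvm_answer_operator:
  fixes L :: "'v \<times> 'w \<Rightarrow> nat \<Rightarrow> nat"
  assumes fin: "finite V" "finite W"
    and sym: "\<And>p m n. p \<in> V \<times> W \<Longrightarrow> k (L p m) n = k m (L p n)"
    and idem: "\<And>p m. p \<in> V \<times> W \<Longrightarrow> k (L p (L p m)) = k (L p m)"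
    and rows: "\<And>g m n. g \<in> V \<Longrightarrow> (\<Sum>h\<in>W. k (L (g, h) m) n) = k m n"
    and cols: "\<And>h m n. h \<in> W \<Longrightarrow> (\<Sum>g\<in>V. k (L (g, h) m) n) = k m n"
    and x: "x \<in> Inl ` V \<union> Inr ` W"
  shows "pvm space (Inl ` V \<union> Inr ` W) (answer_operator L x)"
  unfolding pvm_def
proof (intro conjI ballI)
  let ?A = "Inl ` V \<union> Inr ` W"
  show "finite ?A" using fin by simp
  show proj: "projection space (answer_operator L x a)" if "a \<in> ?A" for a
    using x that by (auto intro!: projection_zero projection_shift sym idem)
  fix v assume "v \<in> carrier space"
  then have v: "v \<in> H" by simp
  have mem: "answer_operator L x a v \<in> H" if "a \<in> ?A" for a
    using proj[OF that] v by (auto simp: projection_def bounded_operator_def)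
  have "(\<Oplus>\<^bsub>space\<^esub>a\<in>?A. answer_operator L x a v) = (\<lambda>n. \<Sum>a\<in>?A. answer_operator L x a v n)"
    using fin mem by (intro finsum_space) auto
  also have "\<dots> = v"
  proof
    fix n
    have "(\<Sum>a\<in>?A. answer_operator L x a v n)
        = (\<Sum>g\<in>V. answer_operator L x (Inl g) v n) + (\<Sum>h\<in>W. answer_operator L x (Inr h) v n)"
      using fin by (subst sum.union_disjoint) (auto simp: sum.reindex)
    also have "\<dots> = v n"
    proof -
      consider (row) g where "x = Inl g" "g \<in> V" | (column) h where "x = Inr h" "h \<in> W"
        using x by auto
      then show ?thesis
      proof cases
        case row
        then show ?thesis
          using H_relation[OF v, where A = W and m = "\<lambda>h. L (g, h) n" and m' = n] by (simp add: rows)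
      next
        case column
        then show ?thesis
          using H_relation[OF v, where A = V and m = "\<lambda>g. L (g, h) n" and m' = n] by (simp add: cols)
      qed
    qed
    finally show "(\<Sum>a\<in>?A. answer_operator L x a v n) = v n" .
  qed
  finally show "(\<Oplus>\<^bsub>space\<^esub>a\<in>?A. answer_operator L x a v) = v" .
qed

text \<open>The first player multiplies on the left and the second on the right, so their operators
  commute by associativity. A vertex in each graph supplies a letter for padding words and makes the
  set of words infinite.\<close>

theorem qc_isomorphic_if_magic_unitary:
  fixes G :: "'v pair_pre_digraph" and G' :: "'w pair_pre_digraph"
  assumes magic: "magic_unitary (pverts G) (pverts G') U"
    and intertwines: "intertwines_graphs G G' U"
    and ne: "g0 \<in> pverts G" "h0 \<in> pverts G'"
  shows "qc_isomorphic G G'"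
proof -
  interpret magic_unitary "pverts G" "pverts G'" U by (rule magic)
  interpret psd_kernel kernel by (rule psd_kernel_kernel[OF ne])
  let ?V = "pverts G" and ?W = "pverts G'"
  let ?A = "Inl ` pverts G \<union> Inr ` pverts G'"
  let ?E = "answer_operator shift_left" and ?F = "answer_operator shift_right"
  define n0 where "n0 = index []"
  define \<psi> where "\<psi> = (\<lambda>n. kernel n n0)"
  have n0: "enum n0 = []" by (simp add: n0_def enum_index)
  have \<psi>: "\<psi> \<in> H" unfolding \<psi>_def by (rule kernel_in_H)
  have E: "pvm space ?A (?E x)" if "x \<in> ?A" for x
    by (rule pvm_answer_operator[OF finite_V finite_W])
       (use that in \<open>auto intro: kernel_shift_left kernel_shift_left_sum\<close>)
  have F: "pvm space ?A (?F x)" if "x \<in> ?A" for x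
    by (rule pvm_answer_operator[OF finite_V finite_W])
       (use that in \<open>auto intro: kernel_shift_right kernel_shift_right_sum\<close>)
  have closed: "?E x a v \<in> H" "?F x a v \<in> H" if "x \<in> ?A" "a \<in> ?A" "v \<in> H" for x a v
    using E[OF that(1)] F[OF that(1)] that
    by (auto simp: pvm_def projection_def bounded_operator_def Pi_iff)
  have commute: "?E x a (?F y b v) = ?F y b (?E x a v)"
    if "x \<in> ?A" "a \<in> ?A" "y \<in> ?A" "b \<in> ?A" for x a y b v
  proof (cases rule: answer_operator_cases[of x a])
    case (1 g h)
    then have p: "(g, h) \<in> ?V \<times> ?W" using that by (auto simp: doubleton_eq_iff)
    note one = 1
    show ?thesis
    proof (cases rule: answer_operator_cases[of y b])
      case (1 g' h')
      then have "(g', h') \<in> ?V \<times> ?W" using that by (auto simp: doubleton_eq_iff)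
      then show ?thesis
        using p by (simp add: one 1 shift_commute)
    next
      case 2
      then show ?thesis using one by simp
    qed
  next
    case 2
    then show ?thesis by (cases rule: answer_operator_cases[of y b]) auto
  qed
  have lose: "inner \<psi> (?E x a (?F y b \<psi>)) = 0"
    if mem: "x \<in> ?A" "y \<in> ?A" "a \<in> ?A" "b \<in> ?A"
      and lose: "\<not> wins (graph_isomorphism_game G G') x y a b" for x y a b
  proof -
    \<comment> \<open>\<open>\<psi>\<close> is the kernel column of the empty word, so pairing with
      it is evaluation at the index \<open>n0\<close> of that word.\<close>
    have eval: "inner \<psi> (?E x a (?F y b \<psi>)) = ?E x a (?F y b \<psi>) n0"
      unfolding \<psi>_def by (rule reproducing) (use closed mem \<psi> in \<open>simp add: \<psi>_def\<close>)
    show ?thesis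
    proof (cases rule: answer_operator_cases[of x a])
      case (1 g h)
      then have p: "g \<in> ?V" "h \<in> ?W" using mem by (auto simp: doubleton_eq_iff)
      note one = 1
      show ?thesis
      proof (cases rule: answer_operator_cases[of y b])
        case (1 g' h')
        then have q: "g' \<in> ?V" "h' \<in> ?W" using mem by (auto simp: doubleton_eq_iff)
        have "?E x a (?F y b \<psi>) n0 = trace_word [(g, h), (g', h')]"
          using p q by (simp add: one 1 \<psi>_def kernel_def enum_shift n0)
        also have "\<dots> = 0"
        proof (cases "(g = g') = (h = h')")
          case False
          show ?thesis
            by (rule trace_word_eq_0[where r = "(=)" and r' = "(=)"])
               (use False p q U_row_orthogonal U_column_orthogonal in auto)
        next
          case True
          \<comment> \<open>Equality is respected in this case, so the pair of answers can lose only
            through adjacency.\<close>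
          then have "((g, g') \<in> parcs G) \<noteq> ((h, h') \<in> parcs G')"
            using lose one(1) 1(1) by (auto simp: graph_isomorphism_game_def)
          then show ?thesis
            by (intro trace_word_eq_0[where r = "\<lambda>g g'. (g, g') \<in> parcs G" and r' = "\<lambda>h h'. (h, h') \<in> parcs G'"])
               (use p q intertwines in \<open>auto simp: intertwines_graphs_def\<close>)
        qed
        finally show ?thesis using eval by simp
      next
        case 2
        then show ?thesis using eval one by simp
      qed
    next
      case 2
      then show ?thesis using eval by simp
    qed
  qed
  have norm: "vec_norm space \<psi> = 1"
  proof -
    have "inner \<psi> \<psi> = \<psi> n0" unfolding \<psi>_def by (rule reproducing[OF kernel_in_H])
    then show ?thesis by (simp add: vec_norm_space \<psi>_def kernel_def n0)
  qed
  have "perfect_qc_strategy (graph_isomorphism_game G G') space \<psi> ?E ?F"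
    unfolding perfect_qc_strategy_def
  proof (intro conjI ballI impI)
    show "complex_hilbert_space space" by (rule complex_hilbert_space_space)
    show "\<psi> \<in> carrier space" using \<psi> by simp
    show "vec_norm space \<psi> = 1" by (rule norm)
  qed (use E F commute lose in \<open>simp_all add: graph_isomorphism_game_def\<close>)
  then show ?thesis
    unfolding qc_isomorphic_def has_perfect_qc_strategy_def by blast
qed

theorem corollary6p2:
  fixes H H' :: "complex^'n^'n" and s :: nat
  assumes "s \<ge> 1"
    and "complex_hadamard H" and "complex_hadamard H'"
    and "\<And>i j. (H $ i $ j) ^ s = 1" and "\<And>i j. (H' $ i $ j) ^ s = 1"
    and "quantum_equivalent_over TYPE('a::unital_cstar_algebra) s H H'"
  shows "qc_isomorphic (hadamard_graph s H) (hadamard_graph s H')"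
proof -
  obtain p q :: "'a^'n^'n" where
    "quantum_reflection_matrix s p" "quantum_reflection_matrix s q"
    "map_matrix (\<lambda>c. c *\<^sub>C 1) H' ** q = p ** map_matrix (\<lambda>c. c *\<^sub>C 1) H"
    using assms(6) by (auto simp: quantum_equivalent_over_def)
  note pq = assms(1) this
  \<comment> \<open>These vertices show that both graphs are nonempty.\<close>
  have "Row i 1 \<in> pverts (hadamard_graph s M)" for i and M :: "complex^'n^'n"
    by (simp add: pverts_hadamard_graph[OF assms(1)])
  then show ?thesis
    by (intro qc_isomorphic_if_magic_unitary[OF magic_unitary_hadamard_magic[OF pq]
        intertwines_hadamard_magic[OF pq]])
qed

end
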